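(* Let $\Omega\subset\mathbb{R}^2$ be a rectangular domain with outer unit normal $\mathbf{n}$, let $v\in H^1(\Omega;\mathbb{R}_+^* )$ be a given reference image, let $\mathbf{d}=\nabla(\log v)$ be the canonical drift vector field associated to $v$, and let the diffusivity be $g(|\mathbf{s}|)=1/|\mathbf{s}|$ with $\mathbf{s}=\nabla u-\mathbf{d}u$. Then a function $u^*:\Omega\to\mathbb{R}_+$ satisfies the steady state equation $$\mathrm{div}\Big(g(|\nabla u^*-\mathbf{d}u^*|)\,(\nabla u^*-\mathbf{d}u^* )\Big)=0\quad\text{on }\Omega$$ with boundary condition $\langle\nabla u^*-\mathbf{d}u^*,\mathbf{n}\rangle=0$ on $\partial\Omega$, if and only if $u^*$ is a stationary point of the energy functional $$E(u):=\int_\Omega\left|\nabla\left(\frac{u}{v}\right)(x)\right|dx.$$ Moreover, if $u^*$ is the steady state of the osmosis evolution $\partial_t u=\mathrm{div}\big(g(|\nabla u-\mathbf{d}u|)(\nabla u-\mathbf{d}u)\big)$ with boundary condition $\langle\nabla u-\mathbf{d}u,\mathbf{n}\rangle=0$ and initial image $f=u(\cdot,0)$, then $u^*$ is a multiplicative rescaling of $v$ where the rescaling constant is the ratio between the average grey values of $f$ and $v$, i.e. $$u^*(x)=\frac{\mu(f)}{\mu(v)}\,v(x),\qquad\forall x\in\Omega.$$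
   Context: $\mathbb{R}_+$ and $\mathbb{R}_+^*$ denote the non-negative and the positive real numbers. For an image $w$ on $\Omega$, $\mu(w):=\frac{1}{|\Omega|}\int_\Omega w(x)\,dx$ is its average grey value. The initial image is $f\in L^\infty(\Omega;\mathbb{R}_+^* )$. The osmosis evolution preserves the average grey value, so a steady state $u^*$ of the evolution started from $f$ satisfies $\mu(u^* )=\mu(f)$. Convention: wherever $\nabla u-\mathbf{d}u=0$, one sets $\frac{\nabla u-\mathbf{d}u}{|\nabla u-\mathbf{d}u|}:=0$. A stationary point of $E$ is a function $u$ at which the first variation of $E$ vanishes, i.e. $\frac{d}{d\eta}E(u+\eta z)\big|_{\eta=0}=0$ for all test functions $z$; since $\nabla(u/v)=(\nabla u-\mathbf{d}u)/v$, the first variation at $u$ in direction $z$ is $\int_\Omega\big\langle\frac{\nabla u-\mathbf{d}u}{|\nabla u-\mathbf{d}u|},\nabla(\tfrac{z}{v})\big\rangle dx$, understood with the convention that $\frac{\nabla u-\mathbf{d}u}{|\nabla u-\mathbf{d}u|}:=0$ wherever $\nabla u-\mathbf{d}u=0$.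
   Formalization: The boundary condition is imposed on the flux g(|s|)s (zero weak normal trace) rather than on s=∇u−du, since the claim fails if s merely vanishes on ∂Ω (v=1, u=1+x₁²/2−x₁³/3 on the unit square); u* is weakly differentiable with E(u* ) finite, and identities hold a.e. *)

theory Defs
  imports "HOL-Analysis.Analysis"
begin

section \<open>Smooth functions and test functions\<close>

definition grad :: "(real^2 \<Rightarrow> real) \<Rightarrow> real^2 \<Rightarrow> real^2" where
  "grad \<phi> x = (\<chi> i. frechet_derivative \<phi> (at x) (axis i 1))"

primrec Ck :: "nat \<Rightarrow> (real^2 \<Rightarrow> real) \<Rightarrow> bool" where
  "Ck 0 \<phi> \<longleftrightarrow> continuous_on UNIV \<phi>"
| "Ck (Suc k) \<phi> \<longleftrightarrow> (\<forall>x. \<phi> differentiable (at x)) \<and> (\<forall>i. Ck k (\<lambda>x. grad \<phi> x $ i))"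

text \<open>Restrictions of functions satisfying the predicate \<open>smooth\<close> to a bounded open set \<open>\<Omega>\<close> are
  the functions that are smooth up to the boundary of \<open>\<Omega>\<close>.\<close>

definition smooth :: "(real^2 \<Rightarrow> real) \<Rightarrow> bool" where
  "smooth \<phi> \<longleftrightarrow> (\<forall>k. Ck k \<phi>)"

definition test_functions :: "(real^2) set \<Rightarrow> (real^2 \<Rightarrow> real) set" where
  "test_functions \<Omega> = {\<phi>. smooth \<phi> \<and> compact (closure (support_on UNIV \<phi>))
                          \<and> closure (support_on UNIV \<phi>) \<subseteq> \<Omega>}"

section \<open>Weak gradients and the space \<open>H\<^sup>1\<close>\<close>

definition locally_integrable ::
    "(real^2) set \<Rightarrow> (real^2 \<Rightarrow> 'b::{banach, second_countable_topology}) \<Rightarrow> bool" where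
  "locally_integrable \<Omega> w \<longleftrightarrow> (\<forall>K. compact K \<and> K \<subseteq> \<Omega> \<longrightarrow> integrable (lebesgue_on K) w)"

definition has_weak_gradient :: "(real^2) set \<Rightarrow> (real^2 \<Rightarrow> real) \<Rightarrow> (real^2 \<Rightarrow> real^2) \<Rightarrow> bool" where
  "has_weak_gradient \<Omega> w G \<longleftrightarrow> locally_integrable \<Omega> w \<and> locally_integrable \<Omega> G \<and>
     (\<forall>\<phi> \<in> test_functions \<Omega>.
        (\<integral>x. w x *\<^sub>R grad \<phi> x \<partial>lebesgue_on \<Omega>) = - (\<integral>x. \<phi> x *\<^sub>R G x \<partial>lebesgue_on \<Omega>))"

definition weakly_differentiable :: "(real^2) set \<Rightarrow> (real^2 \<Rightarrow> real) \<Rightarrow> bool" where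
  "weakly_differentiable \<Omega> w \<longleftrightarrow> (\<exists>G. has_weak_gradient \<Omega> w G)"

text \<open>A weak gradient is determined only up to a null set; \<open>weak_gradient\<close> picks a representative.\<close>

definition weak_gradient :: "(real^2) set \<Rightarrow> (real^2 \<Rightarrow> real) \<Rightarrow> real^2 \<Rightarrow> real^2" where
  "weak_gradient \<Omega> w = (SOME G. has_weak_gradient \<Omega> w G)"

definition in_H1 :: "(real^2) set \<Rightarrow> (real^2 \<Rightarrow> real) \<Rightarrow> bool" where
  "in_H1 \<Omega> w \<longleftrightarrow> w \<in> borel_measurable (lebesgue_on \<Omega>) \<and>
     integrable (lebesgue_on \<Omega>) (\<lambda>x. (w x)\<^sup>2) \<and> weakly_differentiable \<Omega> w \<and>
     integrable (lebesgue_on \<Omega>) (\<lambda>x. (norm (weak_gradient \<Omega> w x))\<^sup>2)"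

definition in_Linf :: "(real^2) set \<Rightarrow> (real^2 \<Rightarrow> real) \<Rightarrow> bool" where
  "in_Linf \<Omega> w \<longleftrightarrow> w \<in> borel_measurable (lebesgue_on \<Omega>) \<and>
     (\<exists>C. AE x in lebesgue_on \<Omega>. \<bar>w x\<bar> \<le> C)"

definition average_grey_value :: "(real^2) set \<Rightarrow> (real^2 \<Rightarrow> real) \<Rightarrow> real" where
  "average_grey_value \<Omega> w = (1 / measure lebesgue \<Omega>) * (\<integral>x. w x \<partial>lebesgue_on \<Omega>)"

section \<open>Weak divergence and weak normal trace\<close>

definition has_weak_divergence :: "(real^2) set \<Rightarrow> (real^2 \<Rightarrow> real^2) \<Rightarrow> (real^2 \<Rightarrow> real) \<Rightarrow> bool" where
  "has_weak_divergence \<Omega> \<xi> h \<longleftrightarrow> locally_integrable \<Omega> \<xi> \<and> locally_integrable \<Omega> h \<and>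
     (\<forall>\<phi> \<in> test_functions \<Omega>.
        (\<integral>x. \<xi> x \<bullet> grad \<phi> x \<partial>lebesgue_on \<Omega>) = - (\<integral>x. h x * \<phi> x \<partial>lebesgue_on \<Omega>))"

text \<open>By the Gauss--Green formula, for a field \<open>\<xi>\<close> with divergence \<open>h\<close> that is regular up to the
  boundary, this is the integral of \<open>\<phi> \<langle>\<xi>, n\<rangle>\<close> over the boundary of \<open>\<Omega>\<close>, where \<open>n\<close> is the outer
  unit normal. The right-hand side makes sense without boundary regularity of \<open>\<xi>\<close>.\<close>

definition normal_trace ::
    "(real^2) set \<Rightarrow> (real^2 \<Rightarrow> real^2) \<Rightarrow> (real^2 \<Rightarrow> real) \<Rightarrow> (real^2 \<Rightarrow> real) \<Rightarrow> real" where
  "normal_trace \<Omega> \<xi> h \<phi> =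
     (\<integral>x. \<xi> x \<bullet> grad \<phi> x \<partial>lebesgue_on \<Omega>) + (\<integral>x. h x * \<phi> x \<partial>lebesgue_on \<Omega>)"

definition has_zero_normal_trace :: "(real^2) set \<Rightarrow> (real^2 \<Rightarrow> real^2) \<Rightarrow> (real^2 \<Rightarrow> real) \<Rightarrow> bool" where
  "has_zero_normal_trace \<Omega> \<xi> h \<longleftrightarrow> integrable (lebesgue_on \<Omega>) \<xi> \<and> integrable (lebesgue_on \<Omega>) h \<and>
     (\<forall>\<phi>. smooth \<phi> \<longrightarrow> normal_trace \<Omega> \<xi> h \<phi> = 0)"

section \<open>Osmosis with diffusivity \<open>g(s) = 1/s\<close>\<close>

definition diffusivity :: "real \<Rightarrow> real" where
  "diffusivity r = 1 / r"

definition drift_gradient ::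
    "(real^2) set \<Rightarrow> (real^2 \<Rightarrow> real^2) \<Rightarrow> (real^2 \<Rightarrow> real) \<Rightarrow> real^2 \<Rightarrow> real^2" where
  "drift_gradient \<Omega> d u x = weak_gradient \<Omega> u x - u x *\<^sub>R d x"

text \<open>Where \<open>drift_gradient \<Omega> d u x = 0\<close> the flux is \<open>0\<close>, as the convention
  for \<open>s/|s|\<close> requires.\<close>

definition osmosis_flux ::
    "(real^2) set \<Rightarrow> (real^2 \<Rightarrow> real^2) \<Rightarrow> (real^2 \<Rightarrow> real) \<Rightarrow> real^2 \<Rightarrow> real^2" where
  "osmosis_flux \<Omega> d u x = diffusivity (norm (drift_gradient \<Omega> d u x)) *\<^sub>R drift_gradient \<Omega> d u x"

text \<open>The boundary condition \<open>\<langle>\<nabla>u - d u, n\<rangle> = 0\<close> is imposed through the flux: the flux is a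
  positive multiple of \<open>\<nabla>u - d u\<close> (or both vanish), and it is the flux whose divergence exists and
  which therefore has a normal trace.\<close>

definition satisfies_steady_state_equation ::
    "(real^2) set \<Rightarrow> (real^2 \<Rightarrow> real^2) \<Rightarrow> (real^2 \<Rightarrow> real) \<Rightarrow> bool" where
  "satisfies_steady_state_equation \<Omega> d u \<longleftrightarrow> weakly_differentiable \<Omega> u \<and>
     has_weak_divergence \<Omega> (osmosis_flux \<Omega> d u) (\<lambda>x. 0) \<and>
     has_zero_normal_trace \<Omega> (osmosis_flux \<Omega> d u) (\<lambda>x. 0)"

text \<open>Weak evolution, integrated in time: for all \<open>t \<ge> 0\<close> the divergence of the time integral of the
  flux over \<open>[0,t]\<close> is \<open>u(\<cdot>,t) - f\<close>, and its normal trace vanishes. The field \<open>\<xi>\<close> is a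
  representative of the flux that is measurable in space-time; as \<open>weak_gradient\<close> chooses a
  representative separately for every \<open>t\<close>, such a \<open>\<xi>\<close> has to be quantified.\<close>

definition osmosis_evolution ::
    "(real^2) set \<Rightarrow> (real^2 \<Rightarrow> real^2) \<Rightarrow> (real^2 \<Rightarrow> real) \<Rightarrow> (real \<Rightarrow> real^2 \<Rightarrow> real) \<Rightarrow> bool" where
  "osmosis_evolution \<Omega> d f u \<longleftrightarrow>
     (\<forall>t\<ge>0. integrable (lebesgue_on \<Omega>) (u t)) \<and>
     (AE x in lebesgue_on \<Omega>. u 0 x = f x) \<and>
     (\<exists>\<xi>. (\<lambda>p. \<xi> (fst p) (snd p)) \<in> borel_measurable (lebesgue_on ({0<..} \<times> \<Omega>)) \<and>
          (AE t in lebesgue_on {0<..}. weakly_differentiable \<Omega> (u t) \<and>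
             (AE x in lebesgue_on \<Omega>. \<xi> t x = osmosis_flux \<Omega> d (u t) x)) \<and>
          (\<forall>t\<ge>0.
             has_weak_divergence \<Omega> (\<lambda>x. \<integral>\<tau>. \<xi> \<tau> x \<partial>lebesgue_on {0<..t}) (\<lambda>x. u t x - f x) \<and>
             has_zero_normal_trace \<Omega> (\<lambda>x. \<integral>\<tau>. \<xi> \<tau> x \<partial>lebesgue_on {0<..t}) (\<lambda>x. u t x - f x)))"

definition steady_state_of_evolution ::
    "(real^2) set \<Rightarrow> (real^2 \<Rightarrow> real^2) \<Rightarrow> (real^2 \<Rightarrow> real) \<Rightarrow> (real^2 \<Rightarrow> real) \<Rightarrow> bool" where
  "steady_state_of_evolution \<Omega> d f us \<longleftrightarrow>
     satisfies_steady_state_equation \<Omega> d us \<and> integrable (lebesgue_on \<Omega>) us \<and>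
     (\<exists>u. osmosis_evolution \<Omega> d f u \<and>
          ((\<lambda>t. \<integral>x. \<bar>u t x - us x\<bar> \<partial>lebesgue_on \<Omega>) \<longlongrightarrow> 0) at_top)"

section \<open>The energy and its stationary points\<close>

definition energy :: "(real^2) set \<Rightarrow> (real^2 \<Rightarrow> real) \<Rightarrow> (real^2 \<Rightarrow> real) \<Rightarrow> ennreal" where
  "energy \<Omega> v u =
     (if weakly_differentiable \<Omega> (\<lambda>x. u x / v x)
      then \<integral>\<^sup>+ x. ennreal (norm (weak_gradient \<Omega> (\<lambda>x. u x / v x) x)) \<partial>lebesgue_on \<Omega>
      else \<infinity>)"

text \<open>The energy need not be differentiable at \<open>u\<close> where \<open>\<nabla>u - d u\<close> vanishes; the first variation
  is therefore given by its integral formula together with the convention \<open>s/|s| = 0\<close> for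
  \<open>s = 0\<close>, which division by zero provides here. Directions are those of finite energy: \<open>u + \<eta> z\<close>
  then stays in the domain of the energy.\<close>

definition first_variation ::
    "(real^2) set \<Rightarrow> (real^2 \<Rightarrow> real) \<Rightarrow> (real^2 \<Rightarrow> real^2) \<Rightarrow> (real^2 \<Rightarrow> real) \<Rightarrow> (real^2 \<Rightarrow> real) \<Rightarrow> real" where
  "first_variation \<Omega> v d u z =
     (\<integral>x. (drift_gradient \<Omega> d u x /\<^sub>R norm (drift_gradient \<Omega> d u x))
          \<bullet> weak_gradient \<Omega> (\<lambda>x. z x / v x) x \<partial>lebesgue_on \<Omega>)"

definition stationary_point ::
    "(real^2) set \<Rightarrow> (real^2 \<Rightarrow> real) \<Rightarrow> (real^2 \<Rightarrow> real^2) \<Rightarrow> (real^2 \<Rightarrow> real) \<Rightarrow> bool" where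
  "stationary_point \<Omega> v d u \<longleftrightarrow> energy \<Omega> v u < \<infinity> \<and>
     (\<forall>z. energy \<Omega> v z < \<infinity> \<longrightarrow> first_variation \<Omega> v d u z = 0)"

end

theory Submission
  imports Defs
begin

text \<open>
  Write \<open>w = u/v\<close>. The drift \<open>d = \<nabla>(log v)\<close> is made so that \<open>\<nabla>u - d u = v \<nabla>w\<close>, and as \<open>v > 0\<close> the flux
  \<open>\<xi> = s/|s|\<close> with \<open>s = \<nabla>u - d u\<close> is the sign of \<open>\<nabla>w\<close>: a measurable field bounded by \<open>1\<close>, whatever the
  regularity of \<open>u\<close>.

  The steady state equation and its boundary condition together say exactly that
  \<open>\<integral>\<langle>\<xi>, \<nabla>\<phi>\<rangle> = 0\<close> for all \<open>\<phi>\<close> smooth up to the boundary (lemma \<open>steady_state_iff\<close>). Stationarity says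
  that \<open>\<integral>\<langle>\<xi>, \<nabla>(z/v)\<rangle> = 0\<close> for all \<open>z\<close> of finite energy. Taking \<open>z = \<phi> v\<close> shows that stationarity
  is the stronger condition. For the converse, a bounded field that annihilates smooth gradients has
  to annihilate every integrable weak gradient (lemma \<open>divergence_free_pairing\<close>). Here the field is
  regularised instead of the function \<open>z/v\<close>: extended by \<open>0\<close>, \<open>\<xi>\<close> is divergence free on the whole
  plane, since smooth functions on the plane are admissible test functions; shrinking it towards the
  centre of the rectangle and mollifying it gives divergence free fields with compact support in the
  rectangle, against which the definition of a weak gradient can be used. They are bounded by \<open>1\<close>
  and converge to \<open>\<xi>\<close> almost everywhere along a subsequence, so dominated convergence finishes the
  argument.

  For the second assertion let \<open>u\<close> be stationary and take \<open>z = u\<close>. Then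
  \<open>0 = \<integral>\<langle>\<xi>, \<nabla>w\<rangle> = \<integral>|\<nabla>w|\<close>, thus \<open>\<nabla>w = 0\<close> and \<open>u = c v\<close> for a constant \<open>c\<close>
  (lemma \<open>stationary_point_multiple\<close>). Testing the evolution with \<open>\<phi> = 1\<close> shows that mass is conserved,
  and convergence in \<open>L\<^sup>1\<close> carries this over to the limit (lemma \<open>steady_state_mass\<close>); comparing
  integrals determines \<open>c\<close>.

  The identity \<open>\<nabla>u - d u = v \<nabla>w\<close> is the delicate point, because \<open>u\<close>, \<open>w\<close> and \<open>log v\<close> are only
  locally integrable with locally integrable weak gradients, and no product rule applies to
  \<open>u = w exp(log v)\<close>. The two-variable chain rule for functions with bounded derivatives does apply
  (lemma \<open>weak_gradient_chain_rule\<close>). The damped function \<open>arctan(w) / (v + 1/v)\<close> is such a function of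
  \<open>(u, log v)\<close> and also one of \<open>(w, log v)\<close>. Its weak gradient is unique, and comparing the two
  formulas for it gives the identity (lemma \<open>weak_gradient_quotient\<close>).

  All approximation is by convolution with a smooth kernel of compact support, in \<open>L\<^sup>1\<close>
  (lemma \<open>mollify_L1\<close>).
\<close>

section \<open>Calculus of smooth functions\<close>

lemma grad_eqI:
  assumes "(\<phi> has_derivative D) (at x)"
  shows "grad \<phi> x $ i = D (axis i 1)"
  using frechet_derivative_at[OF assms] by (simp add: grad_def)

lemma has_derivative_grad:
  assumes "\<phi> differentiable (at x)"
  shows "(\<phi> has_derivative (\<lambda>h. h \<bullet> grad \<phi> x)) (at x)"
proof -
  let ?D = "frechet_derivative \<phi> (at x)"
  have D: "(\<phi> has_derivative ?D) (at x)"
    using assms frechet_derivative_works by blast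
  then interpret bounded_linear ?D by (rule has_derivative_bounded_linear)
  have "?D h = h \<bullet> grad \<phi> x" for h
  proof -
    have "?D h = ?D (\<Sum>i\<in>UNIV. h $ i *\<^sub>R axis i 1)"
      using basis_expansion[of h] by (simp add: scalar_mult_eq_scaleR)
    also have "\<dots> = (\<Sum>i\<in>UNIV. h $ i * ?D (axis i 1))"
      by (simp add: sum scaleR)
    finally show ?thesis by (simp add: inner_vec_def grad_def)
  qed
  then have "?D = (\<lambda>h. h \<bullet> grad \<phi> x)" by blast
  with D show ?thesis by metis
qed

lemma Ck_imp_continuous: "Ck k \<phi> \<Longrightarrow> continuous_on UNIV \<phi>"
proof (cases k)
  case (Suc m)
  assume "Ck k \<phi>"
  with Suc show ?thesis
    by (metis Ck.simps(2) continuous_at_imp_continuous_on differentiable_imp_continuous_within)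
qed simp

lemma Ck_Suc_imp: "Ck (Suc k) \<phi> \<Longrightarrow> Ck k \<phi>"
proof (induction k arbitrary: \<phi>)
  case 0
  then show ?case by (simp only: Ck.simps(1) Ck_imp_continuous)
next
  case (Suc k)
  then show ?case by (metis Ck.simps(2))
qed

lemma Ck_const: "Ck k (\<lambda>x. c)"
proof (induction k arbitrary: c)
  case (Suc k)
  have "grad (\<lambda>x. c) x $ i = 0" for x i
    by (rule grad_eqI[OF has_derivative_const])
  with Suc[of 0] show ?case by simp
qed simp

lemma Ck_add: "Ck k \<phi> \<Longrightarrow> Ck k \<psi> \<Longrightarrow> Ck k (\<lambda>x. \<phi> x + \<psi> x)"
proof (induction k arbitrary: \<phi> \<psi>)
  case 0
  then show ?case by (simp add: continuous_intros)
next
  case (Suc k)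
  have "grad (\<lambda>x. \<phi> x + \<psi> x) x $ i = grad \<phi> x $ i + grad \<psi> x $ i" for x i
    using Suc.prems
    by (subst grad_eqI[OF has_derivative_add[OF has_derivative_grad has_derivative_grad]])
       (auto simp: inner_axis' )
  with Suc show ?case by (auto intro!: derivative_intros)
qed

lemma grad_mult:
  assumes "\<phi> differentiable (at x)" "\<psi> differentiable (at x)"
  shows "grad (\<lambda>x. \<phi> x * \<psi> x) x = \<phi> x *\<^sub>R grad \<psi> x + \<psi> x *\<^sub>R grad \<phi> x"
  unfolding vec_eq_iff
  by (subst grad_eqI[OF has_derivative_mult[OF has_derivative_grad[OF assms(1)] has_derivative_grad[OF assms(2)]]])
     (simp add: inner_axis' algebra_simps)

lemma Ck_mult: "Ck k \<phi> \<Longrightarrow> Ck k \<psi> \<Longrightarrow> Ck k (\<lambda>x. \<phi> x * \<psi> x)"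
proof (induction k arbitrary: \<phi> \<psi>)
  case 0
  then show ?case by (simp add: continuous_intros)
next
  case (Suc k)
  have "Ck k \<phi>" "Ck k \<psi>" using Suc.prems Ck_Suc_imp by blast+
  then have "Ck k (\<lambda>x. \<phi> x * grad \<psi> x $ i + \<psi> x * grad \<phi> x $ i)" for i
    using Suc by (intro Ck_add Suc.IH) auto
  with Suc.prems show ?case by (auto simp: grad_mult intro!: derivative_intros)
qed

lemma grad_affine:
  assumes "\<And>x. \<phi> differentiable (at x)"
  shows "(\<lambda>x. \<phi> (a *\<^sub>R x + b)) differentiable (at x)"
    "grad (\<lambda>x. \<phi> (a *\<^sub>R x + b)) x = a *\<^sub>R grad \<phi> (a *\<^sub>R x + b)"
proof -
  have *: "((\<lambda>x. \<phi> (a *\<^sub>R x + b)) has_derivative (\<lambda>h. (a *\<^sub>R h) \<bullet> grad \<phi> (a *\<^sub>R x + b))) (at x)"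
    by (rule has_derivative_compose[OF _ has_derivative_grad[OF assms]])
       (auto intro!: derivative_eq_intros)
  then show "(\<lambda>x. \<phi> (a *\<^sub>R x + b)) differentiable (at x)"
    by (auto simp: differentiable_def)
  show "grad (\<lambda>x. \<phi> (a *\<^sub>R x + b)) x = a *\<^sub>R grad \<phi> (a *\<^sub>R x + b)"
    by (simp add: vec_eq_iff grad_eqI[OF *] inner_axis')
qed

lemma Ck_affine: "Ck k \<phi> \<Longrightarrow> Ck k (\<lambda>x. \<phi> (a *\<^sub>R x + b))"
proof (induction k arbitrary: \<phi>)
  case 0
  then show ?case
    by (auto intro!: continuous_intros continuous_on_compose2[of UNIV \<phi>])
next
  case (Suc k)
  then show ?case by (auto simp: grad_affine intro!: Ck_mult Ck_const)
qed

lemma smooth_differentiable: "smooth \<phi> \<Longrightarrow> \<phi> differentiable (at x)"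
  unfolding smooth_def by (metis Ck.simps(2))

lemma smooth_continuous: "smooth \<phi> \<Longrightarrow> continuous_on S \<phi>"
  unfolding smooth_def by (meson Ck_imp_continuous continuous_on_subset subset_UNIV)

lemma smooth_grad: "smooth \<phi> \<Longrightarrow> smooth (\<lambda>x. grad \<phi> x $ i)"
  unfolding smooth_def by (metis Ck.simps(2))

lemma smooth_grad_continuous: "smooth \<phi> \<Longrightarrow> continuous_on S (grad \<phi>)"
  using smooth_continuous[OF smooth_grad, of \<phi>]
  by (intro continuous_on_vec_lambda[of S "\<lambda>i x. grad \<phi> x $ i", simplified vec_nth_inverse vec_lambda_eta]) auto

lemma smooth_mult: "smooth \<phi> \<Longrightarrow> smooth \<psi> \<Longrightarrow> smooth (\<lambda>x. \<phi> x * \<psi> x)"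
  by (simp add: smooth_def Ck_mult)

lemma smooth_const: "smooth (\<lambda>x. c)"
  by (simp add: smooth_def Ck_const)

lemma smooth_affine: "smooth \<phi> \<Longrightarrow> smooth (\<lambda>x. \<phi> (a *\<^sub>R x + b))"
  by (simp add: smooth_def Ck_affine)

lemma grad_const: "grad (\<lambda>x. c) x = 0"
  by (simp add: vec_eq_iff grad_eqI[OF has_derivative_const])

section \<open>A smooth function with compact support\<close>

text \<open>The derivative of \<open>exp(-1/t) / t^m\<close> is a combination of the members with exponents \<open>m + 1\<close> and
  \<open>m + 2\<close>, so that smoothness of the whole family follows by a single induction.\<close>
definition flat_exp :: "nat \<Rightarrow> real \<Rightarrow> real" where
  "flat_exp m t = (if t \<le> 0 then 0 else exp (- 1 / t) / t ^ m)"

lemma flat_exp_div: "flat_exp m t / t = flat_exp (Suc m) t"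
  by (simp add: flat_exp_def)

lemma flat_exp_tendsto_0: "(flat_exp m \<longlongrightarrow> 0) (at 0)"
proof -
  have "((\<lambda>t::real. (inverse t) ^ m / exp (inverse t)) \<longlongrightarrow> 0) (at_right 0)"
    by (rule filterlim_compose[OF tendsto_power_div_exp_0 filterlim_inverse_at_top_right])
  then have "(flat_exp m \<longlongrightarrow> 0) (at_right 0)"
    by (rule Lim_transform_eventually)
       (auto simp: flat_exp_def eventually_at_right_field exp_minus field_simps intro!: exI[of _ 1])
  moreover have "(flat_exp m \<longlongrightarrow> 0) (at_left 0)"
    by (rule Lim_transform_eventually[OF tendsto_const])
       (auto simp: flat_exp_def eventually_at_left_field intro!: exI[of _ "-1"])
  ultimately show ?thesis
    by (simp add: filterlim_split_at_real)
qed

lemma DERIV_flat_exp: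
  "(flat_exp m has_real_derivative - real m * flat_exp (Suc m) t + flat_exp (Suc (Suc m)) t) (at t)"
proof -
  consider "t < 0" | "t > 0" | "t = 0" by linarith
  then show ?thesis
  proof cases
    case 1
    have "((\<lambda>t. 0) has_real_derivative 0) (at t)" by simp
    then show ?thesis
      by (rule DERIV_cong[OF has_field_derivative_transform_within_open[where S="{..<0}"]])
         (use 1 in \<open>auto simp: flat_exp_def\<close>)
  next
    case 2
    have "((\<lambda>t. exp (- 1 / t) / t ^ m) has_real_derivative
            - real m * flat_exp (Suc m) t + flat_exp (Suc (Suc m)) t) (at t)"
      using 2 power_minus_mult[of m t]
      by (cases "m = 0") (auto intro!: derivative_eq_intros simp: flat_exp_def field_simps)
    then show ?thesis
      by (rule has_field_derivative_transform_within_open[where S="{0<..}"])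
         (use 2 in \<open>auto simp: flat_exp_def\<close>)
  next
    case 3
    have "((\<lambda>y. (flat_exp m y - flat_exp m 0) / (y - 0)) \<longlongrightarrow> 0) (at 0)"
      using flat_exp_tendsto_0[of "Suc m"] by (simp add: flat_exp_div flat_exp_def[of _ 0])
    with 3 show ?thesis by (simp add: has_field_derivative_iff flat_exp_def[of _ 0])
  qed
qed

lemma flat_exp_coordinate:
  "((\<lambda>x::real^2. flat_exp m (c + s * x $ i)) has_derivative
     (\<lambda>h. (- real m * flat_exp (Suc m) (c + s * x $ i) + flat_exp (Suc (Suc m)) (c + s * x $ i)) * (s * h $ i))) (at x)"
  by (rule has_derivative_compose[OF _ DERIV_flat_exp[unfolded has_field_derivative_def]])
     (auto intro!: derivative_eq_intros bounded_linear_imp_has_derivative bounded_linear_vec_nth)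

lemma Ck_flat_exp: "Ck k (\<lambda>x. flat_exp m (c + s * x $ i))"
proof (induction k arbitrary: m)
  case 0
  have "continuous_on UNIV (flat_exp m)"
    using DERIV_flat_exp DERIV_isCont continuous_at_imp_continuous_on by blast
  then show ?case
    by (auto intro!: continuous_intros continuous_on_compose2[of UNIV "flat_exp m"])
next
  case (Suc k)
  have "grad (\<lambda>x. flat_exp m (c + s * x $ i)) x $ j =
     (- real m * flat_exp (Suc m) (c + s * x $ i) + flat_exp (Suc (Suc m)) (c + s * x $ i)) * (s * axis j 1 $ i)" for x j
    by (rule grad_eqI[OF flat_exp_coordinate])
  then have "Ck k (\<lambda>x. grad (\<lambda>x. flat_exp m (c + s * x $ i)) x $ j)" for j
    by (simp only:) (intro Ck_mult Ck_add Ck_const Suc.IH)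
  moreover have "(\<lambda>x. flat_exp m (c + s * x $ i)) differentiable (at x)" for x
    using flat_exp_coordinate differentiable_def by blast
  ultimately show ?case by simp
qed

text \<open>A product of one-dimensional bumps on \<open>[-1,1]\<close>. The arguments have the form \<open>c + s * x $ i\<close> of
  lemma \<open>Ck_flat_exp\<close>.\<close>
definition bump :: "real^2 \<Rightarrow> real" where
  "bump x = flat_exp 0 (1 + 1 * x $ 1) * flat_exp 0 (1 + (-1) * x $ 1) *
            (flat_exp 0 (1 + 1 * x $ 2) * flat_exp 0 (1 + (-1) * x $ 2))"

lemma smooth_bump: "smooth bump"
  unfolding smooth_def bump_def by (intro allI Ck_mult Ck_flat_exp)

lemma bump_nonneg: "bump x \<ge> 0"
  by (simp add: bump_def flat_exp_def)

lemma bump_0: "bump 0 > 0"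
  by (simp add: bump_def flat_exp_def)

lemma bump_support: "bump x \<noteq> 0 \<Longrightarrow> norm (x $ i) \<le> 1"
  using exhaust_2[of i] by (auto simp: bump_def flat_exp_def split: if_splits)

section \<open>Integration by parts\<close>

lemma
  fixes t :: "real^2"
  assumes "c \<noteq> 0"
  shows lebesgue_affine_eq:
      "lebesgue = density (distr lebesgue lebesgue (\<lambda>x. t + c *\<^sub>R x)) (\<lambda>_. ennreal (c\<^sup>2))"
    and lebesgue_affine_meas: "(\<lambda>x. t + c *\<^sub>R x) \<in> lebesgue \<rightarrow>\<^sub>M lebesgue"
  using lebesgue_affine_euclidean[of "\<lambda>_::real^2. c" t] lebesgue_affine_measurable[of "\<lambda>_::real^2. c" t] assms
  unfolding scaleR_scaleR[symmetric] scaleR_sum_right[symmetric] euclidean_representation prod_constant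
  by (simp_all add: ennreal_power[symmetric])

lemma
  fixes f :: "real^2 \<Rightarrow> 'b :: {banach, second_countable_topology}" and t :: "real^2"
  assumes f: "integrable lebesgue f" and c: "c \<noteq> 0"
  shows integrable_lebesgue_affine: "integrable lebesgue (\<lambda>x. f (t + c *\<^sub>R x))"
    and integral_lebesgue_affine: "(\<integral>x. f x \<partial>lebesgue) = c\<^sup>2 *\<^sub>R (\<integral>x. f (t + c *\<^sub>R x) \<partial>lebesgue)"
proof -
  note m [measurable] = lebesgue_affine_meas[OF c, of t]
  have fm [measurable]: "f \<in> borel_measurable lebesgue" using f by simp
  have "integrable (density (distr lebesgue lebesgue (\<lambda>x. t + c *\<^sub>R x)) (\<lambda>_. ennreal (c\<^sup>2))) f"
    using f lebesgue_affine_eq[OF c, of t] by simp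
  then have *: "integrable (distr lebesgue lebesgue (\<lambda>x. t + c *\<^sub>R x)) (\<lambda>x. c\<^sup>2 *\<^sub>R f x)"
    by (subst (asm) integrable_density) auto
  then have "integrable (distr lebesgue lebesgue (\<lambda>x. t + c *\<^sub>R x)) f"
    using c integrable_scaleR_right[OF *, of "1 / c\<^sup>2"] by simp
  then show "integrable lebesgue (\<lambda>x. f (t + c *\<^sub>R x))"
    by (rule integrable_distr[OF m])
  have "(\<integral>x. f x \<partial>lebesgue) = (\<integral>x. f x \<partial>density (distr lebesgue lebesgue (\<lambda>x. t + c *\<^sub>R x)) (\<lambda>_. ennreal (c\<^sup>2)))"
    using lebesgue_affine_eq[OF c, of t] by simp
  also have "\<dots> = (\<integral>x. c\<^sup>2 *\<^sub>R f x \<partial>distr lebesgue lebesgue (\<lambda>x. t + c *\<^sub>R x))"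
    by (subst integral_density) auto
  also have "\<dots> = c\<^sup>2 *\<^sub>R (\<integral>x. f (t + c *\<^sub>R x) \<partial>lebesgue)"
    by (subst integral_distr) auto
  finally show "(\<integral>x. f x \<partial>lebesgue) = c\<^sup>2 *\<^sub>R (\<integral>x. f (t + c *\<^sub>R x) \<partial>lebesgue)" .
qed

lemma continuous_compact_support_bounded:
  fixes f :: "real^2 \<Rightarrow> 'b::real_normed_vector"
  assumes "continuous_on UNIV f" "compact C" "\<And>x. x \<notin> C \<Longrightarrow> f x = 0"
  obtains B where "B > 0" "\<And>x. norm (f x) \<le> B"
proof -
  have "bounded (f ` C)"
    using assms(1,2) by (meson compact_continuous_image compact_imp_bounded continuous_on_subset subset_UNIV)
  then obtain B where "B > 0" "\<And>x. x \<in> C \<Longrightarrow> norm (f x) \<le> B"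
    unfolding bounded_pos by auto
  then show thesis using assms(3) that[of B] by (metis norm_zero less_imp_le)
qed

lemma continuous_imp_lebesgue_measurable:
  fixes f :: "real^2 \<Rightarrow> 'b::{banach, second_countable_topology}"
  shows "continuous_on UNIV f \<Longrightarrow> f \<in> borel_measurable lebesgue"
  by (rule measurable_completion) (simp add: borel_measurable_continuous_onI)

lemma integrable_bounded_compact:
  fixes f :: "real^2 \<Rightarrow> 'b::{banach, second_countable_topology}"
  assumes f: "f \<in> borel_measurable lebesgue" and C: "compact C"
    and 0: "\<And>x. x \<notin> C \<Longrightarrow> f x = 0" and B: "\<And>x. norm (f x) \<le> B"
  shows "integrable lebesgue f"
proof (rule Bochner_Integration.integrable_bound[OF _ f])
  have "C \<in> lmeasurable" using C by (rule lmeasurable_compact)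
  then show "integrable lebesgue (\<lambda>x. B * indicator C x :: real)"
    by (intro integrable_mult_right) (simp add: lmeasurable_iff_integrable)
  show "AE x in lebesgue. norm (f x) \<le> norm (B * indicator C x)"
    using B 0 by (auto simp: indicator_def intro: order_trans[OF _ abs_ge_self])
qed

lemma integrable_continuous_compact:
  fixes f :: "real^2 \<Rightarrow> 'b::{banach, second_countable_topology}"
  assumes "continuous_on UNIV f" "compact C" "\<And>x. x \<notin> C \<Longrightarrow> f x = 0"
  shows "integrable lebesgue f"
proof -
  obtain B where "\<And>x. norm (f x) \<le> B"
    using continuous_compact_support_bounded[OF assms] by blast
  from integrable_bounded_compact[OF continuous_imp_lebesgue_measurable[OF assms(1)] assms(2,3) this]
  show ?thesis .
qed

lemma grad_lipschitz:
  assumes "\<And>x. H differentiable (at x)" "\<And>x. norm (grad H x) \<le> B"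
  shows "\<bar>H x - H y\<bar> \<le> B * norm (x - y)"
proof -
  have "onorm (\<lambda>h. h \<bullet> grad H x) \<le> B" for x
  proof (rule onorm_bound)
    show "0 \<le> B" using order_trans[OF norm_ge_zero assms(2)[of x]] .
    show "norm (h \<bullet> grad H x) \<le> B * norm h" for h
      using Cauchy_Schwarz_ineq2[of h "grad H x"] mult_left_mono[OF assms(2)[of x] norm_ge_zero[of h]]
      by (simp add: mult.commute[of B])
  qed
  then show ?thesis
    using differentiable_bound[of UNIV H "\<lambda>x h. h \<bullet> grad H x" B x y] has_derivative_grad assms(1) by simp
qed

lemma grad_zero_outside:
  assumes "closed C" "\<And>x. x \<notin> C \<Longrightarrow> H x = 0" "x \<notin> C"
  shows "grad H x = 0"
proof -
  have "(H has_derivative (\<lambda>_. 0)) (at x)"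
    by (rule has_derivative_transform_within_open[OF has_derivative_const[of 0], where s = "- C"])
       (use assms in auto)
  then show ?thesis by (simp add: vec_eq_iff grad_eqI)
qed

lemma grad_quotient_tendsto:
  assumes "H differentiable (at x)" "h \<longlonglongrightarrow> 0" "\<And>n. h n \<noteq> (0::real)"
  shows "(\<lambda>n. (H (x + h n *\<^sub>R axis i 1) - H x) / h n) \<longlonglongrightarrow> grad H x $ i"
proof -
  have "((\<lambda>s. H (x + s *\<^sub>R axis i 1)) has_derivative (\<lambda>s. (s *\<^sub>R axis i 1) \<bullet> grad H x)) (at 0)"
    by (rule has_derivative_compose[where f = "\<lambda>s. x + s *\<^sub>R axis i 1" and g = H])
       (use has_derivative_grad[OF assms(1)] in \<open>auto intro!: derivative_eq_intros\<close>)
  then have "((\<lambda>s. H (x + s *\<^sub>R axis i 1)) has_real_derivative grad H x $ i) (at 0)"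
    unfolding has_field_derivative_def by (rule has_derivative_eq_rhs) (auto simp: inner_axis' fun_eq_iff)
  then have "((\<lambda>s. (H (x + s *\<^sub>R axis i 1) - H x) / s) \<longlongrightarrow> grad H x $ i) (at 0)"
    by (simp add: has_field_derivative_iff)
  then show ?thesis
    using assms(2,3) by (simp add: tendsto_at_iff_sequentially comp_def)
qed

text \<open>The integral of a difference quotient vanishes by translation invariance of Lebesgue measure, and
  the difference quotients converge to the partial derivative. They are dominated, as a function
  with compact support and continuous gradient is Lipschitz. This avoids iterated integrals.\<close>
lemma integral_grad_zero:
  assumes H: "\<And>x. H differentiable (at x)" "continuous_on UNIV (grad H)"
    and C: "compact C" "\<And>x. x \<notin> C \<Longrightarrow> H x = 0"
  shows "(\<integral>x. grad H x $ i \<partial>lebesgue) = 0"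
proof -
  have g0: "grad H x = 0" if "x \<notin> C" for x
    using grad_zero_outside C compact_imp_closed that by blast
  obtain B where B: "B > 0" "\<And>x. norm (grad H x) \<le> B"
    using continuous_compact_support_bounded[OF H(2) C(1) g0] by blast
  obtain R where R: "\<And>x. x \<in> C \<Longrightarrow> norm x \<le> R"
    using compact_imp_bounded[OF C(1)] unfolding bounded_iff by blast
  have cH: "continuous_on UNIV H"
    using H(1) by (simp add: continuous_at_imp_continuous_on differentiable_imp_continuous_within)
  have iH: "integrable lebesgue H" by (rule integrable_continuous_compact[OF cH C])
  define h :: "nat \<Rightarrow> real" where "h n = inverse (real (Suc n))" for n
  have h: "h n > 0" "h n \<le> 1" for n by (simp_all add: h_def field_simps)
  have h0: "h \<longlonglongrightarrow> 0" unfolding h_def by (rule LIMSEQ_inverse_real_of_nat)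
  define s where "s n x = (H (x + h n *\<^sub>R axis i 1) - H x) / h n" for n x
  have ish: "integrable lebesgue (\<lambda>x. H (x + h n *\<^sub>R axis i 1))" for n
    using integrable_lebesgue_affine[OF iH, of 1 "h n *\<^sub>R axis i 1"] by (simp add: add.commute)
  have s0: "(\<integral>x. s n x \<partial>lebesgue) = 0" for n
    using integral_lebesgue_affine[OF iH, of 1 "h n *\<^sub>R axis i 1"] ish[of n] iH
    by (simp add: s_def add.commute)
  have bound: "norm (s n x) \<le> B * indicator (cball 0 (R + 1)) x" for n x
  proof (cases "norm x \<le> R + 1")
    case True
    have "\<bar>H (x + h n *\<^sub>R axis i 1) - H x\<bar> \<le> B * h n"
      using grad_lipschitz[OF H(1) B(2), of "x + h n *\<^sub>R axis i 1" x] h(1)[of n] by simp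
    then show ?thesis using True h(1)[of n] by (simp add: s_def abs_divide field_simps)
  next
    case False
    \<comment> \<open>step sizes are at most \<open>1\<close>, so both \<open>x\<close> and its translate stay away from \<open>C\<close>\<close>
    have "norm x \<le> norm (x + h n *\<^sub>R axis i 1) + norm (h n *\<^sub>R axis i (1::real))"
      by (metis add_diff_cancel_right' norm_triangle_ineq4)
    with False have "norm (x + h n *\<^sub>R axis i 1) > R" "norm x > R" using h[of n] by auto
    then have "x + h n *\<^sub>R axis i 1 \<notin> C" "x \<notin> C" using R by force+
    then show ?thesis using False C(2) by (simp add: s_def)
  qed
  have "(\<lambda>n. \<integral>x. s n x \<partial>lebesgue) \<longlonglongrightarrow> (\<integral>x. grad H x $ i \<partial>lebesgue)"
  proof (rule integral_dominated_convergence)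
    show "(\<lambda>x. grad H x $ i) \<in> borel_measurable lebesgue"
      using H(2) by (intro continuous_imp_lebesgue_measurable continuous_intros)
    show "s n \<in> borel_measurable lebesgue" for n
      using ish[of n] iH unfolding s_def by (auto intro!: borel_measurable_integrable)
    show "integrable lebesgue (\<lambda>x::real^2. B * indicator (cball 0 (R + 1)) x :: real)"
      using lmeasurable_compact[OF compact_cball, of "0::real^2" "R+1"]
      by (intro integrable_mult_right) (simp add: lmeasurable_iff_integrable)
    show "AE x in lebesgue. (\<lambda>n. s n x) \<longlonglongrightarrow> grad H x $ i"
      unfolding s_def using grad_quotient_tendsto[OF H(1) h0] h(1)
      by (intro AE_I2) (simp add: less_imp_neq[symmetric])
  qed (use bound in auto)
  then show ?thesis by (simp add: s0 LIMSEQ_const_iff)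
qed

lemma test_functionsI:
  assumes "smooth \<phi>" "compact C" "C \<subseteq> \<Omega>" "\<And>x. x \<notin> C \<Longrightarrow> \<phi> x = 0"
  shows "\<phi> \<in> test_functions \<Omega>"
proof -
  have *: "closure (support_on UNIV \<phi>) \<subseteq> C"
    using assms(2,4) by (intro closure_minimal compact_imp_closed) (auto simp: support_on_def)
  have "bounded (support_on UNIV \<phi>)"
    by (rule bounded_subset[OF compact_imp_bounded[OF assms(2)] order_trans[OF closure_subset *]])
  then show ?thesis using assms(1,3) * by (auto simp: test_functions_def)
qed

lemma test_functionsE:
  assumes "\<phi> \<in> test_functions \<Omega>"
  obtains C where "smooth \<phi>" "compact C" "C \<subseteq> \<Omega>" "\<And>x. x \<notin> C \<Longrightarrow> \<phi> x = 0"
    "\<And>x. x \<notin> C \<Longrightarrow> grad \<phi> x = 0"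
proof -
  define C where "C = closure (support_on UNIV \<phi>)"
  have C: "smooth \<phi>" "compact C" "C \<subseteq> \<Omega>"
    using assms by (simp_all add: test_functions_def C_def)
  have 0: "\<phi> x = 0" if "x \<notin> C" for x
    using that closure_subset[of "support_on UNIV \<phi>"] by (auto simp: support_on_def C_def)
  have "grad \<phi> x = 0" if "x \<notin> C" for x
    using grad_zero_outside[OF compact_imp_closed[OF C(2)] 0 that] .
  from that[OF C 0 this] show thesis .
qed

lemma test_functions_grad:
  assumes "\<phi> \<in> test_functions \<Omega>" shows "(\<lambda>x. grad \<phi> x $ i) \<in> test_functions \<Omega>"
  using assms by (elim test_functionsE) (rule test_functionsI, auto intro: smooth_grad)

lemma test_functions_integrable:
  assumes "\<phi> \<in> test_functions \<Omega>" shows "integrable lebesgue \<phi>"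
  using assms by (elim test_functionsE) (auto intro: integrable_continuous_compact smooth_continuous)

lemma test_functions_bounded:
  assumes "\<phi> \<in> test_functions \<Omega>"
  obtains B where "B > 0" "\<And>x. \<bar>\<phi> x\<bar> \<le> B" "\<And>x. norm (grad \<phi> x) \<le> B"
proof -
  obtain C where C: "smooth \<phi>" "compact C" "C \<subseteq> \<Omega>" "\<And>x. x \<notin> C \<Longrightarrow> \<phi> x = 0"
    "\<And>x. x \<notin> C \<Longrightarrow> grad \<phi> x = 0"
    by (rule test_functionsE[OF assms]) (rule that)
  obtain B1 where B1: "B1 > 0" "\<And>x. norm (\<phi> x) \<le> B1"
    using continuous_compact_support_bounded[OF smooth_continuous[OF C(1)] C(2,4)] by blast
  obtain B2 where B2: "B2 > 0" "\<And>x. norm (grad \<phi> x) \<le> B2"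
    using continuous_compact_support_bounded[OF smooth_grad_continuous[OF C(1)] C(2,5)] by blast
  show thesis
    using that[of "max B1 B2"] B1 B2 by (auto simp: le_max_iff_disj)
qed

text \<open>The gradient of the product \<open>g \<phi>\<close>, which has compact support in the plane, integrates to \<open>0\<close>; hence
  there is no boundary term.\<close>
lemma integration_by_parts:
  assumes \<phi>: "\<phi> \<in> test_functions \<Omega>"
    and g: "\<And>x. g differentiable (at x)" "continuous_on UNIV (grad g)"
  shows "(\<integral>x. g x * grad \<phi> x $ i \<partial>lebesgue) = - (\<integral>x. \<phi> x * grad g x $ i \<partial>lebesgue)"
proof -
  obtain C where C: "smooth \<phi>" "compact C" "C \<subseteq> \<Omega>" "\<And>x. x \<notin> C \<Longrightarrow> \<phi> x = 0"
    "\<And>x. x \<notin> C \<Longrightarrow> grad \<phi> x = 0"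
    by (rule test_functionsE[OF \<phi>]) (rule that)
  note d = smooth_differentiable[OF C(1)]
  have cg: "continuous_on UNIV g"
    using g(1) by (simp add: continuous_at_imp_continuous_on differentiable_imp_continuous_within)
  have gm: "grad (\<lambda>x. g x * \<phi> x) x = g x *\<^sub>R grad \<phi> x + \<phi> x *\<^sub>R grad g x" for x
    by (rule grad_mult[OF g(1) d])
  note c = smooth_continuous[OF C(1)] smooth_grad_continuous[OF C(1)] cg g(2)
  have "0 = (\<integral>x. grad (\<lambda>x. g x * \<phi> x) x $ i \<partial>lebesgue)"
    by (rule integral_grad_zero[symmetric, OF _ _ C(2)])
       (use g d C c in \<open>auto simp: gm intro!: derivative_intros continuous_intros\<close>)
  also have "\<dots> = (\<integral>x. g x * grad \<phi> x $ i + \<phi> x * grad g x $ i \<partial>lebesgue)"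
    by (simp add: gm)
  also have "\<dots> = (\<integral>x. g x * grad \<phi> x $ i \<partial>lebesgue) + (\<integral>x. \<phi> x * grad g x $ i \<partial>lebesgue)"
    by (rule Bochner_Integration.integral_add; rule integrable_continuous_compact[OF _ C(2)])
       (use c C in \<open>auto intro!: continuous_intros\<close>)
  finally show ?thesis by simp
qed

section \<open>Convolution with a smooth kernel\<close>

definition conv :: "(real^2 \<Rightarrow> real) \<Rightarrow> (real^2 \<Rightarrow> real) \<Rightarrow> real^2 \<Rightarrow> real" where
  "conv k f x = (\<integral>y. k (x - y) * f y \<partial>lebesgue)"

lemma continuous_shift_measurable:
  "continuous_on UNIV (k :: real^2 \<Rightarrow> 'b::{banach, second_countable_topology}) \<Longrightarrow> (\<lambda>y. k (x - y)) \<in> borel_measurable lebesgue"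
  by (intro continuous_imp_lebesgue_measurable continuous_on_compose2[of UNIV k UNIV "\<lambda>y. x - y"])
     (auto intro!: continuous_intros)

lemma integrable_conv:
  fixes k :: "real^2 \<Rightarrow> 'b::{banach, second_countable_topology}"
  assumes "integrable lebesgue f" "continuous_on UNIV k" "\<And>x. norm (k x) \<le> B"
  shows "integrable lebesgue (\<lambda>y. f y *\<^sub>R k (x - y))"
proof (rule Bochner_Integration.integrable_bound)
  show "integrable lebesgue (\<lambda>y. B * f y)" using assms(1) by simp
  show "(\<lambda>y. f y *\<^sub>R k (x - y)) \<in> borel_measurable lebesgue"
    using assms continuous_shift_measurable by (intro borel_measurable_scaleR) auto
  have "0 \<le> B" using assms(3) norm_ge_zero order_trans by blast
  then show "AE y in lebesgue. norm (f y *\<^sub>R k (x - y)) \<le> norm (B * f y)"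
    using assms(3) by (intro AE_I2) (simp add: abs_mult mult.commute[of B] mult_left_mono)
qed

lemma continuous_conv:
  assumes f: "integrable lebesgue f" and k: "continuous_on UNIV k" "\<And>x. \<bar>k x\<bar> \<le> B"
  shows "continuous_on UNIV (conv k f)"
proof (rule continuous_on_sequentiallyI)
  fix u :: "nat \<Rightarrow> real^2" and x assume u: "u \<longlonglongrightarrow> x"
  have "0 \<le> B" using k(2) abs_ge_zero order_trans by blast
  show "(\<lambda>n. conv k f (u n)) \<longlonglongrightarrow> conv k f x"
    unfolding conv_def
  proof (rule integral_dominated_convergence[where w = "\<lambda>y. B * \<bar>f y\<bar>"])
    show "AE y in lebesgue. (\<lambda>n. k (u n - y) * f y) \<longlonglongrightarrow> k (x - y) * f y"
      using k(1) u by (intro AE_I2 tendsto_mult_right isCont_tendsto_compose[of _ k] tendsto_intros)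
         (auto simp: continuous_on_eq_continuous_at)
    show "AE y in lebesgue. norm (k (u n - y) * f y) \<le> B * \<bar>f y\<bar>" for n
      using k(2) by (intro AE_I2) (simp add: abs_mult mult_right_mono)
  qed (use f k continuous_shift_measurable in \<open>auto intro!: borel_measurable_times\<close>)
qed

text \<open>Differentiation under the integral. The error quotient of the kernel tends to \<open>0\<close> pointwise
  and is bounded by twice the Lipschitz constant of the kernel, so dominated convergence applies.\<close>
lemma has_derivative_conv:
  assumes f: "integrable lebesgue f" and k: "k \<in> test_functions UNIV"
  shows "(conv k f has_derivative (\<lambda>h. h \<bullet> (\<integral>y. f y *\<^sub>R grad k (x - y) \<partial>lebesgue))) (at x)"
proof -
  obtain B where B: "B > 0" "\<And>x. \<bar>k x\<bar> \<le> B" "\<And>x. norm (grad k x) \<le> B"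
    using test_functions_bounded[OF k] by blast
  have sk: "smooth k" using k by (simp add: test_functions_def)
  have dk: "\<And>x. k differentiable (at x)" using smooth_differentiable[OF sk] .
  define q where "q h y = (k (x + h - y) - k (x - y) - h \<bullet> grad k (x - y)) / norm h" for h y
  have ig: "integrable lebesgue (\<lambda>y. f y *\<^sub>R grad k (x - y))"
    by (rule integrable_conv[OF f smooth_grad_continuous[OF sk] B(3)])
  have ik: "integrable lebesgue (\<lambda>y. k (z - y) * f y)" for z
    using integrable_conv[OF f smooth_continuous[OF sk], of B z] B(2) by (simp add: mult.commute)
  have eq: "(conv k f (x + h) - conv k f x - h \<bullet> (\<integral>y. f y *\<^sub>R grad k (x - y) \<partial>lebesgue)) / norm h
        = (\<integral>y. q h y * f y \<partial>lebesgue)" for h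
  proof -
    have "integrable lebesgue (\<lambda>y. h \<bullet> f y *\<^sub>R grad k (x - y))"
      using ig by (rule integrable_inner_right)
    then have "conv k f (x + h) - conv k f x - h \<bullet> (\<integral>y. f y *\<^sub>R grad k (x - y) \<partial>lebesgue)
       = (\<integral>y. k (x + h - y) * f y - k (x - y) * f y - h \<bullet> f y *\<^sub>R grad k (x - y) \<partial>lebesgue)"
      using ik integral_inner_right[OF ig, of h] by (simp add: conv_def)
    then show ?thesis
      by (simp add: q_def algebra_simps flip: integral_divide_zero)
  qed
  have qb: "\<bar>q h y\<bar> \<le> 2 * B" for h y
  proof (cases "h = 0")
    case False
    have "\<bar>k (x + h - y) - k (x - y)\<bar> \<le> B * norm h"
      using grad_lipschitz[OF dk B(3), of "x + h - y" "x - y"] by (simp add: algebra_simps)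
    moreover have "\<bar>h \<bullet> grad k (x - y)\<bar> \<le> B * norm h"
      using Cauchy_Schwarz_ineq2[of h "grad k (x - y)"] mult_left_mono[OF B(3)[of "x - y"] norm_ge_zero[of h]]
      by (simp add: mult.commute[of B])
    ultimately have "\<bar>k (x + h - y) - k (x - y) - h \<bullet> grad k (x - y)\<bar> \<le> 2 * B * norm h" by linarith
    with False show ?thesis by (simp add: q_def abs_divide field_simps)
  qed (use B in \<open>simp add: q_def\<close>)
  have "((\<lambda>h. \<integral>y. q h y * f y \<partial>lebesgue) \<longlongrightarrow> 0) (at 0)"
    unfolding tendsto_at_iff_sequentially comp_def
  proof (intro allI impI)
    fix X :: "nat \<Rightarrow> real^2" assume X: "\<forall>i. X i \<in> UNIV - {0}" "X \<longlonglongrightarrow> 0"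
    have "(\<lambda>n. \<integral>y. q (X n) y * f y \<partial>lebesgue) \<longlonglongrightarrow> (\<integral>y. 0 * f y \<partial>lebesgue)"
    proof (rule integral_dominated_convergence[where w = "\<lambda>y. 2 * B * \<bar>f y\<bar>"])
      show "AE y in lebesgue. (\<lambda>n. q (X n) y * f y) \<longlonglongrightarrow> 0 * f y"
      proof (intro AE_I2 tendsto_mult_right)
        fix y
        have "((\<lambda>h. norm (k (x - y + h) - k (x - y) - h \<bullet> grad k (x - y)) / norm h) \<longlongrightarrow> 0) (at 0)"
          using has_derivative_grad[OF dk, of "x - y"] by (simp add: has_derivative_at)
        then have "((\<lambda>h. norm (q h y)) \<longlongrightarrow> 0) (at 0)"
          by (simp add: q_def abs_divide algebra_simps)
        then have "((\<lambda>h. q h y) \<longlongrightarrow> 0) (at 0)"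
          by (simp only: tendsto_norm_zero_iff)
        then show "(\<lambda>n. q (X n) y) \<longlonglongrightarrow> 0"
          using X by (auto simp: tendsto_at_iff_sequentially comp_def)
      qed
      show "AE y in lebesgue. norm (q (X n) y * f y) \<le> 2 * B * \<bar>f y\<bar>" for n
        using qb by (intro AE_I2) (simp add: abs_mult mult_right_mono)
      show "(\<lambda>y. q (X n) y * f y) \<in> borel_measurable lebesgue" for n
        unfolding q_def using f smooth_continuous[OF sk] smooth_grad_continuous[OF sk]
        by (intro borel_measurable_times borel_measurable_divide borel_measurable_diff borel_measurable_inner
             continuous_shift_measurable) auto
    qed (use f in auto)
    then show "(\<lambda>n. \<integral>y. q (X n) y * f y \<partial>lebesgue) \<longlonglongrightarrow> 0" by simp
  qed
  from tendsto_norm_zero[OF this]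
  have "((\<lambda>h. norm (conv k f (x + h) - conv k f x - h \<bullet> (\<integral>y. f y *\<^sub>R grad k (x - y) \<partial>lebesgue)) / norm h) \<longlongrightarrow> 0) (at 0)"
    by (simp add: eq[symmetric] abs_divide)
  then show ?thesis
    by (simp add: has_derivative_at bounded_linear_inner_left)
qed

lemma
  assumes f: "integrable lebesgue f" and k: "k \<in> test_functions UNIV"
  shows conv_differentiable: "conv k f differentiable (at x)"
    and grad_conv: "grad (conv k f) x $ i = conv (\<lambda>z. grad k z $ i) f x"
proof -
  show "conv k f differentiable (at x)"
    using has_derivative_conv[OF assms] differentiable_def by blast
  obtain B where B: "B > 0" "\<And>x. \<bar>k x\<bar> \<le> B" "\<And>x. norm (grad k x) \<le> B"
    using test_functions_bounded[OF k] by blast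
  have sk: "smooth k" using k by (simp add: test_functions_def)
  have "integrable lebesgue (\<lambda>y. f y *\<^sub>R grad k (x - y))"
    by (rule integrable_conv[OF f smooth_grad_continuous[OF sk] B(3)])
  from integral_bounded_linear[OF bounded_linear_vec_nth this, of i]
  show "grad (conv k f) x $ i = conv (\<lambda>z. grad k z $ i) f x"
    by (simp add: grad_eqI[OF has_derivative_conv[OF assms]] inner_axis' conv_def mult.commute)
qed

lemma smooth_conv:
  assumes f: "integrable lebesgue f" and k: "k \<in> test_functions UNIV"
  shows "smooth (conv k f)"
proof -
  have "Ck m (conv k f)" if "k \<in> test_functions UNIV" for m k
    using that
  proof (induction m arbitrary: k)
    case 0
    obtain B where B: "\<And>x. \<bar>k x\<bar> \<le> B" using test_functions_bounded[OF 0] by blast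
    have sk: "smooth k" using 0 by (simp add: test_functions_def)
    show ?case using continuous_conv[OF f smooth_continuous[OF sk] B] by simp
  next
    case (Suc m)
    then show ?case
      by (simp add: conv_differentiable[OF f] grad_conv[OF f] test_functions_grad)
  qed
  then show ?thesis using k by (simp add: smooth_def)
qed

section \<open>Mollification converges in \<open>L\<^sup>1\<close>\<close>

text \<open>The factor \<open>e\<^sup>2\<close> is the Jacobian of the scaling in the plane, so the kernel has integral \<open>1\<close>.\<close>
definition mollifier :: "real \<Rightarrow> real^2 \<Rightarrow> real" where
  "mollifier e x = bump (x /\<^sub>R e) / (e\<^sup>2 * (\<integral>y. bump y \<partial>lebesgue))"

lemma bump_test: "bump \<in> test_functions UNIV"
proof (rule test_functionsI[OF smooth_bump compact_cbox])
  show "bump x = 0" if "x \<notin> cbox (\<chi> i. -1) (\<chi> i. 1)" for x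
    using that bump_support[of x] by (force simp: mem_box_cart abs_le_iff)
qed simp

lemma integral_bump: "(\<integral>y. bump y \<partial>lebesgue) > 0"
proof (rule ccontr)
  assume "\<not> (\<integral>y. bump y \<partial>lebesgue) > 0"
  then have "(\<integral>y. bump y \<partial>lebesgue) = 0"
    by (simp add: bump_nonneg Bochner_Integration.integral_nonneg order_antisym)
  then have "AE x in lebesgue. bump x = 0"
    using Bochner_Integration.integral_nonneg_eq_0_iff_AE[OF test_functions_integrable[OF bump_test]] bump_nonneg by auto
  then have "{x. bump x \<noteq> 0} \<in> null_sets lebesgue"
    by (rule AE_E3) (auto intro: null_sets_completion_subset)
  moreover have "open {x. bump x \<noteq> 0}"
    using smooth_continuous[OF smooth_bump, of UNIV] by (intro open_Collect_neq) auto
  ultimately show False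
    using open_not_negligible[of "{x. bump x \<noteq> 0}"] bump_0 unfolding negligible_iff_null_sets
    by (metis (mono_tags, lifting) empty_iff less_irrefl mem_Collect_eq)
qed

lemma mollifier_nonneg: "mollifier e x \<ge> 0"
  using integral_bump by (simp add: mollifier_def bump_nonneg)

lemma mollifier_support:
  assumes "e > 0" "mollifier e x \<noteq> 0" shows "\<bar>x $ i\<bar> \<le> e"
  using assms bump_support[of "x /\<^sub>R e" i] by (auto simp: mollifier_def abs_mult divide_simps split: if_splits)

lemma mollifier_test: assumes "e > 0" shows "mollifier e \<in> test_functions UNIV"
proof (rule test_functionsI[OF _ compact_cbox])
  have "smooth (\<lambda>x. bump (inverse e *\<^sub>R x + 0) * (1 / (e\<^sup>2 * (\<integral>y. bump y \<partial>lebesgue))))"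
    by (intro smooth_mult smooth_const smooth_affine smooth_bump)
  then show "smooth (mollifier e)" by (simp add: mollifier_def[abs_def])
  show "mollifier e x = 0" if "x \<notin> cbox (\<chi> i. -e) (\<chi> i. e)" for x
  proof (rule ccontr)
    assume "mollifier e x \<noteq> 0"
    from mollifier_support[OF assms this] have "\<And>i. - e \<le> x $ i \<and> x $ i \<le> e"
      by (simp add: abs_le_iff minus_le_iff)
    with that show False by (simp add: mem_box_cart)
  qed
qed simp

lemma integrable_shift:
  assumes "integrable lebesgue f" "k \<in> test_functions UNIV"
  shows "integrable lebesgue (\<lambda>y. k (x - y) * f y)"
proof -
  obtain B where B: "\<And>x. \<bar>k x\<bar> \<le> B" using test_functions_bounded[OF assms(2)] by blast
  have "smooth k" using assms(2) by (simp add: test_functions_def)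
  from integrable_conv[OF assms(1) smooth_continuous[OF this], of B x] B
  show ?thesis by (simp add: mult.commute)
qed

text \<open>After the substitution \<open>y = x - e z\<close> the convolution is an average of translates of \<open>f\<close> with
  weights that do not depend on \<open>e\<close>.\<close>
lemma
  assumes f: "integrable lebesgue f" and e: "e > 0"
  shows conv_mollifier: "conv (mollifier e) f x = (\<integral>z. mollifier 1 z * f (x + (- e) *\<^sub>R z) \<partial>lebesgue)"
    and integrable_conv_mollifier: "integrable lebesgue (\<lambda>z. mollifier 1 z * f (x + (- e) *\<^sub>R z))"
proof -
  have i: "integrable lebesgue (\<lambda>y. mollifier e (x - y) * f y)"
    by (rule integrable_shift[OF f mollifier_test[OF e]])
  have eq: "mollifier e (x - (x + (- e) *\<^sub>R z)) = mollifier 1 z / e\<^sup>2" for z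
    using e by (simp add: mollifier_def)
  show "conv (mollifier e) f x = (\<integral>z. mollifier 1 z * f (x + (- e) *\<^sub>R z) \<partial>lebesgue)"
    unfolding conv_def using e by (subst integral_lebesgue_affine[OF i, of "-e" x]) (auto simp only: eq, auto)
  have "integrable lebesgue (\<lambda>z. e\<^sup>2 * (mollifier e (x - (x + (- e) *\<^sub>R z)) * f (x + (- e) *\<^sub>R z)))"
    using integrable_lebesgue_affine[OF i, of "-e" x] e by simp
  then show "integrable lebesgue (\<lambda>z. mollifier 1 z * f (x + (- e) *\<^sub>R z))"
    unfolding eq using e by simp
qed

lemma integral_mollifier_1: "(\<integral>z. mollifier 1 z \<partial>lebesgue) = 1"
  using integral_bump by (simp add: mollifier_def)

text \<open>A measurable function is an almost everywhere limit of continuous functions. Cutting \<open>f\<close> off at height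
  \<open>m\<close> and outside the ball of radius \<open>m\<close> changes it little in \<open>L\<^sup>1\<close>. The same cut-off applied to the
  approximating functions keeps them continuous and makes them dominated.\<close>
lemma L1_continuous_dense:
  fixes f :: "real^2 \<Rightarrow> real"
  assumes f: "integrable lebesgue f" and "\<epsilon> > 0"
  obtains g C where "continuous_on UNIV g" "compact C" "\<And>x. x \<notin> C \<Longrightarrow> g x = 0"
    "(\<integral>x. \<bar>f x - g x\<bar> \<partial>lebesgue) < \<epsilon>"
proof -
  define cut :: "nat \<Rightarrow> real \<Rightarrow> real^2 \<Rightarrow> real" where
    "cut m t x = max (- real m) (min (real m) t) * max 0 (min 1 (real m - norm x))" for m t x
  have cut0: "cut m t x = 0" if "x \<notin> cball 0 (real m)" for m t x
    using that by (simp add: cut_def)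
  have cut_le: "\<bar>cut m t x\<bar> \<le> \<bar>t\<bar>" "\<bar>cut m t x\<bar> \<le> real m" for m t x
  proof -
    have "\<bar>max (- real m) (min (real m) t)\<bar> * \<bar>max 0 (min 1 (real m - norm x))\<bar> \<le> c * 1"
      if "\<bar>max (- real m) (min (real m) t)\<bar> \<le> c" for c
      using that by (intro mult_mono) auto
    from this[of "\<bar>t\<bar>"] this[of "real m"]
    show "\<bar>cut m t x\<bar> \<le> \<bar>t\<bar>" "\<bar>cut m t x\<bar> \<le> real m" by (auto simp: cut_def abs_mult)
  qed
  have fm [measurable]: "f \<in> borel_measurable lebesgue" using f by simp
  have cutm [measurable]: "(\<lambda>x. cut m (h x) x) \<in> borel_measurable lebesgue"
    if [measurable]: "h \<in> borel_measurable lebesgue" for m h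
  proof -
    have [measurable]: "(\<lambda>x::real^2. norm x) \<in> borel_measurable lebesgue"
      by (intro continuous_imp_lebesgue_measurable continuous_intros)
    show ?thesis unfolding cut_def by measurable
  qed
  have "(\<lambda>m. \<integral>x. \<bar>f x - cut m (f x) x\<bar> \<partial>lebesgue) \<longlonglongrightarrow> (\<integral>x. 0 \<partial>(lebesgue :: (real^2) measure))"
  proof (rule integral_dominated_convergence[where w = "\<lambda>x. 2 * \<bar>f x\<bar>"])
    show "AE x in lebesgue. (\<lambda>m. \<bar>f x - cut m (f x) x\<bar>) \<longlonglongrightarrow> 0"
    proof (intro AE_I2 tendsto_eventually)
      fix x
      have "eventually (\<lambda>m. real m \<ge> \<bar>f x\<bar> + norm x + 1) sequentially"
        by (metis eventually_sequentiallyI le_nat_iff nat_ceiling_le_eq ceiling_le_iff real_nat_ceiling_ge order_trans of_nat_mono)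
      then show "eventually (\<lambda>m. \<bar>f x - cut m (f x) x\<bar> = 0) sequentially"
      proof eventually_elim
        case (elim m)
        then have "max (- real m) (min (real m) (f x)) = f x" "max 0 (min 1 (real m - norm x)) = 1"
          using norm_ge_zero[of x] by linarith+
        then show ?case by (simp add: cut_def)
      qed
    qed
    show "AE x in lebesgue. norm \<bar>f x - cut m (f x) x\<bar> \<le> 2 * \<bar>f x\<bar>" for m
      using cut_le(1)[of m] by (intro AE_I2) (smt (verit) real_norm_def)
  qed (use f in \<open>auto\<close>)
  then have "eventually (\<lambda>m. (\<integral>x. \<bar>f x - cut m (f x) x\<bar> \<partial>lebesgue) < \<epsilon> / 2) sequentially"
    using \<open>\<epsilon> > 0\<close> by (intro order_tendstoD(2)) auto
  then obtain m where m: "(\<integral>x. \<bar>f x - cut m (f x) x\<bar> \<partial>lebesgue) < \<epsilon> / 2"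
    by (meson eventually_sequentially order_refl)
  have "f measurable_on UNIV"
    using measurable_on_iff_borel_measurable[of UNIV f] fm by (simp add: lebesgue_on_UNIV_eq)
  then obtain N g where g: "negligible N" "\<And>n. continuous_on UNIV (g n)"
    "\<And>x. x \<notin> N \<Longrightarrow> (\<lambda>n. g n x) \<longlonglongrightarrow> f x"
    unfolding measurable_on_def by auto
  have gm [measurable]: "g n \<in> borel_measurable lebesgue" for n
    using g(2) by (rule continuous_imp_lebesgue_measurable)
  have cg: "continuous_on UNIV (\<lambda>x. cut m (g n x) x)" for n
    unfolding cut_def using g(2) by (intro continuous_intros) auto
  have ic: "integrable lebesgue (\<lambda>x. cut m (h x) x)" if "h \<in> borel_measurable lebesgue" for h
    by (rule integrable_bounded_compact[where C = "cball 0 (real m)" and B = "real m"])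
       (use cutm[OF that] cut0 cut_le(2) in auto)
  have "(\<lambda>n. \<integral>x. \<bar>cut m (f x) x - cut m (g n x) x\<bar> \<partial>lebesgue) \<longlonglongrightarrow> (\<integral>x. 0 \<partial>(lebesgue :: (real^2) measure))"
  proof (rule integral_dominated_convergence[where w = "\<lambda>x. 2 * real m * indicator (cball 0 (real m)) x"])
    have "AE x in lebesgue. x \<notin> N"
      using g(1) by (simp add: negligible_iff_null_sets AE_not_in)
    then show "AE x in lebesgue. (\<lambda>n. \<bar>cut m (f x) x - cut m (g n x) x\<bar>) \<longlonglongrightarrow> 0"
    proof eventually_elim
      case (elim x)
      have "(\<lambda>n. cut m (g n x) x) \<longlonglongrightarrow> cut m (f x) x"
        unfolding cut_def by (intro tendsto_intros g(3)[OF elim])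
      from tendsto_rabs[OF tendsto_diff[OF tendsto_const[of "cut m (f x) x"] this]] show ?case by simp
    qed
    show "AE x in lebesgue. norm \<bar>cut m (f x) x - cut m (g n x) x\<bar> \<le> 2 * real m * indicator (cball 0 (real m)) x" for n
    proof (intro AE_I2)
      fix x show "norm \<bar>cut m (f x) x - cut m (g n x) x\<bar> \<le> 2 * real m * indicator (cball 0 (real m)) x"
        using cut0[of x m] cut_le(2)[of m "f x" x] cut_le(2)[of m "g n x" x]
        by (cases "x \<in> cball 0 (real m)") auto
    qed
    show "integrable lebesgue (\<lambda>x::real^2. 2 * real m * indicator (cball 0 (real m)) x :: real)"
      using lmeasurable_compact[OF compact_cball, of "0::real^2" "real m"]
      by (intro integrable_mult_right) (simp add: lmeasurable_iff_integrable)
  qed auto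
  then have "eventually (\<lambda>n. (\<integral>x. \<bar>cut m (f x) x - cut m (g n x) x\<bar> \<partial>lebesgue) < \<epsilon> / 2) sequentially"
    using \<open>\<epsilon> > 0\<close> by (intro order_tendstoD(2)) auto
  then obtain n where n: "(\<integral>x. \<bar>cut m (f x) x - cut m (g n x) x\<bar> \<partial>lebesgue) < \<epsilon> / 2"
    by (meson eventually_sequentially order_refl)
  have "(\<integral>x. \<bar>f x - cut m (g n x) x\<bar> \<partial>lebesgue)
     \<le> (\<integral>x. \<bar>f x - cut m (f x) x\<bar> + \<bar>cut m (f x) x - cut m (g n x) x\<bar> \<partial>lebesgue)"
    using f ic by (intro integral_mono) auto
  also have "\<dots> = (\<integral>x. \<bar>f x - cut m (f x) x\<bar> \<partial>lebesgue) + (\<integral>x. \<bar>cut m (f x) x - cut m (g n x) x\<bar> \<partial>lebesgue)"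
    using f ic by (intro Bochner_Integration.integral_add) auto
  also have "\<dots> < \<epsilon>" using m n by simp
  finally show thesis
    using that[OF cg compact_cball cut0] by blast
qed

text \<open>The claim is clear for a continuous function with compact support, and composing two functions
  with a dilation by a factor of at least \<open>1\<close> does not increase their \<open>L\<^sup>1\<close> distance.\<close>
lemma L1_affine_continuity:
  fixes f :: "real^2 \<Rightarrow> real"
  assumes f: "integrable lebesgue f" and a: "a \<longlonglongrightarrow> 1" "\<And>n. a n \<ge> 1" and b: "b \<longlonglongrightarrow> 0"
  shows "(\<lambda>n. \<integral>x. \<bar>f (b n + a n *\<^sub>R x) - f x\<bar> \<partial>lebesgue) \<longlonglongrightarrow> 0"
proof (rule LIMSEQ_I)
  fix r :: real assume "r > 0"
  then obtain g C where g: "continuous_on UNIV g" "compact C" "\<And>x. x \<notin> C \<Longrightarrow> g x = 0"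
    and fg: "(\<integral>x. \<bar>f x - g x\<bar> \<partial>lebesgue) < r / 4"
    using L1_continuous_dense[OF f, of "r / 4"] by auto
  have an: "a n \<noteq> 0" for n using a(2)[of n] by auto
  have ig: "integrable lebesgue g" by (rule integrable_continuous_compact[OF g])
  have ifa: "integrable lebesgue (\<lambda>x. f (b n + a n *\<^sub>R x))" for n by (rule integrable_lebesgue_affine[OF f an])
  have iga: "integrable lebesgue (\<lambda>x. g (b n + a n *\<^sub>R x))" for n by (rule integrable_lebesgue_affine[OF ig an])
  obtain M where M: "M > 0" "\<And>x. norm (g x) \<le> M" using continuous_compact_support_bounded[OF g] by blast
  obtain R where R: "R > 0" "\<And>x. x \<in> C \<Longrightarrow> norm x \<le> R"
    using compact_imp_bounded[OF g(2)] unfolding bounded_pos by blast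
  obtain K where K: "\<And>n. norm (b n) \<le> K"
    using convergent_imp_Bseq[of b] b unfolding convergent_def Bseq_def by blast
  have "(\<lambda>n. \<integral>x. \<bar>g (b n + a n *\<^sub>R x) - g x\<bar> \<partial>lebesgue) \<longlonglongrightarrow> (\<integral>x. 0 \<partial>(lebesgue :: (real^2) measure))"
  proof (rule integral_dominated_convergence[where w = "\<lambda>x. 2 * M * indicator (cball 0 (R + K)) x"])
    show "AE x in lebesgue. (\<lambda>n. \<bar>g (b n + a n *\<^sub>R x) - g x\<bar>) \<longlonglongrightarrow> 0"
    proof (intro AE_I2)
      fix x
      have "(\<lambda>n. b n + a n *\<^sub>R x) \<longlonglongrightarrow> 0 + 1 *\<^sub>R x" using a b by (intro tendsto_intros)
      then have "(\<lambda>n. g (b n + a n *\<^sub>R x)) \<longlonglongrightarrow> g x"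
        using g(1) by (intro isCont_tendsto_compose[of _ g]) (auto simp: continuous_on_eq_continuous_at)
      from tendsto_rabs[OF tendsto_diff[OF this tendsto_const[of "g x"]]]
      show "(\<lambda>n. \<bar>g (b n + a n *\<^sub>R x) - g x\<bar>) \<longlonglongrightarrow> 0" by simp
    qed
    show "AE x in lebesgue. norm \<bar>g (b n + a n *\<^sub>R x) - g x\<bar> \<le> 2 * M * indicator (cball 0 (R + K)) x" for n
    proof (intro AE_I2)
      fix x :: "real^2"
      show "norm \<bar>g (b n + a n *\<^sub>R x) - g x\<bar> \<le> 2 * M * indicator (cball 0 (R + K)) x"
      proof (cases "norm x \<le> R + K")
        case True
        then show ?thesis using M(2)[of x] M(2)[of "b n + a n *\<^sub>R x"] by simp
      next
        case False
        have "norm x \<le> norm (a n *\<^sub>R x)" using a(2)[of n] mult_right_mono[of 1 "a n" "norm x"] by simp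
        also have "\<dots> \<le> norm (b n + a n *\<^sub>R x) + norm (b n)"
          by (metis add_diff_cancel_left' norm_triangle_ineq4)
        finally have "norm (b n + a n *\<^sub>R x) > R" "norm x > R"
          using False K[of n] norm_ge_zero[of "b n"] by linarith+
        then have "b n + a n *\<^sub>R x \<notin> C" "x \<notin> C" using R(2) by force+
        then show ?thesis using g(3) False by simp
      qed
    qed
    show "integrable lebesgue (\<lambda>x::real^2. 2 * M * indicator (cball 0 (R + K)) x :: real)"
      using lmeasurable_compact[OF compact_cball, of "0::real^2" "R + K"]
      by (intro integrable_mult_right) (simp add: lmeasurable_iff_integrable)
    show "(\<lambda>x. \<bar>g (b n + a n *\<^sub>R x) - g x\<bar>) \<in> borel_measurable lebesgue" for n
      using ig iga[of n] by (auto intro!: borel_measurable_integrable)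
  qed auto
  then obtain n0 where n0: "\<And>n. n \<ge> n0 \<Longrightarrow> (\<integral>x. \<bar>g (b n + a n *\<^sub>R x) - g x\<bar> \<partial>lebesgue) < r / 4"
    using order_tendstoD(2)[of _ 0 sequentially "r/4"] \<open>r > 0\<close> unfolding eventually_sequentially by force
  have "norm ((\<integral>x. \<bar>f (b n + a n *\<^sub>R x) - f x\<bar> \<partial>lebesgue) - 0) < r" if "n \<ge> n0" for n
  proof -
    \<comment> \<open>the Jacobian \<open>(a n)\<^sup>2\<close> is at least \<open>1\<close>, so the distance of the transformed functions is not larger\<close>
    have "integrable lebesgue (\<lambda>x. \<bar>f x - g x\<bar>)" using f ig by auto
    from integral_lebesgue_affine[OF this an[of n], of "b n"]
    have "(a n)\<^sup>2 * (\<integral>x. \<bar>f (b n + a n *\<^sub>R x) - g (b n + a n *\<^sub>R x)\<bar> \<partial>lebesgue) < r / 4"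
      using fg by simp
    moreover have "1 * (\<integral>x. \<bar>f (b n + a n *\<^sub>R x) - g (b n + a n *\<^sub>R x)\<bar> \<partial>lebesgue)
      \<le> (a n)\<^sup>2 * (\<integral>x. \<bar>f (b n + a n *\<^sub>R x) - g (b n + a n *\<^sub>R x)\<bar> \<partial>lebesgue)"
      using a(2)[of n] by (intro mult_right_mono Bochner_Integration.integral_nonneg one_le_power) auto
    ultimately have 1: "(\<integral>x. \<bar>f (b n + a n *\<^sub>R x) - g (b n + a n *\<^sub>R x)\<bar> \<partial>lebesgue) < r / 4" by linarith
    have "(\<integral>x. \<bar>f (b n + a n *\<^sub>R x) - f x\<bar> \<partial>lebesgue) \<le>
      (\<integral>x. \<bar>f (b n + a n *\<^sub>R x) - g (b n + a n *\<^sub>R x)\<bar> + \<bar>g (b n + a n *\<^sub>R x) - g x\<bar> + \<bar>f x - g x\<bar> \<partial>lebesgue)"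
      using f ig ifa iga by (intro integral_mono) auto
    also have "\<dots> = (\<integral>x. \<bar>f (b n + a n *\<^sub>R x) - g (b n + a n *\<^sub>R x)\<bar> \<partial>lebesgue) +
       (\<integral>x. \<bar>g (b n + a n *\<^sub>R x) - g x\<bar> \<partial>lebesgue) + (\<integral>x. \<bar>f x - g x\<bar> \<partial>lebesgue)"
      using f ig ifa iga by (simp add: Bochner_Integration.integral_add)
    also have "\<dots> < r" using 1 n0[OF that] fg \<open>r > 0\<close> by linarith
    finally show ?thesis by (simp add: Bochner_Integration.integral_nonneg)
  qed
  then show "\<exists>no. \<forall>n\<ge>no. norm ((\<integral>x. \<bar>f (b n + a n *\<^sub>R x) - f x\<bar> \<partial>lebesgue) - 0) < r" by blast
qed

lemma borel_mollifier: "e > 0 \<Longrightarrow> mollifier e \<in> borel_measurable borel"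
  using mollifier_test[of e] by (auto simp: test_functions_def intro: borel_measurable_continuous_onI smooth_continuous)

text \<open>By Tonelli's theorem the \<open>L\<^sup>1\<close> distance between \<open>f\<close> and its mollification is at most the average,
  over the displacement \<open>z\<close>, of the \<open>L\<^sup>1\<close> distance between \<open>f\<close> and its image under an affine map. Each
  of these distances tends to \<open>0\<close>, and they are bounded by \<open>2 |f|\<^sub>1\<close>. Tonelli's theorem is applied on
  the product of two Borel measures, which is why \<open>f\<close> is a Borel function here.\<close>
lemma
  fixes f :: "real^2 \<Rightarrow> real"
  assumes f: "integrable lebesgue f" and fb [measurable]: "f \<in> borel_measurable borel"
    and a: "a \<longlonglongrightarrow> 1" "\<And>n. a n \<ge> 1" and b: "b \<longlonglongrightarrow> 0" and e: "e \<longlonglongrightarrow> 0" "\<And>n. e n > 0"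
  shows mollify_L1_borel: "(\<lambda>n. \<integral>\<^sup>+x. ennreal \<bar>conv (mollifier (e n)) f (a n *\<^sub>R x + b n) - f x\<bar> \<partial>lebesgue) \<longlonglongrightarrow> 0"
    and mollify_finite_borel: "(\<integral>\<^sup>+x. ennreal \<bar>conv (mollifier (e n)) f (a n *\<^sub>R x + b n) - f x\<bar> \<partial>lebesgue) < \<infinity>"
proof -
  define F where "F n x z = ennreal (mollifier 1 z * \<bar>f (a n *\<^sub>R x + b n + (- e n) *\<^sub>R z) - f x\<bar>)" for n x z
  define D where "D n z = (\<integral>x. \<bar>f ((b n + (- e n) *\<^sub>R z) + a n *\<^sub>R x) - f x\<bar> \<partial>lebesgue)" for n z
  have [measurable]: "mollifier 1 \<in> borel_measurable borel" by (rule borel_mollifier) simp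
  have an: "a n \<noteq> 0" for n using a(2)[of n] by auto
  have i1: "integrable lebesgue (mollifier 1)" by (rule test_functions_integrable[OF mollifier_test]) simp
  have Fm [measurable]: "case_prod (F n) \<in> borel_measurable (lborel \<Otimes>\<^sub>M lborel)" for n
    unfolding F_def by measurable
  have D0: "D n z \<ge> 0" for n z unfolding D_def by (rule Bochner_Integration.integral_nonneg) simp
  have ifa: "integrable lebesgue (\<lambda>x. f (t + a n *\<^sub>R x))" for n t by (rule integrable_lebesgue_affine[OF f an])
  have D_le: "D n z \<le> 2 * (\<integral>x. \<bar>f x\<bar> \<partial>lebesgue)" for n z
  proof -
    let ?t = "b n + (- e n) *\<^sub>R z"
    have "(\<integral>x. \<bar>f x\<bar> \<partial>lebesgue) = (a n)\<^sup>2 * (\<integral>x. \<bar>f (?t + a n *\<^sub>R x)\<bar> \<partial>lebesgue)"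
      using integral_lebesgue_affine[OF integrable_abs[OF f] an[of n], of ?t] by simp
    moreover have "1 * (\<integral>x. \<bar>f (?t + a n *\<^sub>R x)\<bar> \<partial>lebesgue) \<le> (a n)\<^sup>2 * (\<integral>x. \<bar>f (?t + a n *\<^sub>R x)\<bar> \<partial>lebesgue)"
      using a(2)[of n] by (intro mult_right_mono Bochner_Integration.integral_nonneg one_le_power) auto
    moreover have "D n z \<le> (\<integral>x. \<bar>f (?t + a n *\<^sub>R x)\<bar> + \<bar>f x\<bar> \<partial>lebesgue)"
      unfolding D_def using ifa[of ?t n] f by (intro integral_mono) auto
    moreover have "\<dots> = (\<integral>x. \<bar>f (?t + a n *\<^sub>R x)\<bar> \<partial>lebesgue) + (\<integral>x. \<bar>f x\<bar> \<partial>lebesgue)"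
      using ifa[of ?t n] f by (intro Bochner_Integration.integral_add) auto
    ultimately show ?thesis by linarith
  qed
  have FD: "(\<integral>\<^sup>+x. F n x z \<partial>lborel) = ennreal (mollifier 1 z * D n z)" for n z
  proof -
    have eq: "a n *\<^sub>R x + b n + (- e n) *\<^sub>R z = (b n + (- e n) *\<^sub>R z) + a n *\<^sub>R x" for x by simp
    have "(\<integral>\<^sup>+x. F n x z \<partial>lborel) = (\<integral>\<^sup>+x. F n x z \<partial>lebesgue)" by (simp add: nn_integral_completion)
    also have "\<dots> = ennreal (\<integral>x. mollifier 1 z * \<bar>f ((b n + (- e n) *\<^sub>R z) + a n *\<^sub>R x) - f x\<bar> \<partial>lebesgue)"
      unfolding F_def eq using ifa f mollifier_nonneg by (intro nn_integral_eq_integral) auto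
    finally show ?thesis by (simp add: D_def)
  qed
  have main: "(\<integral>\<^sup>+x. ennreal \<bar>conv (mollifier (e n)) f (a n *\<^sub>R x + b n) - f x\<bar> \<partial>lebesgue) \<le> (\<integral>\<^sup>+z. ennreal (mollifier 1 z * D n z) \<partial>lborel)" for n
  proof -
    have "ennreal \<bar>conv (mollifier (e n)) f (a n *\<^sub>R x + b n) - f x\<bar> \<le> (\<integral>\<^sup>+z. F n x z \<partial>lborel)" for x
    proof -
      let ?y = "a n *\<^sub>R x + b n"
      note ic = integrable_conv_mollifier[OF f e(2)[of n], of ?y]
      have "conv (mollifier (e n)) f ?y - f x = (\<integral>z. mollifier 1 z * f (?y + (- e n) *\<^sub>R z) \<partial>lebesgue) - (\<integral>z. mollifier 1 z * f x \<partial>lebesgue)"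
        by (simp add: conv_mollifier[OF f e(2)] integral_mollifier_1)
      also have "\<dots> = (\<integral>z. mollifier 1 z * (f (?y + (- e n) *\<^sub>R z) - f x) \<partial>lebesgue)"
        using ic i1 by (subst Bochner_Integration.integral_diff[symmetric]) (auto simp: algebra_simps)
      finally have eq: "conv (mollifier (e n)) f ?y - f x = (\<integral>z. mollifier 1 z * (f (?y + (- e n) *\<^sub>R z) - f x) \<partial>lebesgue)" .
      have "integrable lebesgue (\<lambda>z. mollifier 1 z * f (?y + (- e n) *\<^sub>R z) - mollifier 1 z * f x)"
        using ic i1 by auto
      then have "integrable lebesgue (\<lambda>z. mollifier 1 z * (f (?y + (- e n) *\<^sub>R z) - f x))"
        by (simp add: right_diff_distrib)
      from integral_norm_bound_ennreal[OF this]
      show ?thesis by (simp add: eq F_def abs_mult mollifier_nonneg nn_integral_completion)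
    qed
    then have "(\<integral>\<^sup>+x. ennreal \<bar>conv (mollifier (e n)) f (a n *\<^sub>R x + b n) - f x\<bar> \<partial>lborel) \<le> (\<integral>\<^sup>+x. \<integral>\<^sup>+z. F n x z \<partial>lborel \<partial>lborel)"
      by (intro nn_integral_mono)
    also have "\<dots> = (\<integral>\<^sup>+z. \<integral>\<^sup>+x. F n x z \<partial>lborel \<partial>lborel)"
      using lborel_pair.Fubini'[OF Fm] by simp
    finally show ?thesis by (simp add: FD nn_integral_completion)
  qed
  have w: "integrable lborel (\<lambda>z. mollifier 1 z * (2 * (\<integral>x. \<bar>f x\<bar> \<partial>lebesgue)))"
    using i1 by (simp add: integrable_completion)
  have wfin: "(\<integral>\<^sup>+z. ennreal (mollifier 1 z * (2 * (\<integral>x. \<bar>f x\<bar> \<partial>lebesgue))) \<partial>lborel) < \<infinity>"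
    using w mollifier_nonneg by (subst nn_integral_eq_integral) (auto intro!: mult_nonneg_nonneg Bochner_Integration.integral_nonneg)
  have le: "ennreal (mollifier 1 z * D n z) \<le> ennreal (mollifier 1 z * (2 * (\<integral>x. \<bar>f x\<bar> \<partial>lebesgue)))" for n z
    by (intro ennreal_leI mult_left_mono D_le mollifier_nonneg)
  have "(\<lambda>n. \<integral>\<^sup>+z. ennreal (mollifier 1 z * D n z) \<partial>lborel) \<longlonglongrightarrow> (\<integral>\<^sup>+z. 0 \<partial>(lborel :: (real^2) measure))"
  proof (rule nn_integral_dominated_convergence[OF _ _ _ _ wfin])
    show "(\<lambda>z. ennreal (mollifier 1 z * D n z)) \<in> borel_measurable lborel" for n
      unfolding FD[symmetric] by measurable
    show "AE z in lborel. (\<lambda>n. ennreal (mollifier 1 z * D n z)) \<longlonglongrightarrow> 0"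
    proof (intro AE_I2)
      fix z :: "real^2"
      have "(\<lambda>n. b n + (- e n) *\<^sub>R z) \<longlonglongrightarrow> 0 + (- 0) *\<^sub>R z" by (intro tendsto_intros b e)
      then have "(\<lambda>n. D n z) \<longlonglongrightarrow> 0"
        unfolding D_def by (intro L1_affine_continuity[OF f a]) simp
      then have "(\<lambda>n. mollifier 1 z * D n z) \<longlonglongrightarrow> mollifier 1 z * 0" by (intro tendsto_intros)
      then show "(\<lambda>n. ennreal (mollifier 1 z * D n z)) \<longlonglongrightarrow> 0"
        by (metis ennreal_0 mult_zero_right tendsto_ennrealI)
    qed
  qed (use le in auto)
  then have lim: "(\<lambda>n. \<integral>\<^sup>+z. ennreal (mollifier 1 z * D n z) \<partial>lborel) \<longlonglongrightarrow> 0" by simp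
  show "(\<lambda>n. \<integral>\<^sup>+x. ennreal \<bar>conv (mollifier (e n)) f (a n *\<^sub>R x + b n) - f x\<bar> \<partial>lebesgue) \<longlonglongrightarrow> 0"
    by (rule tendsto_sandwich[OF _ _ tendsto_const lim]) (use main in auto)
  show "(\<integral>\<^sup>+x. ennreal \<bar>conv (mollifier (e n)) f (a n *\<^sub>R x + b n) - f x\<bar> \<partial>lebesgue) < \<infinity>"
    using main[of n] wfin le by (meson nn_integral_mono order.strict_trans1)
qed

lemma conv_cong_AE:
  assumes "integrable lebesgue f" "integrable lebesgue f'" "AE x in lebesgue. f x = f' x" "k \<in> test_functions UNIV"
  shows "conv k f x = conv k f' x"
  unfolding conv_def
  using assms(3) integrable_shift[OF assms(1,4)] integrable_shift[OF assms(2,4)]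
  by (intro integral_cong_AE) auto

text \<open>Besides mollifying, the operator may dilate and translate; this is used to push the support of a
  function into the interior of a rectangle. A Lebesgue integrable function has the same
  mollifications as any Borel function to which it is almost everywhere equal.\<close>
lemma
  fixes f :: "real^2 \<Rightarrow> real"
  assumes f: "integrable lebesgue f"
    and a: "a \<longlonglongrightarrow> 1" "\<And>n. a n \<ge> 1" and b: "b \<longlonglongrightarrow> 0" and e: "e \<longlonglongrightarrow> 0" "\<And>n. e n > 0"
  shows mollify_L1: "(\<lambda>n. \<integral>x. \<bar>conv (mollifier (e n)) f (a n *\<^sub>R x + b n) - f x\<bar> \<partial>lebesgue) \<longlonglongrightarrow> 0"
    and integrable_mollify: "integrable lebesgue (\<lambda>x. conv (mollifier (e n)) f (a n *\<^sub>R x + b n))"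
proof -
  obtain g where g: "g \<in> borel_measurable borel" and "AE x in lborel. f x = g x"
    using completion_ex_borel_measurable_real[of f lborel] f by auto
  then have fg: "AE x in lebesgue. f x = g x" by (simp add: AE_completion)
  have gi: "integrable lebesgue g"
  proof (rule integrable_cong_AE_imp[OF f])
    show "g \<in> borel_measurable lebesgue" using g by (intro measurable_completion) simp
    show "AE x in lebesgue. f x = g x" by (rule fg)
  qed
  have eq: "(\<integral>\<^sup>+x. ennreal \<bar>conv (mollifier (e n)) f (a n *\<^sub>R x + b n) - f x\<bar> \<partial>lebesgue)
      = (\<integral>\<^sup>+x. ennreal \<bar>conv (mollifier (e n)) g (a n *\<^sub>R x + b n) - g x\<bar> \<partial>lebesgue)" for n
    using fg by (intro nn_integral_cong_AE) (auto simp: conv_cong_AE[OF f gi fg mollifier_test[OF e(2)]])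
  have cm: "(\<lambda>x. conv (mollifier (e n)) f (a n *\<^sub>R x + b n)) \<in> borel_measurable lebesgue" for n
    by (intro continuous_imp_lebesgue_measurable smooth_continuous smooth_affine smooth_conv[OF f] mollifier_test e)
  have id: "integrable lebesgue (\<lambda>x. conv (mollifier (e n)) f (a n *\<^sub>R x + b n) - f x)" for n
    using mollify_finite_borel[OF gi g a b e, of n] cm[of n] f by (intro integrableI_bounded) (auto simp: eq)
  from Bochner_Integration.integrable_add[OF id[of n] f]
  show "integrable lebesgue (\<lambda>x. conv (mollifier (e n)) f (a n *\<^sub>R x + b n))" by simp
  have "(\<lambda>n. ennreal (\<integral>x. \<bar>conv (mollifier (e n)) f (a n *\<^sub>R x + b n) - f x\<bar> \<partial>lebesgue)) \<longlonglongrightarrow> ennreal 0"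
    using mollify_L1_borel[OF gi g a b e] id
    by (subst nn_integral_eq_integral[symmetric]) (auto simp: eq)
  then show "(\<lambda>n. \<integral>x. \<bar>conv (mollifier (e n)) f (a n *\<^sub>R x + b n) - f x\<bar> \<partial>lebesgue) \<longlonglongrightarrow> 0"
    by (subst (asm) tendsto_ennreal_iff) (auto intro: Bochner_Integration.integral_nonneg)
qed

section \<open>Weak gradients and their uniqueness\<close>

text \<open>The maximum norm is the one that fits the support of the kernel, which is a square.\<close>
lemma compact_thickening:
  fixes K :: "(real^2) set"
  assumes "compact K" "open \<Omega>" "K \<subseteq> \<Omega>"
  obtains \<delta> K' where "\<delta> > 0" "compact K'" "K \<subseteq> K'" "K' \<subseteq> \<Omega>"
    "\<forall>x\<in>K. \<forall>y. (\<forall>i. \<bar>(x - y) $ i\<bar> \<le> \<delta>) \<longrightarrow> y \<in> K'"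
proof -
  obtain \<epsilon> where \<epsilon>: "\<epsilon> > 0" "(\<Union>x\<in>K. cball x \<epsilon>) \<subseteq> \<Omega>"
    using compact_subset_open_imp_cball_epsilon_subset[OF assms] by blast
  have "y \<in> (\<Union>x\<in>K. cball x \<epsilon>)" if "x \<in> K" "\<And>i. \<bar>(x - y) $ i\<bar> \<le> \<epsilon> / 2" for x y
  proof -
    have "norm (x - y) \<le> (\<Sum>i\<in>UNIV. \<bar>(x - y) $ i\<bar>)" by (rule norm_le_l1_cart)
    also have "\<dots> \<le> \<epsilon>" using that(2)[of 1] that(2)[of 2] by (simp add: sum_2)
    finally show ?thesis using that(1) by (auto simp: dist_norm)
  qed
  then show thesis
    using \<epsilon> compact_minkowski_sum_cball[OF assms(1), of \<epsilon>]
    by (intro that[of "\<epsilon> / 2" "\<Union>x\<in>K. cball x \<epsilon>"]) (auto intro!: bexI)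
qed

lemma integral_vanishing_outside:
  fixes h :: "real^2 \<Rightarrow> real"
  assumes "\<Omega> \<in> sets lebesgue" "\<And>x. x \<notin> \<Omega> \<Longrightarrow> h x = 0"
  shows "(\<integral>x. h x \<partial>lebesgue_on \<Omega>) = (\<integral>x. h x \<partial>lebesgue)"
proof -
  have "(\<lambda>x. if x \<in> \<Omega> then h x else 0) = h" using assms(2) by auto
  with Lebesgue_Measure.integral_restrict_UNIV[OF assms(1), of h] show ?thesis by simp
qed

lemma integrable_vanishing_outside:
  fixes h :: "real^2 \<Rightarrow> 'b::{banach, second_countable_topology}"
  assumes "\<Omega> \<in> sets lebesgue" "\<And>x. x \<notin> \<Omega> \<Longrightarrow> h x = 0"
  shows "integrable (lebesgue_on \<Omega>) h \<longleftrightarrow> integrable lebesgue h"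
proof -
  have "(\<lambda>x. if x \<in> \<Omega> then h x else 0) = h" using assms(2) by auto
  with Lebesgue_Measure.integrable_restrict_UNIV[OF assms(1), of h] show ?thesis by simp
qed

lemma integrable_bounded_mult:
  fixes f h :: "'a \<Rightarrow> real"
  assumes f: "integrable M f" and h: "h \<in> borel_measurable M" and B: "AE x in M. \<bar>h x\<bar> \<le> B"
  shows "integrable M (\<lambda>x. h x * f x)"
proof (rule Bochner_Integration.integrable_bound)
  show "integrable M (\<lambda>x. B * f x)" using f by simp
  show "(\<lambda>x. h x * f x) \<in> borel_measurable M" using f h by auto
  show "AE x in M. norm (h x * f x) \<le> norm (B * f x)"
    using B by eventually_elim (auto simp: abs_mult intro!: mult_right_mono)
qed

lemma locally_integrable_component:
  fixes G :: "real^2 \<Rightarrow> real^2"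
  assumes "locally_integrable \<Omega> G"
  shows "locally_integrable \<Omega> (\<lambda>x. G x $ i)"
  unfolding locally_integrable_def
proof (intro allI impI)
  fix K assume K: "compact K \<and> K \<subseteq> \<Omega>"
  then have K': "integrable (lebesgue_on K) G" "K \<in> sets lebesgue"
    using assms lmeasurable_compact by (auto simp: locally_integrable_def intro: fmeasurableD)
  from spec[OF iffD1[OF integrable_iff_component[OF K'(2)] K'(1)]]
  show "integrable (lebesgue_on K) (\<lambda>x. G x $ i)" .
qed

lemma locally_integrable_cutoff:
  fixes w :: "real^2 \<Rightarrow> real"
  assumes "locally_integrable \<Omega> w" "compact K" "K \<subseteq> \<Omega>"
  shows "integrable lebesgue (\<lambda>x. if x \<in> K then w x else 0)"
  using assms Lebesgue_Measure.integrable_restrict_UNIV[of K w] fmeasurableD[OF lmeasurable_compact[OF assms(2)]]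
  by (simp add: locally_integrable_def)

lemma locally_integrable_test:
  fixes w :: "real^2 \<Rightarrow> real"
  assumes w: "locally_integrable \<Omega> w" and h: "continuous_on UNIV h"
    and C: "compact C" "C \<subseteq> \<Omega>" "\<And>x. x \<notin> C \<Longrightarrow> h x = 0"
  shows "integrable lebesgue (\<lambda>x. h x * w x)"
proof -
  obtain B where "\<And>x. norm (h x) \<le> B"
    using continuous_compact_support_bounded[OF h C(1,3)] by blast
  then have "integrable lebesgue (\<lambda>x. h x * (if x \<in> C then w x else 0))"
    by (intro integrable_bounded_mult[OF locally_integrable_cutoff[OF w C(1,2)] continuous_imp_lebesgue_measurable[OF h]])
      auto
  moreover have "(\<lambda>x. h x * (if x \<in> C then w x else 0)) = (\<lambda>x. h x * w x)" using C(3) by auto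
  ultimately show ?thesis by simp
qed

lemma
  fixes w :: "real^2 \<Rightarrow> real"
  assumes w: "locally_integrable \<Omega> w" and \<phi>: "\<phi> \<in> test_functions \<Omega>"
  shows locally_integrable_times_test: "integrable lebesgue (\<lambda>x. \<phi> x * w x)"
    and locally_integrable_times_grad: "integrable lebesgue (\<lambda>x. w x * grad \<phi> x $ i)"
proof -
  obtain C where C: "smooth \<phi>" "compact C" "C \<subseteq> \<Omega>" "\<And>x. x \<notin> C \<Longrightarrow> \<phi> x = 0"
    "\<And>x. x \<notin> C \<Longrightarrow> grad \<phi> x = 0"
    by (rule test_functionsE[OF \<phi>]) (rule that)
  show "integrable lebesgue (\<lambda>x. \<phi> x * w x)"
    using locally_integrable_test[OF w smooth_continuous[OF C(1)] C(2-4)] .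
  have "integrable lebesgue (\<lambda>x. grad \<phi> x $ i * w x)"
    using C(5) by (intro locally_integrable_test[OF w smooth_continuous[OF smooth_grad[OF C(1)]] C(2,3)]) auto
  then show "integrable lebesgue (\<lambda>x. w x * grad \<phi> x $ i)" by (simp add: mult.commute)
qed

text \<open>This form, with scalar integrals over the whole plane, is the one in which convolutions can be used.
  It is equivalent because test functions and their gradients vanish outside \<open>\<Omega>\<close>.\<close>
lemma has_weak_gradient_iff:
  assumes "open \<Omega>"
  shows "has_weak_gradient \<Omega> w G \<longleftrightarrow> locally_integrable \<Omega> w \<and> locally_integrable \<Omega> G \<and>
    (\<forall>\<phi> \<in> test_functions \<Omega>. \<forall>i.
       (\<integral>x. w x * grad \<phi> x $ i \<partial>lebesgue) = - (\<integral>x. \<phi> x * G x $ i \<partial>lebesgue))"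
proof -
  have \<Omega>: "\<Omega> \<in> sets lebesgue" using assms by auto
  have "(\<integral>x. w x *\<^sub>R grad \<phi> x \<partial>lebesgue_on \<Omega>) = - (\<integral>x. \<phi> x *\<^sub>R G x \<partial>lebesgue_on \<Omega>) \<longleftrightarrow>
    (\<forall>i. (\<integral>x. w x * grad \<phi> x $ i \<partial>lebesgue) = - (\<integral>x. \<phi> x * G x $ i \<partial>lebesgue))"
    if w: "locally_integrable \<Omega> w" and G: "locally_integrable \<Omega> G" and \<phi>: "\<phi> \<in> test_functions \<Omega>" for \<phi>
  proof -
    obtain C where C: "C \<subseteq> \<Omega>" "\<And>x. x \<notin> C \<Longrightarrow> \<phi> x = 0" "\<And>x. x \<notin> C \<Longrightarrow> grad \<phi> x = 0"
      by (rule test_functionsE[OF \<phi>]) (rule that)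
    then have z: "\<phi> x = 0" "grad \<phi> x = 0" if "x \<notin> \<Omega>" for x using that by auto
    have "integrable (lebesgue_on \<Omega>) (\<lambda>x. w x *\<^sub>R grad \<phi> x)"
      using locally_integrable_times_grad[OF w \<phi>] z
      by (subst integrable_iff_component[OF \<Omega>]) (simp add: integrable_vanishing_outside[OF \<Omega>])
    from integral_bounded_linear[OF bounded_linear_vec_nth this]
    have 1: "(\<integral>x. w x *\<^sub>R grad \<phi> x \<partial>lebesgue_on \<Omega>) $ i = (\<integral>x. w x * grad \<phi> x $ i \<partial>lebesgue)" for i
      using z by (simp add: integral_vanishing_outside[OF \<Omega>])
    have "integrable (lebesgue_on \<Omega>) (\<lambda>x. \<phi> x *\<^sub>R G x)"
      using locally_integrable_times_test[OF locally_integrable_component[OF G] \<phi>] z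
      by (subst integrable_iff_component[OF \<Omega>]) (simp add: integrable_vanishing_outside[OF \<Omega>])
    from integral_bounded_linear[OF bounded_linear_vec_nth this]
    have 2: "(\<integral>x. \<phi> x *\<^sub>R G x \<partial>lebesgue_on \<Omega>) $ i = (\<integral>x. \<phi> x * G x $ i \<partial>lebesgue)" for i
      using z by (simp add: integral_vanishing_outside[OF \<Omega>])
    show ?thesis by (simp add: vec_eq_iff 1 2)
  qed
  then show ?thesis unfolding has_weak_gradient_def by blast
qed

lemma shifted_mollifier_test:
  assumes e: "e > 0" and K: "K \<subseteq> \<Omega>" "\<And>y. (\<And>i. \<bar>(x - y) $ i\<bar> \<le> e) \<Longrightarrow> y \<in> K"
  shows "(\<lambda>y. mollifier e (x - y)) \<in> test_functions \<Omega>"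
    and "grad (\<lambda>y. mollifier e (x - y)) y = - grad (mollifier e) (x - y)"
    and "y \<notin> K \<Longrightarrow> mollifier e (x - y) = 0"
proof -
  have sm: "smooth (mollifier e)" using mollifier_test[OF e] by (simp add: test_functions_def)
  show z: "y \<notin> K \<Longrightarrow> mollifier e (x - y) = 0" for y
    using mollifier_support[OF e, of "x - y"] K(2)[of y] by blast
  let ?C = "cbox (\<chi> i. x $ i - e) (\<chi> i. x $ i + e)"
  show "(\<lambda>y. mollifier e (x - y)) \<in> test_functions \<Omega>"
  proof (rule test_functionsI[OF _ compact_cbox[of "\<chi> i. x $ i - e" "\<chi> i. x $ i + e"]])
    show "smooth (\<lambda>y. mollifier e (x - y))" using smooth_affine[OF sm, of "-1" x] by simp
    show "?C \<subseteq> \<Omega>"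
    proof
      fix y assume "y \<in> ?C"
      then have "\<bar>(x - y) $ i\<bar> \<le> e" for i by (auto simp: mem_box_cart abs_le_iff algebra_simps)
      then show "y \<in> \<Omega>" using K by blast
    qed
    show "mollifier e (x - y) = 0" if "y \<notin> ?C" for y
    proof (rule ccontr)
      assume "mollifier e (x - y) \<noteq> 0"
      from mollifier_support[OF e this] have "\<bar>x $ i - y $ i\<bar> \<le> e" for i by simp
      then have "x $ i - e \<le> y $ i \<and> y $ i \<le> x $ i + e" for i by (simp add: abs_le_iff) (smt (verit))
      with that show False by (simp add: mem_box_cart)
    qed
  qed
  show "grad (\<lambda>y. mollifier e (x - y)) y = - grad (mollifier e) (x - y)"
    using grad_affine(2)[OF smooth_differentiable[OF sm], of "-1" x y] by simp
qed

text \<open>As the closed square of half side \<open>e\<close> around \<open>x\<close> lies in \<open>\<Omega>\<close>, \<open>y \<mapsto> mollifier e (x - y)\<close> is a test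
  function on \<open>\<Omega>\<close>, so the defining identity of the weak gradient moves the derivative from the kernel
  onto \<open>w\<close>. The cut-off to a compact set makes the functions integrable on the plane.\<close>
lemma grad_mollified_weak:
  assumes \<Omega>: "open \<Omega>" and w: "has_weak_gradient \<Omega> w G" and K': "compact K" "K \<subseteq> \<Omega>"
    and e: "e > 0" and K: "\<And>y. (\<And>i. \<bar>(x - y) $ i\<bar> \<le> e) \<Longrightarrow> y \<in> K"
  shows "grad (conv (mollifier e) (\<lambda>y. if y \<in> K then w y else 0)) x $ i =
    conv (mollifier e) (\<lambda>y. if y \<in> K then G y $ i else 0) x"
proof -
  note t = shifted_mollifier_test[OF e K'(2) K]
  have lw: "locally_integrable \<Omega> w" using w by (simp add: has_weak_gradient_def)
  have "grad (conv (mollifier e) (\<lambda>y. if y \<in> K then w y else 0)) x $ i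
     = (\<integral>y. grad (mollifier e) (x - y) $ i * (if y \<in> K then w y else 0) \<partial>lebesgue)"
    by (simp add: grad_conv[OF locally_integrable_cutoff[OF lw K'] mollifier_test[OF e]] conv_def)
  also have "\<dots> = (\<integral>y. - (w y * grad (\<lambda>y. mollifier e (x - y)) y $ i) \<partial>lebesgue)"
  proof (rule Bochner_Integration.integral_cong[OF refl])
    fix y
    have "grad (mollifier e) (x - y) = 0" if "y \<notin> K"
    proof -
      have "grad (\<lambda>y. mollifier e (x - y)) y = 0"
        by (rule grad_zero_outside[OF compact_imp_closed[OF K'(1)] _ that]) (rule t(3))
      then show ?thesis using t(2) by simp
    qed
    moreover have "grad (\<lambda>y. mollifier e (x - y)) y $ i = - grad (mollifier e) (x - y) $ i"
      using t(2) by simp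
    ultimately show "grad (mollifier e) (x - y) $ i * (if y \<in> K then w y else 0) = - (w y * grad (\<lambda>y. mollifier e (x - y)) y $ i)"
      by auto
  qed
  also have "\<dots> = (\<integral>y. mollifier e (x - y) * G y $ i \<partial>lebesgue)"
    using w t(1) unfolding has_weak_gradient_iff[OF \<Omega>] by simp
  also have "\<dots> = conv (mollifier e) (\<lambda>y. if y \<in> K then G y $ i else 0) x"
    unfolding conv_def using t(3) by (intro Bochner_Integration.integral_cong) auto
  finally show ?thesis .
qed

lemma mollify_L1_seq:
  fixes f :: "real^2 \<Rightarrow> real"
  assumes f: "integrable lebesgue f" and "\<delta> > 0"
  defines "e \<equiv> \<lambda>n. \<delta> / real (Suc n)"
  shows "(\<lambda>n. \<integral>x. \<bar>conv (mollifier (e n)) f x - f x\<bar> \<partial>lebesgue) \<longlonglongrightarrow> 0"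
    and "integrable lebesgue (conv (mollifier (e n)) f)"
    and "e n > 0" "e n \<le> \<delta>"
proof -
  have e0: "e \<longlonglongrightarrow> 0"
    unfolding e_def using LIMSEQ_Suc[OF lim_const_over_n[of \<delta>]] by simp
  show ep: "e n > 0" for n using assms(2) by (simp add: e_def)
  show "e n \<le> \<delta>" using assms(2) by (simp add: e_def field_simps)
  show "(\<lambda>n. \<integral>x. \<bar>conv (mollifier (e n)) f x - f x\<bar> \<partial>lebesgue) \<longlonglongrightarrow> 0"
    using mollify_L1[OF f tendsto_const _ tendsto_const e0 ep] by simp
  show "integrable lebesgue (conv (mollifier (e n)) f)"
    using integrable_mollify[OF f tendsto_const _ tendsto_const e0 ep] by simp
qed

lemma AE_on_compacts:
  assumes "open \<Omega>" "\<And>K. compact K \<Longrightarrow> K \<subseteq> \<Omega> \<Longrightarrow> AE x in lebesgue. x \<in> K \<longrightarrow> P x"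
  shows "AE x in lebesgue_on (\<Omega> :: (real^2) set). P x"
proof -
  obtain C :: "nat \<Rightarrow> (real^2) set" where C: "\<And>n. compact (C n)" "\<And>n. C n \<subseteq> \<Omega>" "\<Union>(range C) = \<Omega>"
    by (rule open_Union_compact_subsets[OF assms(1)]) (rule that)
  have "AE x in lebesgue. \<forall>n. x \<in> C n \<longrightarrow> P x"
    by (subst AE_all_countable) (intro allI assms(2)[OF C(1,2)])
  then have "AE x in lebesgue. x \<in> \<Omega> \<longrightarrow> P x"
    by eventually_elim (use C(3) in auto)
  then show ?thesis using assms(1) by (subst AE_restrict_space_iff) auto
qed

text \<open>The kernels centred at points of a compact set are test functions, so the mollifications of \<open>h\<close>
  vanish there; but they converge to \<open>h\<close> in \<open>L\<^sup>1\<close>.\<close>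
lemma fundamental_lemma_of_variations:
  fixes h :: "real^2 \<Rightarrow> real"
  assumes \<Omega>: "open \<Omega>" and h: "locally_integrable \<Omega> h"
    and 0: "\<And>\<phi>. \<phi> \<in> test_functions \<Omega> \<Longrightarrow> (\<integral>x. \<phi> x * h x \<partial>lebesgue) = 0"
  shows "AE x in lebesgue_on \<Omega>. h x = 0"
proof (rule AE_on_compacts[OF \<Omega>])
  fix K assume K: "compact K" "K \<subseteq> \<Omega>"
  obtain \<delta> K' where \<delta>: "\<delta> > 0" "compact K'" "K \<subseteq> K'" "K' \<subseteq> \<Omega>"
    "\<forall>x\<in>K. \<forall>y. (\<forall>i. \<bar>(x - y) $ i\<bar> \<le> \<delta>) \<longrightarrow> y \<in> K'"
    by (rule compact_thickening[OF K(1) \<Omega> K(2)]) (rule that)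
  define H where "H x = (if x \<in> K' then h x else 0)" for x
  have H: "integrable lebesgue H" unfolding H_def by (rule locally_integrable_cutoff[OF h \<delta>(2,4)])
  note m = mollify_L1_seq[OF H \<delta>(1)]
  have c0: "conv (mollifier (\<delta> / real (Suc n))) H x = 0" if "x \<in> K" for n x
  proof -
    have K': "y \<in> K'" if "\<And>i. \<bar>(x - y) $ i\<bar> \<le> \<delta> / real (Suc n)" for y
      using bspec[OF \<delta>(5) \<open>x \<in> K\<close>, THEN spec, THEN mp, OF allI[OF order_trans[OF that m(4)]]] .
    note t = shifted_mollifier_test[OF m(3) \<delta>(4) K']
    have "conv (mollifier (\<delta> / real (Suc n))) H x = (\<integral>y. mollifier (\<delta> / real (Suc n)) (x - y) * h y \<partial>lebesgue)"
      unfolding conv_def H_def using t(3) by (intro Bochner_Integration.integral_cong) auto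
    also have "\<dots> = 0" by (rule 0[OF t(1)])
    finally show ?thesis .
  qed
  have iK: "integrable lebesgue (\<lambda>x. if x \<in> K then \<bar>H x\<bar> else 0)"
  proof -
    have "integrable lebesgue (\<lambda>x. indicator K x * \<bar>H x\<bar>)"
      using H K fmeasurableD[OF lmeasurable_compact[OF K(1)]]
      by (intro integrable_bounded_mult[where B = 1]) (auto simp: indicator_def)
    moreover have "(\<lambda>x. indicator K x * \<bar>H x\<bar>) = (\<lambda>x. if x \<in> K then \<bar>H x\<bar> else 0)" by auto
    ultimately show ?thesis by simp
  qed
  have "(\<integral>x. (if x \<in> K then \<bar>H x\<bar> else 0) \<partial>lebesgue) \<le> (\<integral>x. \<bar>conv (mollifier (\<delta> / real (Suc n))) H x - H x\<bar> \<partial>lebesgue)" for n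
    using iK m(2) H by (intro integral_mono) (auto simp: c0 simp del: of_nat_Suc)
  then have "(\<integral>x. (if x \<in> K then \<bar>H x\<bar> else 0) \<partial>lebesgue) \<le> 0"
    by (intro LIMSEQ_le_const[OF m(1)]) auto
  moreover have "(\<integral>x. (if x \<in> K then \<bar>H x\<bar> else 0) \<partial>lebesgue) \<ge> 0"
    by (rule Bochner_Integration.integral_nonneg) auto
  ultimately have "(\<integral>x. (if x \<in> K then \<bar>H x\<bar> else 0) \<partial>lebesgue) = 0" by simp
  then have "AE x in lebesgue. (if x \<in> K then \<bar>H x\<bar> else 0) = 0"
    by (subst (asm) integral_nonneg_eq_0_iff_AE[OF iK]) auto
  then show "AE x in lebesgue. x \<in> K \<longrightarrow> h x = 0"
    by eventually_elim (use \<delta>(3) in \<open>auto simp: H_def split: if_splits\<close>)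
qed

lemma weak_gradient_unique:
  assumes \<Omega>: "open \<Omega>" and "has_weak_gradient \<Omega> w G" "has_weak_gradient \<Omega> w' G'"
    and ww: "AE x in lebesgue_on \<Omega>. w x = w' x"
  shows "AE x in lebesgue_on \<Omega>. G x = G' x"
proof -
  note W = assms(2,3)[unfolded has_weak_gradient_iff[OF \<Omega>]]
  have ww': "AE x in lebesgue. x \<in> \<Omega> \<longrightarrow> w x = w' x"
    using ww \<Omega> by (subst (asm) AE_restrict_space_iff) auto
  have "AE x in lebesgue_on \<Omega>. G x $ i - G' x $ i = 0" for i
  proof (rule fundamental_lemma_of_variations[OF \<Omega>])
    have l: "locally_integrable \<Omega> (\<lambda>x. G x $ i)" "locally_integrable \<Omega> (\<lambda>x. G' x $ i)"
      using W by (auto intro: locally_integrable_component)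
    then show "locally_integrable \<Omega> (\<lambda>x. G x $ i - G' x $ i)"
      by (auto simp: locally_integrable_def)
    fix \<phi> assume \<phi>: "\<phi> \<in> test_functions \<Omega>"
    obtain C where C: "C \<subseteq> \<Omega>" "\<And>x. x \<notin> C \<Longrightarrow> grad \<phi> x = 0"
      by (rule test_functionsE[OF \<phi>]) (rule that)
    have "(\<integral>x. \<phi> x * (G x $ i - G' x $ i) \<partial>lebesgue) = (\<integral>x. \<phi> x * G x $ i \<partial>lebesgue) - (\<integral>x. \<phi> x * G' x $ i \<partial>lebesgue)"
      unfolding right_diff_distrib
      by (rule Bochner_Integration.integral_diff[OF locally_integrable_times_test[OF l(1) \<phi>] locally_integrable_times_test[OF l(2) \<phi>]])
    also have "\<dots> = (\<integral>x. w' x * grad \<phi> x $ i \<partial>lebesgue) - (\<integral>x. w x * grad \<phi> x $ i \<partial>lebesgue)"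
      using W \<phi> by simp
    also have "(\<integral>x. w' x * grad \<phi> x $ i \<partial>lebesgue) = (\<integral>x. w x * grad \<phi> x $ i \<partial>lebesgue)"
    proof (rule integral_cong_AE)
      show "AE x in lebesgue. w' x * grad \<phi> x $ i = w x * grad \<phi> x $ i"
        using ww' by eventually_elim (use C in force)
    qed (use W \<phi> locally_integrable_times_grad in blast)+
    finally show "(\<integral>x. \<phi> x * (G x $ i - G' x $ i) \<partial>lebesgue) = 0" by simp
  qed
  then have "AE x in lebesgue_on \<Omega>. \<forall>i. G x $ i - G' x $ i = 0" by (simp add: AE_all_countable)
  then show ?thesis by eventually_elim (simp add: vec_eq_iff)
qed

section \<open>The chain rule for weak gradients\<close>

text \<open>Along a subsequence \<open>|u n| + |v n|\<close> tends to \<open>0\<close> almost everywhere; this gives one subsequence that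
  works for both sequences.\<close>
lemma common_AE_subseq:
  fixes u v :: "nat \<Rightarrow> 'a \<Rightarrow> real"
  assumes u: "\<And>n. integrable M (u n)" "(\<lambda>n. \<integral>x. \<bar>u n x\<bar> \<partial>M) \<longlonglongrightarrow> 0"
    and v: "\<And>n. integrable M (v n)" "(\<lambda>n. \<integral>x. \<bar>v n x\<bar> \<partial>M) \<longlonglongrightarrow> 0"
  obtains r :: "nat \<Rightarrow> nat" where "strict_mono r"
    "AE x in M. (\<lambda>n. u (r n) x) \<longlonglongrightarrow> 0 \<and> (\<lambda>n. v (r n) x) \<longlonglongrightarrow> 0"
proof -
  let ?s = "\<lambda>n x. \<bar>u n x\<bar> + \<bar>v n x\<bar>"
  have i: "integrable M (?s n)" for n using u(1) v(1) by auto
  have "(\<integral>x. norm (?s n x) \<partial>M) = (\<integral>x. \<bar>u n x\<bar> \<partial>M) + (\<integral>x. \<bar>v n x\<bar> \<partial>M)" for n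
    using u(1) v(1) by (simp add: Bochner_Integration.integral_add)
  then have "(\<lambda>n. \<integral>x. norm (?s n x) \<partial>M) \<longlonglongrightarrow> 0"
    using tendsto_add[OF u(2) v(2)] by simp
  from tendsto_L1_AE_subseq[of M ?s, OF i this]
  obtain r where r: "strict_mono r" "AE x in M. (\<lambda>n. ?s (r n) x) \<longlonglongrightarrow> 0" by blast
  have "AE x in M. (\<lambda>n. u (r n) x) \<longlonglongrightarrow> 0 \<and> (\<lambda>n. v (r n) x) \<longlonglongrightarrow> 0"
    using r(2)
  proof eventually_elim
    case (elim x)
    have "(\<lambda>n. u (r n) x) \<longlonglongrightarrow> 0" by (rule Lim_null_comparison[OF _ elim]) auto
    moreover have "(\<lambda>n. v (r n) x) \<longlonglongrightarrow> 0" by (rule Lim_null_comparison[OF _ elim]) auto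
    ultimately show ?case by blast
  qed
  with r(1) show thesis by (rule that)
qed

text \<open>Split \<open>c n * g n - c' * f\<close> into \<open>c n * (g n - f)\<close>, which is small in \<open>L\<^sup>1\<close> by boundedness of \<open>c n\<close>, and
  \<open>(c n - c') * f\<close>, to which dominated convergence applies.\<close>
lemma tendsto_integral_bounded_mult:
  fixes c :: "nat \<Rightarrow> 'a \<Rightarrow> real"
  assumes c: "\<And>n. c n \<in> borel_measurable M" "\<And>n x. \<bar>c n x\<bar> \<le> B"
    and c': "c' \<in> borel_measurable M" "AE x in M. (\<lambda>n. c n x) \<longlonglongrightarrow> c' x"
    and f: "integrable M f" and g: "\<And>n. integrable M (g n)" "(\<lambda>n. \<integral>x. \<bar>g n x - f x\<bar> \<partial>M) \<longlonglongrightarrow> 0"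
  shows "(\<lambda>n. \<integral>x. c n x * g n x \<partial>M) \<longlonglongrightarrow> (\<integral>x. c' x * f x \<partial>M)"
proof -
  have 1: "(\<lambda>n. \<integral>x. c n x * f x \<partial>M) \<longlonglongrightarrow> (\<integral>x. c' x * f x \<partial>M)"
  proof (rule integral_dominated_convergence[where w = "\<lambda>x. B * \<bar>f x\<bar>"])
    show "AE x in M. (\<lambda>n. c n x * f x) \<longlonglongrightarrow> c' x * f x"
      using c'(2) by eventually_elim (intro tendsto_intros)
    show "AE x in M. norm (c n x * f x) \<le> B * \<bar>f x\<bar>" for n
      using c(2) by (intro AE_I2) (simp add: abs_mult mult_right_mono)
  qed (use c c' f in auto)
  have i: "integrable M (\<lambda>x. c n x * (g n x - f x))" "integrable M (\<lambda>x. c n x * f x)" for n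
    using c f g by (auto intro!: integrable_bounded_mult[where B = B])
  have "(\<lambda>n. \<integral>x. c n x * (g n x - f x) \<partial>M) \<longlonglongrightarrow> 0"
  proof (rule Lim_null_comparison)
    show "eventually (\<lambda>n. norm (\<integral>x. c n x * (g n x - f x) \<partial>M) \<le> B * (\<integral>x. \<bar>g n x - f x\<bar> \<partial>M)) sequentially"
    proof (intro always_eventually allI)
      fix n
      have "norm (\<integral>x. c n x * (g n x - f x) \<partial>M) \<le> (\<integral>x. norm (c n x * (g n x - f x)) \<partial>M)"
        by (rule integral_norm_bound)
      also have "\<dots> \<le> (\<integral>x. B * \<bar>g n x - f x\<bar> \<partial>M)"
        using i f g c(2) by (intro integral_mono integrable_norm) (auto simp: abs_mult mult_right_mono)
      finally show "norm (\<integral>x. c n x * (g n x - f x) \<partial>M) \<le> B * (\<integral>x. \<bar>g n x - f x\<bar> \<partial>M)" by simp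
    qed
    show "(\<lambda>n. B * (\<integral>x. \<bar>g n x - f x\<bar> \<partial>M)) \<longlonglongrightarrow> 0"
      using tendsto_mult[OF tendsto_const[of B] g(2)] by simp
  qed
  from tendsto_add[OF this 1] show ?thesis
    using i by (simp add: Bochner_Integration.integral_add[symmetric] algebra_simps)
qed

lemma integrable_const_compact:
  "compact K \<Longrightarrow> integrable (lebesgue_on (K :: (real^2) set)) (\<lambda>x. c :: real)"
proof -
  assume K: "compact K"
  have "integrable lebesgue (\<lambda>x. c * indicator K x :: real)"
    using lmeasurable_compact[OF K] by (intro integrable_mult_right) (simp add: lmeasurable_iff_integrable)
  moreover have "(\<lambda>x. c * indicator K x) = (\<lambda>x. if x \<in> K then c else 0)" by auto
  ultimately show ?thesis
    using Lebesgue_Measure.integrable_restrict_UNIV[of K "\<lambda>x. c"] fmeasurableD[OF lmeasurable_compact[OF K]] by simp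
qed

text \<open>For the mollified functions this is the classical chain rule followed by integration by parts.
  In the limit, \<open>F (u n) (w n) - F u w\<close> tends to \<open>0\<close> in \<open>L\<^sup>1\<close> because \<open>F\<close> is Lipschitz, the mollified gradients
  converge in \<open>L\<^sup>1\<close>, and their coefficients are bounded and converge almost everywhere along a
  subsequence by continuity of the partial derivatives \<open>Fs\<close> and \<open>Ft\<close>.\<close>
lemma weak_gradient_chain_rule:
  fixes F Fs Ft :: "real \<Rightarrow> real \<Rightarrow> real"
  assumes \<Omega>: "open \<Omega>" and u: "has_weak_gradient \<Omega> u G" and w: "has_weak_gradient \<Omega> w H"
    and F: "\<And>s t. ((\<lambda>p. F (fst p) (snd p)) has_derivative (\<lambda>h. Fs s t * fst h + Ft s t * snd h)) (at (s, t))"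
    and Fs: "continuous_on UNIV (\<lambda>p. Fs (fst p) (snd p))" "\<And>s t. \<bar>Fs s t\<bar> \<le> B"
    and Ft: "continuous_on UNIV (\<lambda>p. Ft (fst p) (snd p))" "\<And>s t. \<bar>Ft s t\<bar> \<le> B"
  shows "has_weak_gradient \<Omega> (\<lambda>x. F (u x) (w x)) (\<lambda>x. Fs (u x) (w x) *\<^sub>R G x + Ft (u x) (w x) *\<^sub>R H x)"
proof -
  have B0: "0 \<le> B" by (rule order_trans[OF abs_ge_zero Fs(2)])
  have Fc: "continuous_on UNIV (\<lambda>p. F (fst p) (snd p))"
    using F by (auto intro!: continuous_at_imp_continuous_on has_derivative_continuous)
  have Fm: "(\<lambda>x. F (p x) (q x)) \<in> borel_measurable M" and F1m: "(\<lambda>x. Fs (p x) (q x)) \<in> borel_measurable M"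
    and F2m: "(\<lambda>x. Ft (p x) (q x)) \<in> borel_measurable M"
    if "p \<in> borel_measurable M" "q \<in> borel_measurable M" for p q and M :: "(real^2) measure"
    using borel_measurable_continuous_Pair[OF that Fc] borel_measurable_continuous_Pair[OF that Fs(1)]
      borel_measurable_continuous_Pair[OF that Ft(1)] by auto
  have Flip: "\<bar>F s t - F s' t'\<bar> \<le> 2 * B * (\<bar>s - s'\<bar> + \<bar>t - t'\<bar>)" for s t s' t'
  proof -
    have "onorm (\<lambda>h. Fs s t * fst h + Ft s t * snd h) \<le> 2 * B" for s t
    proof (rule onorm_bound)
      fix h :: "real \<times> real"
      have "\<bar>Fs s t * fst h\<bar> \<le> B * norm h" "\<bar>Ft s t * snd h\<bar> \<le> B * norm h"
        unfolding abs_mult using Fs(2) Ft(2) B0 norm_fst_le[of "fst h" "snd h"] norm_snd_le[of "snd h" "fst h"]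
        by (auto intro!: mult_mono)
      then show "norm (Fs s t * fst h + Ft s t * snd h) \<le> 2 * B * norm h" by simp
    qed (use B0 in simp)
    then have "norm (F (fst (s, t)) (snd (s, t)) - F (fst (s', t')) (snd (s', t'))) \<le> 2 * B * norm ((s, t) - (s', t'))"
      by (intro differentiable_bound[of UNIV "\<lambda>p. F (fst p) (snd p)" "\<lambda>p h. Fs (fst p) (snd p) * fst h + Ft (fst p) (snd p) * snd h"])
         (use F in auto)
    also have "\<dots> \<le> 2 * B * (\<bar>s - s'\<bar> + \<bar>t - t'\<bar>)"
      using B0 norm_Pair_le[of "s - s'" "t - t'"] by (intro mult_left_mono) auto
    finally show ?thesis by simp
  qed
  note U = u[unfolded has_weak_gradient_iff[OF \<Omega>]] and W = w[unfolded has_weak_gradient_iff[OF \<Omega>]]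
  have li: "locally_integrable \<Omega> u" "locally_integrable \<Omega> w" "locally_integrable \<Omega> G" "locally_integrable \<Omega> H"
    using U W by auto
  show ?thesis
    unfolding has_weak_gradient_iff[OF \<Omega>]
  proof (intro conjI ballI allI)
    show "locally_integrable \<Omega> (\<lambda>x. F (u x) (w x))"
      unfolding locally_integrable_def
    proof (intro allI impI)
      fix K assume K: "compact K \<and> K \<subseteq> \<Omega>"
      then have i: "integrable (lebesgue_on K) u" "integrable (lebesgue_on K) w"
        using li by (auto simp: locally_integrable_def)
      show "integrable (lebesgue_on K) (\<lambda>x. F (u x) (w x))"
      proof (rule Bochner_Integration.integrable_bound)
        show "integrable (lebesgue_on K) (\<lambda>x. \<bar>F 0 0\<bar> + 2 * B * (\<bar>u x\<bar> + \<bar>w x\<bar>))"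
          using i integrable_const_compact K by (intro Bochner_Integration.integrable_add integrable_mult_right integrable_abs) auto
        show "(\<lambda>x. F (u x) (w x)) \<in> borel_measurable (lebesgue_on K)" using i by (intro Fm) auto
        have "\<bar>F s t\<bar> \<le> \<bar>F 0 0\<bar> + 2 * B * (\<bar>s\<bar> + \<bar>t\<bar>)" for s t
          using Flip[of s t 0 0] by simp
        then show "AE x in lebesgue_on K. norm (F (u x) (w x)) \<le> norm (\<bar>F 0 0\<bar> + 2 * B * (\<bar>u x\<bar> + \<bar>w x\<bar>))"
          by (intro AE_I2) (auto intro: order_trans[OF _ abs_ge_self])
      qed
    qed
    show "locally_integrable \<Omega> (\<lambda>x. Fs (u x) (w x) *\<^sub>R G x + Ft (u x) (w x) *\<^sub>R H x)"
      unfolding locally_integrable_def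
    proof (intro allI impI)
      fix K assume K: "compact K \<and> K \<subseteq> \<Omega>"
      then have i: "integrable (lebesgue_on K) u" "integrable (lebesgue_on K) w"
        "integrable (lebesgue_on K) (\<lambda>x. G x $ i)" "integrable (lebesgue_on K) (\<lambda>x. H x $ i)" for i
        using li(1,2) locally_integrable_component[OF li(3), of i] locally_integrable_component[OF li(4), of i]
        by (auto simp: locally_integrable_def)
      have "K \<in> sets lebesgue" using K lmeasurable_compact by (auto intro: fmeasurableD)
      then show "integrable (lebesgue_on K) (\<lambda>x. Fs (u x) (w x) *\<^sub>R G x + Ft (u x) (w x) *\<^sub>R H x)"
        using i Fs(2) Ft(2) F1m F2m
        by (subst integrable_iff_component)
           (auto intro!: Bochner_Integration.integrable_add integrable_bounded_mult[where B = B])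
    qed
    fix \<phi> i assume \<phi>: "\<phi> \<in> test_functions \<Omega>"
    obtain C where C: "smooth \<phi>" "compact C" "C \<subseteq> \<Omega>" "\<And>x. x \<notin> C \<Longrightarrow> \<phi> x = 0"
      "\<And>x. x \<notin> C \<Longrightarrow> grad \<phi> x = 0"
      by (rule test_functionsE[OF \<phi>]) (rule that)
    obtain L where L: "L > 0" "\<And>x. \<bar>\<phi> x\<bar> \<le> L" "\<And>x. norm (grad \<phi> x) \<le> L"
      using test_functions_bounded[OF \<phi>] by blast
    obtain \<delta> K where \<delta>: "\<delta> > 0" "compact K" "C \<subseteq> K" "K \<subseteq> \<Omega>"
      "\<forall>x\<in>C. \<forall>y. (\<forall>i. \<bar>(x - y) $ i\<bar> \<le> \<delta>) \<longrightarrow> y \<in> K"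
      by (rule compact_thickening[OF C(2) \<Omega> C(3)]) (rule that)
    define u' where "u' x = (if x \<in> K then u x else 0)" for x
    define w' where "w' x = (if x \<in> K then w x else 0)" for x
    define G' where "G' x = (if x \<in> K then G x $ i else 0)" for x
    define H' where "H' x = (if x \<in> K then H x $ i else 0)" for x
    have iu: "integrable lebesgue u'" and iw: "integrable lebesgue w'"
      and iG: "integrable lebesgue G'" and iH: "integrable lebesgue H'"
      unfolding u'_def w'_def G'_def H'_def
      using \<delta>(2,4) li by (auto intro!: locally_integrable_cutoff locally_integrable_component)
    define e where "e n = \<delta> / real (Suc n)" for n
    note m = mollify_L1_seq[OF _ \<delta>(1), folded e_def]
    define un where "un n = conv (mollifier (e n)) u'" for n
    define wn where "wn n = conv (mollifier (e n)) w'" for n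
    define Gn where "Gn n = conv (mollifier (e n)) G'" for n
    define Hn where "Hn n = conv (mollifier (e n)) H'" for n
    have e: "e n > 0" "e n \<le> \<delta>" for n using m(3,4)[OF iu] by auto
    have sm: "smooth (un n)" "smooth (wn n)" for n
      unfolding un_def wn_def using smooth_conv[OF iu mollifier_test[OF e(1)]] smooth_conv[OF iw mollifier_test[OF e(1)]] by auto
    have near: "y \<in> K" if "x \<in> C" "\<And>j. \<bar>(x - y) $ j\<bar> \<le> e n" for x y n
      using bspec[OF \<delta>(5) that(1), THEN spec, THEN mp, OF allI[OF order_trans[OF that(2) e(2)]]] .
    have gu: "grad (un n) x $ i = Gn n x" if "x \<in> C" for n x
      unfolding un_def Gn_def u'_def G'_def
      by (rule grad_mollified_weak[OF \<Omega> u \<delta>(2,4) e(1)]) (rule near[OF that])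
    have gw: "grad (wn n) x $ i = Hn n x" if "x \<in> C" for n x
      unfolding wn_def Hn_def w'_def H'_def
      by (rule grad_mollified_weak[OF \<Omega> w \<delta>(2,4) e(1)]) (rule near[OF that])
    have idu: "integrable lebesgue (\<lambda>x. un n x - u' x)" and idw: "integrable lebesgue (\<lambda>x. wn n x - w' x)"
      and iGn: "integrable lebesgue (Gn n)" and iHn: "integrable lebesgue (Hn n)" for n
      unfolding un_def wn_def Gn_def Hn_def using m(2) iu iw iG iH by auto
    obtain r :: "nat \<Rightarrow> nat" where r: "strict_mono r"
      and AEr: "AE x in lebesgue. (\<lambda>n. un (r n) x - u' x) \<longlonglongrightarrow> 0 \<and> (\<lambda>n. wn (r n) x - w' x) \<longlonglongrightarrow> 0"
      using common_AE_subseq[OF idu m(1)[OF iu, folded un_def] idw m(1)[OF iw, folded wn_def]] by blast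
    define gn where "gn n x = F (un n x) (wn n x)" for n x
    have gnd: "(gn n has_derivative (\<lambda>h. Fs (un n x) (wn n x) * (h \<bullet> grad (un n) x) + Ft (un n x) (wn n x) * (h \<bullet> grad (wn n) x))) (at x)" for n x
    proof -
      have "(un n has_derivative (\<lambda>h. h \<bullet> grad (un n) x)) (at x)" "(wn n has_derivative (\<lambda>h. h \<bullet> grad (wn n) x)) (at x)"
        by (rule has_derivative_grad[OF smooth_differentiable[OF sm(1)]],
            rule has_derivative_grad[OF smooth_differentiable[OF sm(2)]])
      from has_derivative_compose[OF has_derivative_Pair[OF this] F]
      show ?thesis by (simp add: gn_def[abs_def])
    qed
    have ggn: "grad (gn n) x = Fs (un n x) (wn n x) *\<^sub>R grad (un n) x + Ft (un n x) (wn n x) *\<^sub>R grad (wn n) x" for n x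
      by (simp add: vec_eq_iff grad_eqI[OF gnd] inner_axis')
    have pc: "continuous_on UNIV (\<lambda>x. (un n x, wn n x))" for n
      by (intro continuous_on_Pair smooth_continuous sm)
    have cF1: "continuous_on UNIV (\<lambda>x. Fs (un n x) (wn n x))" for n
      using continuous_on_compose2[OF Fs(1) pc[of n]] by simp
    have cF2: "continuous_on UNIV (\<lambda>x. Ft (un n x) (wn n x))" for n
      using continuous_on_compose2[OF Ft(1) pc[of n]] by simp
    have cgn: "continuous_on UNIV (gn n)" for n
      using continuous_on_compose2[OF Fc pc[of n]] by (simp add: gn_def[abs_def])
    have um: "u' \<in> borel_measurable lebesgue" "w' \<in> borel_measurable lebesgue"
      "\<phi> \<in> borel_measurable lebesgue"
      using iu iw smooth_continuous[OF C(1)] by (auto intro: continuous_imp_lebesgue_measurable)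
    have bdd: "\<bar>\<phi> x * Fs s t\<bar> \<le> L * B" "\<bar>\<phi> x * Ft s t\<bar> \<le> L * B" for x s t
      unfolding abs_mult using L(1) by (intro mult_mono L(2) Fs(2) Ft(2); simp)+
    have cm: "(\<lambda>x. \<phi> x * Fs (un n x) (wn n x)) \<in> borel_measurable lebesgue"
      "(\<lambda>x. \<phi> x * Ft (un n x) (wn n x)) \<in> borel_measurable lebesgue" for n
      by (intro continuous_imp_lebesgue_measurable continuous_on_mult smooth_continuous[OF C(1)] cF1 cF2)+
    \<comment> \<open>on the support of \<open>\<phi>\<close> the gradient of a mollification is the mollified weak gradient\<close>
    have ibp: "(\<integral>x. gn n x * grad \<phi> x $ i \<partial>lebesgue) = - ((\<integral>x. \<phi> x * Fs (un n x) (wn n x) * Gn n x \<partial>lebesgue)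
        + (\<integral>x. \<phi> x * Ft (un n x) (wn n x) * Hn n x \<partial>lebesgue))" for n
    proof -
      have "(\<integral>x. gn n x * grad \<phi> x $ i \<partial>lebesgue) = - (\<integral>x. \<phi> x * grad (gn n) x $ i \<partial>lebesgue)"
      proof (rule integration_by_parts[OF \<phi>])
        show "gn n differentiable (at x)" for x using gnd differentiable_def by blast
        show "continuous_on UNIV (grad (gn n))"
          unfolding ggn[abs_def] using cF1 cF2 smooth_grad_continuous[OF sm(1)] smooth_grad_continuous[OF sm(2)]
          by (intro continuous_intros) auto
      qed
      also have "(\<integral>x. \<phi> x * grad (gn n) x $ i \<partial>lebesgue) = (\<integral>x. \<phi> x * Fs (un n x) (wn n x) * Gn n x + \<phi> x * Ft (un n x) (wn n x) * Hn n x \<partial>lebesgue)"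
      proof (rule Bochner_Integration.integral_cong[OF refl])
        fix x show "\<phi> x * grad (gn n) x $ i = \<phi> x * Fs (un n x) (wn n x) * Gn n x + \<phi> x * Ft (un n x) (wn n x) * Hn n x"
          by (cases "x \<in> C") (simp_all add: C(4) ggn gu gw algebra_simps)
      qed
      also have "\<dots> = (\<integral>x. \<phi> x * Fs (un n x) (wn n x) * Gn n x \<partial>lebesgue) + (\<integral>x. \<phi> x * Ft (un n x) (wn n x) * Hn n x \<partial>lebesgue)"
        by (rule Bochner_Integration.integral_add; rule integrable_bounded_mult[where B = "L * B"])
           (use iGn iHn cm bdd in auto)
      finally show ?thesis .
    qed
    have AE1: "AE x in lebesgue. (\<lambda>n. \<phi> x * Fs (un (r n) x) (wn (r n) x)) \<longlonglongrightarrow> \<phi> x * Fs (u' x) (w' x)"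
      and AE2: "AE x in lebesgue. (\<lambda>n. \<phi> x * Ft (un (r n) x) (wn (r n) x)) \<longlonglongrightarrow> \<phi> x * Ft (u' x) (w' x)"
    proof -
      have *: "(\<lambda>n. (un (r n) x, wn (r n) x)) \<longlonglongrightarrow> (u' x, w' x)"
        if "(\<lambda>n. un (r n) x - u' x) \<longlonglongrightarrow> 0 \<and> (\<lambda>n. wn (r n) x - w' x) \<longlonglongrightarrow> 0" for x
        using that by (intro tendsto_Pair) (auto simp: LIM_zero_iff)
      show "AE x in lebesgue. (\<lambda>n. \<phi> x * Fs (un (r n) x) (wn (r n) x)) \<longlonglongrightarrow> \<phi> x * Fs (u' x) (w' x)"
        using AEr
      proof eventually_elim
        case (elim x)
        from continuous_on_tendsto_compose[OF Fs(1) *[OF elim]] show ?case by (intro tendsto_intros) auto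
      qed
      show "AE x in lebesgue. (\<lambda>n. \<phi> x * Ft (un (r n) x) (wn (r n) x)) \<longlonglongrightarrow> \<phi> x * Ft (u' x) (w' x)"
        using AEr
      proof eventually_elim
        case (elim x)
        from continuous_on_tendsto_compose[OF Ft(1) *[OF elim]] show ?case by (intro tendsto_intros) auto
      qed
    qed
    have cm': "(\<lambda>x. \<phi> x * Fs (u' x) (w' x)) \<in> borel_measurable lebesgue" "(\<lambda>x. \<phi> x * Ft (u' x) (w' x)) \<in> borel_measurable lebesgue"
      using um F1m[OF um(1,2)] F2m[OF um(1,2)] by auto
    have lim1: "(\<lambda>n. \<integral>x. \<phi> x * Fs (un (r n) x) (wn (r n) x) * Gn (r n) x \<partial>lebesgue) \<longlonglongrightarrow> (\<integral>x. \<phi> x * Fs (u' x) (w' x) * G' x \<partial>lebesgue)"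
      using LIMSEQ_subseq_LIMSEQ[OF m(1)[OF iG] r]
      by (intro tendsto_integral_bounded_mult[OF cm(1) bdd(1) cm'(1) AE1 iG iGn]) (simp add: Gn_def comp_def)
    have lim2: "(\<lambda>n. \<integral>x. \<phi> x * Ft (un (r n) x) (wn (r n) x) * Hn (r n) x \<partial>lebesgue) \<longlonglongrightarrow> (\<integral>x. \<phi> x * Ft (u' x) (w' x) * H' x \<partial>lebesgue)"
      using LIMSEQ_subseq_LIMSEQ[OF m(1)[OF iH] r]
      by (intro tendsto_integral_bounded_mult[OF cm(2) bdd(2) cm'(2) AE2 iH iHn]) (simp add: Hn_def comp_def)
    have igp: "integrable lebesgue (\<lambda>x. gn n x * grad \<phi> x $ i)" for n
      by (intro integrable_continuous_compact[OF _ C(2)] continuous_on_mult cgn smooth_continuous[OF smooth_grad[OF C(1)]])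
         (simp add: C(5))
    have igp': "integrable lebesgue (\<lambda>x. F (u' x) (w' x) * grad \<phi> x $ i)"
    proof (rule Bochner_Integration.integrable_bound)
      show "integrable lebesgue (\<lambda>x. \<bar>gn 0 x * grad \<phi> x $ i\<bar> + L * (2 * B * (\<bar>un 0 x - u' x\<bar> + \<bar>wn 0 x - w' x\<bar>)))"
        using igp idu idw by (intro Bochner_Integration.integrable_add integrable_mult_right integrable_abs) auto
      show "(\<lambda>x. F (u' x) (w' x) * grad \<phi> x $ i) \<in> borel_measurable lebesgue"
        by (intro borel_measurable_times Fm[OF um(1,2)] continuous_imp_lebesgue_measurable
             smooth_continuous[OF smooth_grad[OF C(1)]])
      have "\<bar>F (u' x) (w' x) * grad \<phi> x $ i\<bar> \<le> \<bar>gn 0 x * grad \<phi> x $ i\<bar> + \<bar>grad \<phi> x $ i\<bar> * \<bar>gn 0 x - F (u' x) (w' x)\<bar>" for x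
        unfolding abs_mult[symmetric] by (simp add: algebra_simps)
      moreover have "\<bar>grad \<phi> x $ i\<bar> * \<bar>gn 0 x - F (u' x) (w' x)\<bar> \<le> L * (2 * B * (\<bar>un 0 x - u' x\<bar> + \<bar>wn 0 x - w' x\<bar>))" for x
        unfolding gn_def using L Flip order_trans[OF component_le_norm_cart L(3)] by (intro mult_mono) auto
      ultimately have "\<bar>F (u' x) (w' x) * grad \<phi> x $ i\<bar> \<le> \<bar>gn 0 x * grad \<phi> x $ i\<bar> + L * (2 * B * (\<bar>un 0 x - u' x\<bar> + \<bar>wn 0 x - w' x\<bar>))" for x
        by (meson add_left_mono order_trans)
      then show "AE x in lebesgue. norm (F (u' x) (w' x) * grad \<phi> x $ i) \<le> norm (\<bar>gn 0 x * grad \<phi> x $ i\<bar> + L * (2 * B * (\<bar>un 0 x - u' x\<bar> + \<bar>wn 0 x - w' x\<bar>)))"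
        by (intro AE_I2) (auto intro: order_trans[OF _ abs_ge_self])
    qed
    have lim0: "(\<lambda>n. \<integral>x. gn n x * grad \<phi> x $ i \<partial>lebesgue) \<longlonglongrightarrow> (\<integral>x. F (u' x) (w' x) * grad \<phi> x $ i \<partial>lebesgue)"
    proof (rule LIM_zero_cancel, rule Lim_null_comparison)
      show "eventually (\<lambda>n. norm ((\<integral>x. gn n x * grad \<phi> x $ i \<partial>lebesgue) - (\<integral>x. F (u' x) (w' x) * grad \<phi> x $ i \<partial>lebesgue))
        \<le> L * (2 * B * ((\<integral>x. \<bar>un n x - u' x\<bar> \<partial>lebesgue) + (\<integral>x. \<bar>wn n x - w' x\<bar> \<partial>lebesgue)))) sequentially"
      proof (intro always_eventually allI)
        fix n
        have "norm ((\<integral>x. gn n x * grad \<phi> x $ i \<partial>lebesgue) - (\<integral>x. F (u' x) (w' x) * grad \<phi> x $ i \<partial>lebesgue))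
           = norm (\<integral>x. gn n x * grad \<phi> x $ i - F (u' x) (w' x) * grad \<phi> x $ i \<partial>lebesgue)"
          using igp igp' by simp
        also have "\<dots> \<le> (\<integral>x. norm (gn n x * grad \<phi> x $ i - F (u' x) (w' x) * grad \<phi> x $ i) \<partial>lebesgue)"
          by (rule integral_norm_bound)
        also have "\<dots> \<le> (\<integral>x. L * (2 * B * (\<bar>un n x - u' x\<bar> + \<bar>wn n x - w' x\<bar>)) \<partial>lebesgue)"
        proof (rule integral_mono)
          show "integrable lebesgue (\<lambda>x. norm (gn n x * grad \<phi> x $ i - F (u' x) (w' x) * grad \<phi> x $ i))"
            using igp igp' by auto
          show "integrable lebesgue (\<lambda>x. L * (2 * B * (\<bar>un n x - u' x\<bar> + \<bar>wn n x - w' x\<bar>)))"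
            using idu idw by (intro Bochner_Integration.integrable_add integrable_mult_right integrable_abs) auto
          fix x
          have "norm (gn n x * grad \<phi> x $ i - F (u' x) (w' x) * grad \<phi> x $ i) = \<bar>grad \<phi> x $ i\<bar> * \<bar>gn n x - F (u' x) (w' x)\<bar>"
            by (simp add: abs_mult[symmetric] algebra_simps)
          also have "\<dots> \<le> L * (2 * B * (\<bar>un n x - u' x\<bar> + \<bar>wn n x - w' x\<bar>))"
            unfolding gn_def using L Flip order_trans[OF component_le_norm_cart L(3)] by (intro mult_mono) auto
          finally show "norm (gn n x * grad \<phi> x $ i - F (u' x) (w' x) * grad \<phi> x $ i) \<le> L * (2 * B * (\<bar>un n x - u' x\<bar> + \<bar>wn n x - w' x\<bar>))" .
        qed
        also have "\<dots> = L * (2 * B * ((\<integral>x. \<bar>un n x - u' x\<bar> \<partial>lebesgue) + (\<integral>x. \<bar>wn n x - w' x\<bar> \<partial>lebesgue)))"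
          using idu[of n] idw[of n] by (simp add: Bochner_Integration.integral_add)
        finally show "norm ((\<integral>x. gn n x * grad \<phi> x $ i \<partial>lebesgue) - (\<integral>x. F (u' x) (w' x) * grad \<phi> x $ i \<partial>lebesgue))
        \<le> L * (2 * B * ((\<integral>x. \<bar>un n x - u' x\<bar> \<partial>lebesgue) + (\<integral>x. \<bar>wn n x - w' x\<bar> \<partial>lebesgue)))" .
      qed
      have "(\<lambda>n. L * (2 * B * ((\<integral>x. \<bar>un n x - u' x\<bar> \<partial>lebesgue) + (\<integral>x. \<bar>wn n x - w' x\<bar> \<partial>lebesgue)))) \<longlonglongrightarrow> L * (2 * B * (0 + 0))"
        unfolding un_def wn_def by (intro tendsto_intros m(1) iu iw)
      then show "(\<lambda>n. L * (2 * B * ((\<integral>x. \<bar>un n x - u' x\<bar> \<partial>lebesgue) + (\<integral>x. \<bar>wn n x - w' x\<bar> \<partial>lebesgue)))) \<longlonglongrightarrow> 0" by simp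
    qed
    have "(\<integral>x. F (u' x) (w' x) * grad \<phi> x $ i \<partial>lebesgue) =
      - ((\<integral>x. \<phi> x * Fs (u' x) (w' x) * G' x \<partial>lebesgue) + (\<integral>x. \<phi> x * Ft (u' x) (w' x) * H' x \<partial>lebesgue))"
      using LIMSEQ_subseq_LIMSEQ[OF lim0 r] tendsto_minus[OF tendsto_add[OF lim1 lim2]]
      unfolding comp_def ibp by (rule LIMSEQ_unique)
    also have "(\<integral>x. \<phi> x * Fs (u' x) (w' x) * G' x \<partial>lebesgue) + (\<integral>x. \<phi> x * Ft (u' x) (w' x) * H' x \<partial>lebesgue)
      = (\<integral>x. \<phi> x * Fs (u' x) (w' x) * G' x + \<phi> x * Ft (u' x) (w' x) * H' x \<partial>lebesgue)"
      by (rule Bochner_Integration.integral_add[symmetric]; rule integrable_bounded_mult[where B = "L * B"])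
         (use iG iH cm' bdd in auto)
    also have "\<dots> = (\<integral>x. \<phi> x * (Fs (u x) (w x) *\<^sub>R G x + Ft (u x) (w x) *\<^sub>R H x) $ i \<partial>lebesgue)"
    proof (rule Bochner_Integration.integral_cong[OF refl])
      fix x show "\<phi> x * Fs (u' x) (w' x) * G' x + \<phi> x * Ft (u' x) (w' x) * H' x = \<phi> x * (Fs (u x) (w x) *\<^sub>R G x + Ft (u x) (w x) *\<^sub>R H x) $ i"
        using C(4)[of x] \<delta>(3) by (cases "x \<in> C") (auto simp: u'_def w'_def G'_def H'_def algebra_simps)
    qed
    also have "(\<integral>x. F (u' x) (w' x) * grad \<phi> x $ i \<partial>lebesgue) = (\<integral>x. F (u x) (w x) * grad \<phi> x $ i \<partial>lebesgue)"
    proof (rule Bochner_Integration.integral_cong[OF refl])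
      fix x show "F (u' x) (w' x) * grad \<phi> x $ i = F (u x) (w x) * grad \<phi> x $ i"
        using C(5)[of x] \<delta>(3) by (cases "x \<in> C") (auto simp: u'_def w'_def)
    qed
    finally show "(\<integral>x. F (u x) (w x) * grad \<phi> x $ i \<partial>lebesgue) =
      - (\<integral>x. \<phi> x * (Fs (u x) (w x) *\<^sub>R G x + Ft (u x) (w x) *\<^sub>R H x) $ i \<partial>lebesgue)" .
  qed
qed

section \<open>Functions with vanishing weak gradient\<close>

text \<open>On a convex compact set the mollifications have zero gradient, so they are constants there, and the
  function is almost everywhere equal to the limit of these constants. To compare different compact
  sets, each one is replaced by its convex hull with a fixed ball.\<close>
lemma weak_gradient_zero_imp_constant:
  assumes \<Omega>: "open \<Omega>" "convex \<Omega>" and w: "has_weak_gradient \<Omega> w G" and G: "AE x in lebesgue_on \<Omega>. G x = 0"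
  shows "\<exists>c. AE x in lebesgue_on \<Omega>. w x = c"
proof (cases "\<Omega> = {}")
  case True
  then have "AE x in lebesgue_on \<Omega>. w x = 0" by (subst AE_restrict_space_iff) auto
  then show ?thesis by blast
next
  case False
  have G': "AE x in lebesgue. x \<in> \<Omega> \<longrightarrow> G x = 0"
    using G \<Omega>(1) by (subst (asm) AE_restrict_space_iff) auto
  have const: "\<exists>c. AE x in lebesgue. x \<in> K \<longrightarrow> w x = c" if K: "compact K" "convex K" "K \<subseteq> \<Omega>" for K
  proof -
    obtain \<delta> K' where \<delta>: "\<delta> > 0" "compact K'" "K \<subseteq> K'" "K' \<subseteq> \<Omega>"
      "\<forall>x\<in>K. \<forall>y. (\<forall>i. \<bar>(x - y) $ i\<bar> \<le> \<delta>) \<longrightarrow> y \<in> K'"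
      by (rule compact_thickening[OF K(1) \<Omega>(1) K(3)]) (rule that)
    have lw: "locally_integrable \<Omega> w" using w by (simp add: has_weak_gradient_def)
    define w' where "w' x = (if x \<in> K' then w x else 0)" for x
    have iw: "integrable lebesgue w'" unfolding w'_def by (rule locally_integrable_cutoff[OF lw \<delta>(2,4)])
    define e where "e n = \<delta> / real (Suc n)" for n
    note m = mollify_L1_seq[OF iw \<delta>(1), folded e_def]
    have near: "y \<in> K'" if "x \<in> K" "\<And>j. \<bar>(x - y) $ j\<bar> \<le> e n" for x y n
      using bspec[OF \<delta>(5) that(1), THEN spec, THEN mp, OF allI[OF order_trans[OF that(2) m(4)]]] .
    have g0: "grad (conv (mollifier (e n)) w') x = 0" if "x \<in> K" for n x
    proof -
      have "grad (conv (mollifier (e n)) w') x $ i = conv (mollifier (e n)) (\<lambda>y. if y \<in> K' then G y $ i else 0) x" for i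
        unfolding w'_def by (rule grad_mollified_weak[OF \<Omega>(1) w \<delta>(2,4) m(3)]) (rule near[OF that])
      also have "conv (mollifier (e n)) (\<lambda>y. if y \<in> K' then G y $ i else 0) x = 0" for i
        unfolding conv_def
      proof (rule integral_eq_zero_AE)
        show "AE y in lebesgue. mollifier (e n) (x - y) * (if y \<in> K' then G y $ i else 0) = 0"
          using G' by eventually_elim (use \<delta>(4) in auto)
      qed
      finally show ?thesis by (simp add: vec_eq_iff)
    qed
    have "\<exists>c. \<forall>x\<in>K. conv (mollifier (e n)) w' x = c" for n
    proof (rule has_derivative_zero_constant[OF K(2)])
      fix x assume "x \<in> K"
      have "(conv (mollifier (e n)) w' has_derivative (\<lambda>h. h \<bullet> grad (conv (mollifier (e n)) w') x)) (at x)"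
        by (rule has_derivative_grad[OF conv_differentiable[OF iw mollifier_test[OF m(3)]]])
      then show "(conv (mollifier (e n)) w' has_derivative (\<lambda>h. 0)) (at x within K)"
        using g0[OF \<open>x \<in> K\<close>] by (auto intro: has_derivative_at_withinI)
    qed
    then obtain c where c: "\<And>n x. x \<in> K \<Longrightarrow> conv (mollifier (e n)) w' x = c n" by metis
    have "(\<lambda>n. \<integral>x. norm (conv (mollifier (e n)) w' x - w' x) \<partial>lebesgue) \<longlonglongrightarrow> 0" using m(1) by simp
    from tendsto_L1_AE_subseq[OF Bochner_Integration.integrable_diff[OF m(2) iw] this]
    obtain r where "AE x in lebesgue. (\<lambda>n. conv (mollifier (e (r n))) w' x - w' x) \<longlonglongrightarrow> 0" by blast
    then have "AE x in lebesgue. x \<in> K \<longrightarrow> w x = lim (\<lambda>n. c (r n))"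
    proof eventually_elim
      case (elim x)
      show ?case
      proof
        assume "x \<in> K"
        then have "(\<lambda>n. c (r n)) \<longlonglongrightarrow> w x"
          using elim \<delta>(3) by (auto simp: c w'_def LIM_zero_iff)
        then show "w x = lim (\<lambda>n. c (r n))" by (rule limI[symmetric])
      qed
    qed
    then show ?thesis by blast
  qed
  obtain x0 \<epsilon> where x0: "\<epsilon> > 0" "cball x0 \<epsilon> \<subseteq> \<Omega>"
    using False \<Omega>(1) open_contains_cball by blast
  obtain c0 where c0: "AE x in lebesgue. x \<in> cball x0 \<epsilon> \<longrightarrow> w x = c0"
    using const[OF compact_cball convex_cball x0(2)] by blast
  have "AE x in lebesgue_on \<Omega>. w x = c0"
  proof (rule AE_on_compacts[OF \<Omega>(1)])
    fix K assume K: "compact K" "K \<subseteq> \<Omega>"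
    let ?K = "convex hull (K \<union> cball x0 \<epsilon>)"
    have "compact ?K" using K(1) by (intro compact_convex_hull compact_Un compact_cball)
    moreover have "?K \<subseteq> \<Omega>" using K(2) x0(2) \<Omega>(2) by (intro hull_minimal) auto
    ultimately obtain c1 where c1: "AE x in lebesgue. x \<in> ?K \<longrightarrow> w x = c1"
      using const[OF _ convex_convex_hull] by blast
    have sub: "K \<union> cball x0 \<epsilon> \<subseteq> ?K" by (rule hull_subset)
    \<comment> \<open>the two constants agree on the ball, which is not a null set\<close>
    have "c1 = c0"
    proof (rule ccontr)
      assume "c1 \<noteq> c0"
      have "AE x in lebesgue. x \<notin> ball x0 \<epsilon>"
        using c0 c1
      proof eventually_elim
        case (elim x)
        then show ?case using sub \<open>c1 \<noteq> c0\<close> ball_subset_cball by blast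
      qed
      then have "ball x0 \<epsilon> \<in> null_sets lebesgue" by (subst AE_iff_null_sets) auto
      then show False using open_not_negligible[of "ball x0 \<epsilon>"] x0(1) by (simp add: negligible_iff_null_sets)
    qed
    with c1 show "AE x in lebesgue. x \<in> K \<longrightarrow> w x = c0"
      using sub by (auto elim!: eventually_mono)
  qed
  then show ?thesis by blast
qed

section \<open>Divergence free fields and integrable weak gradients\<close>

text \<open>The kernel is nonnegative with integral \<open>1\<close>.\<close>
lemma conv_mollifier_bounded:
  assumes f: "integrable lebesgue f" and e: "e > 0" and B: "\<And>y. \<bar>f y\<bar> \<le> B"
  shows "\<bar>conv (mollifier e) f x\<bar> \<le> B"
proof -
  have i1: "integrable lebesgue (mollifier 1)" by (rule test_functions_integrable[OF mollifier_test]) simp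
  note i = integrable_conv_mollifier[OF f e, of x]
  have "norm (conv (mollifier e) f x) \<le> (\<integral>z. norm (mollifier 1 z * f (x + (- e) *\<^sub>R z)) \<partial>lebesgue)"
    unfolding conv_mollifier[OF f e] by (rule integral_norm_bound)
  also have "\<dots> \<le> (\<integral>z. mollifier 1 z * B \<partial>lebesgue)"
    using i i1 B by (intro integral_mono integrable_norm) (auto simp: abs_mult mollifier_nonneg intro!: mult_left_mono)
  finally show ?thesis by (simp add: integral_mollifier_1)
qed

text \<open>Let \<open>\<zeta>\<close> be \<open>\<xi>\<close> extended by \<open>0\<close>. The fields \<open>\<eta> n\<close> are mollifications of \<open>\<zeta>\<close>, evaluated at
  \<open>c + s (x - c)\<close> with \<open>c\<close> the centre of the rectangle and \<open>s = s n > 1\<close>. Their support is contained in the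
  closed \<open>e n\<close>-neighbourhood of the rectangle, shrunk towards \<open>c\<close> by the factor \<open>s n\<close>; it lies inside
  the rectangle because \<open>e n\<close> is small compared with \<open>s n - 1\<close>. They are divergence free, as
  their divergence at \<open>x\<close> is, up to a factor, the integral of \<open>\<langle>\<xi>, \<nabla>\<psi>\<rangle>\<close> with a translated kernel \<open>\<psi>\<close>. Thus
  \<open>\<integral>\<langle>\<eta> n, G\<rangle> = 0\<close> by the definition of the weak gradient \<open>G\<close>, and \<open>n\<close> tends to infinity. The
  assumption on \<open>\<xi>\<close> is made for functions that are smooth up to the boundary and so contains the
  vanishing of the normal trace.\<close>
lemma divergence_free_pairing:
  fixes \<xi> :: "real^2 \<Rightarrow> real^2"
  assumes \<Omega>: "\<Omega> = box a b" and ab: "\<And>i. a $ i < b $ i"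
    and \<xi>: "\<xi> \<in> borel_measurable (lebesgue_on \<Omega>)" "\<And>x. norm (\<xi> x) \<le> 1"
    and div: "\<And>\<phi>. smooth \<phi> \<Longrightarrow> (\<integral>x. \<xi> x \<bullet> grad \<phi> x \<partial>lebesgue_on \<Omega>) = 0"
    and g: "has_weak_gradient \<Omega> g G" and iG: "integrable (lebesgue_on \<Omega>) G"
  shows "(\<integral>x. \<xi> x \<bullet> G x \<partial>lebesgue_on \<Omega>) = 0"
proof -
  have op: "open \<Omega>" and \<Omega>s: "\<Omega> \<in> sets lebesgue" by (auto simp: \<Omega>)
  define \<zeta> where "\<zeta> i x = (if x \<in> \<Omega> then \<xi> x $ i else 0)" for i x
  have \<zeta>m: "\<zeta> i \<in> borel_measurable lebesgue" for i
    unfolding \<zeta>_def using \<Omega>s \<xi>(1) by (subst borel_measurable_if) (auto simp: cart_eq_inner_axis intro: borel_measurable_inner)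
  have \<zeta>1: "\<bar>\<zeta> i x\<bar> \<le> 1" for i x
    using order_trans[OF component_le_norm_cart \<xi>(2)] by (auto simp: \<zeta>_def)
  have i\<zeta>: "integrable lebesgue (\<zeta> i)" for i
  proof (rule integrable_bounded_compact[OF \<zeta>m compact_cbox[of a b]])
    show "\<zeta> i x = 0" if "x \<notin> cbox a b" for x
      using that box_subset_cbox[of a b] by (auto simp: \<zeta>_def \<Omega>)
    show "norm (\<zeta> i x) \<le> 1" for x using \<zeta>1 by simp
  qed
  define G' where "G' i x = (if x \<in> \<Omega> then G x $ i else 0)" for i x
  have iG': "integrable lebesgue (G' i)" for i
    unfolding G'_def using iG \<Omega>s integrable_iff_component[OF \<Omega>s, of G]
    by (subst Lebesgue_Measure.integrable_restrict_UNIV) auto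
  define c where "c = (1/2) *\<^sub>R (a + b)"
  define h where "h i = (b $ i - a $ i) / 2" for i
  \<comment> \<open>\<open>\<rho>\<close> is less than both half side lengths, so the mollification radius \<open>\<rho> * t n\<close> is less than the margin
     \<open>h i * t n\<close> gained by the dilation factor \<open>1 + t n\<close>\<close>
  define \<rho> where "\<rho> = min (h 1) (h 2) / 2"
  have h: "h i > 0" for i using ab by (simp add: h_def)
  have \<rho>: "\<rho> > 0" "\<rho> < h i" for i using h[of 1] h[of 2] exhaust_2[of i] by (auto simp: \<rho>_def min_def)
  have in\<Omega>: "x \<in> \<Omega> \<longleftrightarrow> (\<forall>i. \<bar>x $ i - c $ i\<bar> < h i)" for x
    unfolding \<Omega> mem_box_cart
    by (rule all_cong1) (auto simp: c_def h_def abs_less_iff field_simps)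
  define t where "t n = inverse (real (Suc n))" for n
  have t: "t n > 0" "t \<longlonglongrightarrow> 0" for n
    unfolding t_def by (simp, rule LIMSEQ_inverse_real_of_nat)
  define s where "s n = 1 + t n" for n
  define z where "z n = (- t n) *\<^sub>R c" for n
  define e where "e n = \<rho> * t n" for n
  have s: "s \<longlonglongrightarrow> 1" "s n \<ge> 1" for n
    using tendsto_add[OF tendsto_const[of "1::real"] t(2)] t(1)[of n] by (simp_all add: s_def[abs_def])
  have z: "z \<longlonglongrightarrow> 0"
    using tendsto_scaleR[OF tendsto_minus[OF t(2)] tendsto_const[of c]] by (simp add: z_def[abs_def])
  have e: "e \<longlonglongrightarrow> 0" "e n > 0" for n
    using tendsto_mult[OF tendsto_const[of \<rho>] t(2)] t(1) \<rho> by (simp_all add: e_def[abs_def])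
  have arg: "(s n *\<^sub>R x + z n) $ i - c $ i = s n * (x $ i - c $ i)" for n x i
    by (simp add: s_def z_def algebra_simps)
  define \<eta> where "\<eta> n i x = conv (mollifier (e n)) (\<zeta> i) (s n *\<^sub>R x + z n)" for n i x
  have sm: "smooth (conv (mollifier (e n)) (\<zeta> i))" for n i
    by (rule smooth_conv[OF i\<zeta> mollifier_test[OF e(2)]])
  have sm\<eta>: "smooth (\<eta> n i)" for n i
    unfolding \<eta>_def by (rule smooth_affine[OF sm])
  have \<eta>test: "\<eta> n i \<in> test_functions \<Omega>" for n i
  proof (rule test_functionsI[OF sm\<eta> compact_cbox])
    let ?C = "cbox (\<chi> j. c $ j - (h j + e n) / s n) (\<chi> j. c $ j + (h j + e n) / s n)"
    have mC: "x \<in> ?C \<longleftrightarrow> (\<forall>j. \<bar>x $ j - c $ j\<bar> \<le> (h j + e n) / s n)" for x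
      unfolding mem_box_cart by (rule all_cong1) (auto simp: abs_le_iff)
    have s0: "s n > 0" using s(2)[of n] by simp
    have "(h j + e n) / s n < h j" for j
      using s0 t(1)[of n] \<rho>(2)[of j] by (simp add: divide_less_eq e_def s_def algebra_simps)
    then show "?C \<subseteq> \<Omega>" unfolding subset_iff mC in\<Omega> by (meson le_less_trans)
    show "\<eta> n i x = 0" if nx: "x \<notin> ?C" for x
    proof -
      obtain j where j: "\<bar>x $ j - c $ j\<bar> > (h j + e n) / s n" using nx mC[of x] by (meson not_le)
      then have j': "\<bar>(s n *\<^sub>R x + z n) $ j - c $ j\<bar> > h j + e n"
        unfolding arg abs_mult using s0 by (simp add: divide_less_eq mult.commute)
      have "mollifier (e n) (s n *\<^sub>R x + z n - y) * \<zeta> i y = 0" for y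
      proof (cases "y \<in> \<Omega>")
        case True
        then have "\<bar>y $ j - c $ j\<bar> < h j" by (simp add: in\<Omega>)
        with j' have "\<bar>(s n *\<^sub>R x + z n - y) $ j\<bar> > e n" by simp
        then show ?thesis using mollifier_support[OF e(2), of n "s n *\<^sub>R x + z n - y" j] by force
      qed (simp add: \<zeta>_def)
      then show ?thesis unfolding \<eta>_def conv_def by (intro integral_eq_zero_AE AE_I2)
    qed
  qed
  have div\<eta>: "(\<Sum>i\<in>UNIV. grad (\<eta> n i) x $ i) = 0" for n x
  proof -
    let ?y = "s n *\<^sub>R x + z n" and ?k = "mollifier (e n)"
    have sk: "smooth ?k" using mollifier_test[OF e(2)] by (simp add: test_functions_def)
    \<comment> \<open>\<open>\<psi> y = ?k (?y - y)\<close> is smooth on the plane, hence admissible in the assumption on \<open>\<xi>\<close>\<close>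
    have gr: "grad (\<eta> n i) x $ i = s n * conv (\<lambda>z. grad ?k z $ i) (\<zeta> i) ?y" for i
      unfolding \<eta>_def
      by (simp add: grad_affine(2)[OF smooth_differentiable[OF sm]] grad_conv[OF i\<zeta> mollifier_test[OF e(2)]])
    have g\<psi>: "grad (\<lambda>y. ?k (?y - y)) y = - grad ?k (?y - y)" for y
      using grad_affine(2)[OF smooth_differentiable[OF sk], of "-1" ?y y] by simp
    have "smooth (\<lambda>y. ?k (?y - y))" using smooth_affine[OF sk, of "-1" ?y] by simp
    from div[OF this] have "(\<integral>y. \<xi> y \<bullet> grad ?k (?y - y) \<partial>lebesgue_on \<Omega>) = 0" by (simp add: g\<psi>)
    then have "0 = (\<integral>y. (if y \<in> \<Omega> then \<xi> y \<bullet> grad ?k (?y - y) else 0) \<partial>lebesgue)"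
      using Lebesgue_Measure.integral_restrict_UNIV[OF \<Omega>s, of "\<lambda>y. \<xi> y \<bullet> grad ?k (?y - y)"] by simp
    also have "\<dots> = (\<integral>y. (\<Sum>i\<in>UNIV. grad ?k (?y - y) $ i * \<zeta> i y) \<partial>lebesgue)"
      by (rule Bochner_Integration.integral_cong) (auto simp: \<zeta>_def inner_vec_def mult.commute)
    also have "\<dots> = (\<Sum>i\<in>UNIV. conv (\<lambda>z. grad ?k z $ i) (\<zeta> i) ?y)"
      unfolding conv_def
      by (rule Bochner_Integration.integral_sum) (rule integrable_shift[OF i\<zeta> test_functions_grad[OF mollifier_test[OF e(2)]]])
    finally show ?thesis by (simp add: gr sum_distrib_left[symmetric])
  qed
  note W = g[unfolded has_weak_gradient_iff[OF op]]
  have zero: "(\<Sum>i\<in>UNIV. \<integral>x. \<eta> n i x * G' i x \<partial>lebesgue) = 0" for n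
  proof -
    have "\<eta> n i x * G' i x = \<eta> n i x * G x $ i" for i x
    proof (cases "x \<in> \<Omega>")
      case False
      have "\<eta> n i x = 0" by (rule test_functionsE[OF \<eta>test[of n i]]) (use False in blast)
      then show ?thesis by simp
    qed (simp add: G'_def)
    then have "(\<Sum>i\<in>UNIV. \<integral>x. \<eta> n i x * G' i x \<partial>lebesgue) = (\<Sum>i\<in>UNIV. \<integral>x. \<eta> n i x * G x $ i \<partial>lebesgue)"
      by (simp only:)
    also have "\<dots> = (\<Sum>i\<in>UNIV. - (\<integral>x. g x * grad (\<eta> n i) x $ i \<partial>lebesgue))"
      using W \<eta>test by simp
    also have "\<dots> = - (\<integral>x. (\<Sum>i\<in>UNIV. g x * grad (\<eta> n i) x $ i) \<partial>lebesgue)"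
      using W locally_integrable_times_grad[OF _ \<eta>test] by (simp add: sum_negf Bochner_Integration.integral_sum)
    finally show ?thesis by (simp add: sum_distrib_left[symmetric] div\<eta>)
  qed
  have L1: "(\<lambda>n. \<integral>x. \<bar>\<eta> n i x - \<zeta> i x\<bar> \<partial>lebesgue) \<longlonglongrightarrow> 0" for i
    unfolding \<eta>_def by (rule mollify_L1[OF i\<zeta> s z e])
  have i\<eta>: "integrable lebesgue (\<lambda>x. \<eta> n i x - \<zeta> i x)" for n i
    using test_functions_integrable[OF \<eta>test] i\<zeta> by auto
  obtain r :: "nat \<Rightarrow> nat" where r: "strict_mono r"
    and AE12: "AE x in lebesgue. (\<lambda>n. \<eta> (r n) 1 x - \<zeta> 1 x) \<longlonglongrightarrow> 0 \<and> (\<lambda>n. \<eta> (r n) 2 x - \<zeta> 2 x) \<longlonglongrightarrow> 0"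
    using common_AE_subseq[OF i\<eta> L1 i\<eta> L1, of 1 2] by blast
  have AEr: "AE x in lebesgue. (\<lambda>n. \<eta> (r n) i x) \<longlonglongrightarrow> \<zeta> i x" for i
    using AE12 by eventually_elim (use exhaust_2[of i] in \<open>auto simp: LIM_zero_iff\<close>)
  have "(\<lambda>n. \<integral>x. \<eta> (r n) i x * G' i x \<partial>lebesgue) \<longlonglongrightarrow> (\<integral>x. \<zeta> i x * G' i x \<partial>lebesgue)" for i
  proof (rule tendsto_integral_bounded_mult[where B = 1])
    show "\<eta> (r n) i \<in> borel_measurable lebesgue" for n
      using test_functions_integrable[OF \<eta>test] by auto
    show "\<bar>\<eta> (r n) i x\<bar> \<le> 1" for n x
      unfolding \<eta>_def by (rule conv_mollifier_bounded[OF i\<zeta> e(2) \<zeta>1])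
  qed (use \<zeta>m AEr iG' in auto)
  then have "(\<lambda>n. \<Sum>i\<in>UNIV. \<integral>x. \<eta> (r n) i x * G' i x \<partial>lebesgue) \<longlonglongrightarrow> (\<Sum>i\<in>UNIV. \<integral>x. \<zeta> i x * G' i x \<partial>lebesgue)"
    by (intro tendsto_sum)
  then have "(\<Sum>i\<in>UNIV. \<integral>x. \<zeta> i x * G' i x \<partial>lebesgue) = 0"
    by (simp add: zero LIMSEQ_const_iff)
  also have "(\<Sum>i\<in>UNIV. \<integral>x. \<zeta> i x * G' i x \<partial>lebesgue) = (\<integral>x. (\<Sum>i\<in>UNIV. \<zeta> i x * G' i x) \<partial>lebesgue)"
    using integrable_bounded_mult[OF iG' \<zeta>m AE_I2[OF \<zeta>1]] by (intro Bochner_Integration.integral_sum[symmetric]) auto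
  also have "\<dots> = (\<integral>x. (if x \<in> \<Omega> then \<xi> x \<bullet> G x else 0) \<partial>lebesgue)"
    by (rule Bochner_Integration.integral_cong) (auto simp: \<zeta>_def G'_def inner_vec_def)
  also have "\<dots> = (\<integral>x. \<xi> x \<bullet> G x \<partial>lebesgue_on \<Omega>)"
    by (rule Lebesgue_Measure.integral_restrict_UNIV[OF \<Omega>s])
  finally show ?thesis .
qed

section \<open>The weak gradient of a quotient\<close>

text \<open>This is \<open>1 / (v + 1/v)\<close> written as a function of \<open>L = ln v\<close>. It decays at both ends fast enough to make
  the derivatives with respect to \<open>(u, ln v)\<close> of \<open>damp (ln v) * arctan (u/v)\<close> bounded.\<close>
definition damp :: "real \<Rightarrow> real" where "damp L = 1 / (exp L + exp (- L))"
definition damp_deriv :: "real \<Rightarrow> real" where "damp_deriv L = - (exp L - exp (- L)) / (exp L + exp (- L))\<^sup>2"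

lemma has_real_derivative_damp: "(damp has_real_derivative damp_deriv L) (at L)"
proof -
  have "exp L + exp (- L) \<noteq> 0" using exp_gt_zero[of L] exp_gt_zero[of "- L"] by linarith
  then show ?thesis unfolding damp_def[abs_def] damp_deriv_def
    by (auto intro!: derivative_eq_intros simp: power2_eq_square)
qed

lemma damp_bounds: "0 < damp L" "damp L \<le> 1" "damp L * exp (- L) \<le> 1" "\<bar>damp_deriv L\<bar> \<le> 1"
proof -
  have p: "exp L > 0" "exp (- L) > 0" by auto
  have ge: "exp L + exp (- L) \<ge> 1" using exp_ge_add_one_self[of L] exp_ge_add_one_self[of "- L"] by linarith
  show "0 < damp L" "damp L * exp (- L) \<le> 1" using p by (auto simp: damp_def field_simps add_pos_pos)
  show d: "damp L \<le> 1" using ge by (simp add: damp_def)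
  have "\<bar>exp L - exp (- L)\<bar> \<le> exp L + exp (- L)" using p by linarith
  also have "\<dots> \<le> (exp L + exp (- L))\<^sup>2" using ge by (simp add: power2_eq_square mult_le_cancel_left1)
  finally show "\<bar>damp_deriv L\<bar> \<le> 1" using ge by (simp add: damp_deriv_def abs_divide divide_le_eq)
qed

lemma damp_cont: "continuous_on S damp" "continuous_on S damp_deriv"
proof -
  have "exp L + exp (- L) \<noteq> 0" for L :: real using exp_gt_zero[of L] exp_gt_zero[of "- L"] by linarith
  then show "continuous_on S damp" "continuous_on S damp_deriv"
    unfolding damp_def[abs_def] damp_deriv_def[abs_def] by (auto intro!: continuous_intros)
qed

lemma abs_arctan_le: "\<bar>arctan y\<bar> \<le> 2"
  using arctan_bounded[of y] pi_less_4 by (simp add: abs_le_iff)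

lemma abs_frac_le_one: "\<bar>y / (1 + y\<^sup>2)\<bar> \<le> (1::real)"
proof -
  have "2 * \<bar>y\<bar> \<le> 1 + \<bar>y\<bar>\<^sup>2" using zero_le_power2[of "\<bar>y\<bar> - 1"] by (simp add: power2_diff)
  then have "\<bar>y\<bar> \<le> 1 + y\<^sup>2" using abs_ge_zero[of y] by (simp del: abs_ge_zero)
  then show ?thesis by (simp add: abs_divide divide_le_eq add_nonneg_pos)
qed

lemma one_plus_sq: "1 + y\<^sup>2 > (0::real)" "1 + y\<^sup>2 \<ge> (1::real)"
  using zero_le_power2[of y] by linarith+

lemma abs_divide_le_one:
  fixes x D :: real assumes "0 < x" "x \<le> 1" "1 \<le> D" shows "\<bar>x / D\<bar> \<le> 1"
proof -
  have "x \<le> D" "0 < D" using assms by linarith+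
  then show ?thesis using assms by (simp add: abs_divide divide_le_eq)
qed

text \<open>With \<open>L = ln v\<close> the function is \<open>damp L * arctan (u/v)\<close>. Its derivatives in \<open>u\<close> and \<open>L\<close> are bounded: the
  factor \<open>exp (- L) = 1/v\<close> in the first is controlled by \<open>damp L\<close>, and the factor \<open>u/v\<close> that differentiation in
  \<open>L\<close> produces is controlled by \<open>1 / (1 + (u/v)\<^sup>2)\<close>.\<close>
lemma weak_gradient_damped_quotient:
  assumes \<Omega>: "open \<Omega>" and u: "has_weak_gradient \<Omega> u Gu" and L: "has_weak_gradient \<Omega> L d"
  shows "has_weak_gradient \<Omega> (\<lambda>x. damp (L x) * arctan (u x * exp (- L x)))
    (\<lambda>x. (damp (L x) * exp (- L x) / (1 + (u x * exp (- L x))\<^sup>2)) *\<^sub>R Gu x +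
         (damp_deriv (L x) * arctan (u x * exp (- L x)) - damp (L x) * (u x * exp (- L x) / (1 + (u x * exp (- L x))\<^sup>2))) *\<^sub>R d x)"
proof (rule weak_gradient_chain_rule[OF \<Omega> u L, where B = 3 and F = "\<lambda>s t. damp t * arctan (s * exp (- t))"
      and Fs = "\<lambda>s t. damp t * exp (- t) / (1 + (s * exp (- t))\<^sup>2)"
      and Ft = "\<lambda>s t. damp_deriv t * arctan (s * exp (- t)) - damp t * (s * exp (- t) / (1 + (s * exp (- t))\<^sup>2))"])
  fix s t :: real
  have 1: "((\<lambda>p. damp (snd p)) has_derivative (\<lambda>h. snd h * damp_deriv t)) (at (s, t))"
    by (rule DERIV_compose_FDERIV[OF _ has_derivative_snd[OF has_derivative_ident]]) (simp add: has_real_derivative_damp)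
  have 2: "((\<lambda>p::real \<times> real. exp (- snd p)) has_derivative (\<lambda>h. - snd h * exp (- t))) (at (s, t))"
    by (auto intro!: derivative_eq_intros)
  have 3: "((\<lambda>p. arctan (fst p * exp (- snd p))) has_derivative
     (\<lambda>h. (s * (- snd h * exp (- t)) + fst h * exp (- t)) * inverse (1 + (s * exp (- t))\<^sup>2))) (at (s, t))"
    using DERIV_compose_FDERIV[OF _ has_derivative_mult[OF has_derivative_fst[OF has_derivative_ident] 2], of arctan "inverse (1 + (s * exp (- t))\<^sup>2)"]
      DERIV_arctan[of "s * exp (- t)"] by simp
  show "((\<lambda>p. damp (snd p) * arctan (fst p * exp (- snd p))) has_derivative
     (\<lambda>h. damp t * exp (- t) / (1 + (s * exp (- t))\<^sup>2) * fst h +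
       (damp_deriv t * arctan (s * exp (- t)) - damp t * (s * exp (- t) / (1 + (s * exp (- t))\<^sup>2))) * snd h)) (at (s, t))"
    by (rule has_derivative_eq_rhs[OF has_derivative_mult[OF 1 3]])
       (simp add: fun_eq_iff algebra_simps divide_inverse)
  have "\<bar>damp t * exp (- t) / (1 + (s * exp (- t))\<^sup>2)\<bar> \<le> 1"
    using damp_bounds[of t] one_plus_sq(2) by (intro abs_divide_le_one) auto
  then show "\<bar>damp t * exp (- t) / (1 + (s * exp (- t))\<^sup>2)\<bar> \<le> 3" by linarith
  have "\<bar>damp_deriv t * arctan (s * exp (- t))\<bar> \<le> 1 * 2"
    unfolding abs_mult using damp_bounds(4) abs_arctan_le by (intro mult_mono) auto
  moreover have "\<bar>damp t * (s * exp (- t) / (1 + (s * exp (- t))\<^sup>2))\<bar> \<le> 1 * 1"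
    unfolding abs_mult[of "damp t"] using damp_bounds[of t] abs_frac_le_one by (intro mult_mono) auto
  ultimately show "\<bar>damp_deriv t * arctan (s * exp (- t)) - damp t * (s * exp (- t) / (1 + (s * exp (- t))\<^sup>2))\<bar> \<le> 3"
    by linarith
next
  have c: "continuous_on UNIV (\<lambda>p :: real \<times> real. damp (snd p))"
    "continuous_on UNIV (\<lambda>p :: real \<times> real. damp_deriv (snd p))"
    by (rule continuous_on_compose2[OF damp_cont(1)[of UNIV]], auto intro!: continuous_intros)
       (rule continuous_on_compose2[OF damp_cont(2)[of UNIV]], auto intro!: continuous_intros)
  show "continuous_on UNIV (\<lambda>p. damp (snd p) * exp (- snd p) / (1 + (fst p * exp (- snd p))\<^sup>2))"
    using one_plus_sq(1) by (intro continuous_intros c) (simp add: less_imp_neq[symmetric])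
  show "continuous_on UNIV (\<lambda>p. damp_deriv (snd p) * arctan (fst p * exp (- snd p)) -
      damp (snd p) * (fst p * exp (- snd p) / (1 + (fst p * exp (- snd p))\<^sup>2)))"
    using one_plus_sq(1) by (intro continuous_intros c) (simp add: less_imp_neq[symmetric])
qed

lemma weak_gradient_damped:
  assumes \<Omega>: "open \<Omega>" and w: "has_weak_gradient \<Omega> w Gw" and L: "has_weak_gradient \<Omega> L d"
  shows "has_weak_gradient \<Omega> (\<lambda>x. damp (L x) * arctan (w x))
    (\<lambda>x. (damp (L x) / (1 + (w x)\<^sup>2)) *\<^sub>R Gw x + (damp_deriv (L x) * arctan (w x)) *\<^sub>R d x)"
proof (rule weak_gradient_chain_rule[OF \<Omega> w L, where B = 3 and F = "\<lambda>s t. damp t * arctan s"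
      and Fs = "\<lambda>s t. damp t / (1 + s\<^sup>2)" and Ft = "\<lambda>s t. damp_deriv t * arctan s"])
  fix s t :: real
  have 1: "((\<lambda>p. damp (snd p)) has_derivative (\<lambda>h. snd h * damp_deriv t)) (at (s, t))"
    by (rule DERIV_compose_FDERIV[OF _ has_derivative_snd[OF has_derivative_ident]]) (simp add: has_real_derivative_damp)
  have 3: "((\<lambda>p. arctan (fst p)) has_derivative (\<lambda>h. fst h * inverse (1 + s\<^sup>2))) (at (s, t))"
    by (rule DERIV_compose_FDERIV[OF _ has_derivative_fst[OF has_derivative_ident]]) (simp add: DERIV_arctan)
  show "((\<lambda>p. damp (snd p) * arctan (fst p)) has_derivative
     (\<lambda>h. damp t / (1 + s\<^sup>2) * fst h + damp_deriv t * arctan s * snd h)) (at (s, t))"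
    by (rule has_derivative_eq_rhs[OF has_derivative_mult[OF 1 3]])
       (simp add: fun_eq_iff algebra_simps divide_inverse)
  have "\<bar>damp t / (1 + s\<^sup>2)\<bar> \<le> 1"
    using damp_bounds[of t] one_plus_sq(2) by (intro abs_divide_le_one) auto
  then show "\<bar>damp t / (1 + s\<^sup>2)\<bar> \<le> 3" by linarith
  have "\<bar>damp_deriv t * arctan s\<bar> \<le> 1 * 2"
    unfolding abs_mult using damp_bounds(4) abs_arctan_le by (intro mult_mono) auto
  then show "\<bar>damp_deriv t * arctan s\<bar> \<le> 3" by linarith
next
  have c: "continuous_on UNIV (\<lambda>p :: real \<times> real. damp (snd p))"
    "continuous_on UNIV (\<lambda>p :: real \<times> real. damp_deriv (snd p))"
    by (rule continuous_on_compose2[OF damp_cont(1)[of UNIV]], auto intro!: continuous_intros)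
       (rule continuous_on_compose2[OF damp_cont(2)[of UNIV]], auto intro!: continuous_intros)
  show "continuous_on UNIV (\<lambda>p. damp (snd p) / (1 + (fst p)\<^sup>2))"
    using one_plus_sq(1) by (intro continuous_intros c) (simp add: less_imp_neq[symmetric])
  show "continuous_on UNIV (\<lambda>p. damp_deriv (snd p) * arctan (fst p))"
    by (intro continuous_intros c)
qed

text \<open>The same damped function is differentiated as a function of \<open>(u, ln v)\<close> and as a function of
  \<open>(u/v, ln v)\<close>. By uniqueness of weak gradients the two results agree; the terms containing
  \<open>damp_deriv\<close> cancel, and what remains is the quotient rule times the positive factor
  \<open>\<beta> = damp (ln v) / (1 + (u/v)\<^sup>2)\<close>.\<close>
lemma weak_gradient_quotient:
  assumes \<Omega>: "open \<Omega>" and u: "has_weak_gradient \<Omega> u Gu" and d: "has_weak_gradient \<Omega> (\<lambda>x. ln (v x)) d"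
    and w: "has_weak_gradient \<Omega> (\<lambda>x. u x / v x) Gw" and v: "AE x in lebesgue_on \<Omega>. v x > 0"
  shows "AE x in lebesgue_on \<Omega>. Gu x - u x *\<^sub>R d x = v x *\<^sub>R Gw x"
proof -
  have ev: "u x * exp (- ln (v x)) = u x / v x" if "v x > 0" for x
    using that by (simp add: exp_minus divide_inverse)
  have "AE x in lebesgue_on \<Omega>. damp (ln (v x)) * arctan (u x * exp (- ln (v x))) = damp (ln (v x)) * arctan (u x / v x)"
    using v by eventually_elim (simp add: ev)
  from weak_gradient_unique[OF \<Omega> weak_gradient_damped_quotient[OF \<Omega> u d] weak_gradient_damped[OF \<Omega> w d] this] v
  show ?thesis
  proof eventually_elim
    case (elim x)
    define y where "y = u x / v x"
    define \<beta> where "\<beta> = damp (ln (v x)) / (1 + y\<^sup>2)"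
    have \<beta>: "\<beta> > 0" using damp_bounds(1) one_plus_sq(1) by (simp add: \<beta>_def)
    have e: "exp (- ln (v x)) = 1 / v x" using elim(2) by (simp add: exp_minus divide_inverse)
    have 1: "damp (ln (v x)) * exp (- ln (v x)) / (1 + y\<^sup>2) = \<beta> / v x"
      "damp (ln (v x)) * (y / (1 + y\<^sup>2)) = \<beta> * y" by (simp_all add: \<beta>_def e)
    have "(\<beta> / v x) *\<^sub>R Gu x - (\<beta> * y) *\<^sub>R d x = \<beta> *\<^sub>R Gw x"
      using elim(1) unfolding ev[OF elim(2)] y_def[symmetric] 1 \<beta>_def[symmetric] by (simp add: algebra_simps)
    then have "\<beta> *\<^sub>R (Gu x - u x *\<^sub>R d x) = \<beta> *\<^sub>R (v x *\<^sub>R Gw x)"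
      using elim(2) by (auto simp: y_def vec_eq_iff field_simps)
    then show ?case by (rule scaleR_left_imp_eq[rotated]) (use \<beta> in simp)
  qed
qed

section \<open>Steady states of osmosis\<close>

lemma locally_integrable_measurable:
  fixes G :: "real^2 \<Rightarrow> 'b::{banach, second_countable_topology}"
  assumes \<Omega>: "open \<Omega>" and G: "locally_integrable \<Omega> G"
  shows "G \<in> borel_measurable (lebesgue_on \<Omega>)"
proof -
  obtain C :: "nat \<Rightarrow> (real^2) set" where C: "\<And>n. compact (C n)" "\<And>n. C n \<subseteq> \<Omega>"
    "\<And>K. compact K \<Longrightarrow> K \<subseteq> \<Omega> \<Longrightarrow> \<exists>N. \<forall>n\<ge>N. K \<subseteq> C n"
    by (rule open_Union_compact_subsets[OF \<Omega>]) (rule that)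
  show ?thesis
  proof (rule borel_measurable_LIMSEQ_metric)
    fix n
    have "integrable lebesgue (\<lambda>x. if x \<in> C n then G x else 0)"
      using G C(1,2)[of n] by (subst Lebesgue_Measure.integrable_restrict_UNIV)
        (auto simp: locally_integrable_def intro: fmeasurableD lmeasurable_compact)
    then show "(\<lambda>x. if x \<in> C n then G x else 0) \<in> borel_measurable (lebesgue_on \<Omega>)"
      by (intro measurable_restrict_space1) auto
  next
    fix x assume "x \<in> space (lebesgue_on \<Omega>)"
    then obtain N where "\<forall>n\<ge>N. {x} \<subseteq> C n" using C(3)[of "{x}"] by auto
    then show "(\<lambda>n. if x \<in> C n then G x else 0) \<longlonglongrightarrow> G x"
      by (intro tendsto_eventually) (auto simp: eventually_sequentially)
  qed
qed

lemma locally_integrable_continuous: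
  fixes f :: "real^2 \<Rightarrow> 'b::{banach, second_countable_topology}"
  assumes "continuous_on UNIV f" shows "locally_integrable \<Omega> f"
  unfolding locally_integrable_def
proof (intro allI impI)
  fix K assume K: "compact K \<and> K \<subseteq> \<Omega>"
  have Ks: "K \<in> sets lebesgue" using K lmeasurable_compact by (auto intro: fmeasurableD)
  obtain M where M: "M > 0" "\<And>x. x \<in> K \<Longrightarrow> norm (f x) \<le> M"
    using compact_imp_bounded[OF compact_continuous_image[OF continuous_on_subset[OF assms subset_UNIV]]] K
    unfolding bounded_pos by (metis imageI)
  have "integrable lebesgue (\<lambda>x. if x \<in> K then f x else 0)"
    using K M Ks continuous_imp_lebesgue_measurable[OF assms]
    by (intro integrable_bounded_compact[of _ K M]) auto
  then show "integrable (lebesgue_on K) f" using Lebesgue_Measure.integrable_restrict_UNIV[OF Ks, of f] by simp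
qed

text \<open>Functions smooth up to the boundary are needed as quotients \<open>z/v\<close> in the first variation.\<close>
lemma smooth_has_weak_gradient:
  assumes "open \<Omega>" "smooth \<phi>" shows "has_weak_gradient \<Omega> \<phi> (grad \<phi>)"
  unfolding has_weak_gradient_iff[OF assms(1)]
  using integration_by_parts[OF _ smooth_differentiable[OF assms(2)] smooth_grad_continuous[OF assms(2)]]
    locally_integrable_continuous[OF smooth_continuous[OF assms(2)]]
    locally_integrable_continuous[OF smooth_grad_continuous[OF assms(2)]] by blast

lemma has_weak_gradient_cong:
  assumes \<Omega>: "open \<Omega>" and w: "has_weak_gradient \<Omega> w G"
    and m: "w' \<in> borel_measurable (lebesgue_on \<Omega>)" and ww: "AE x in lebesgue_on \<Omega>. w x = w' x"
  shows "has_weak_gradient \<Omega> w' G"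
proof -
  have \<Omega>s: "\<Omega> \<in> sets lebesgue" using \<Omega> by auto
  note W = w[unfolded has_weak_gradient_iff[OF \<Omega>]]
  have ww': "AE x in lebesgue. x \<in> \<Omega> \<longrightarrow> w x = w' x"
    using ww \<Omega> by (subst (asm) AE_restrict_space_iff) auto
  have l: "locally_integrable \<Omega> w'"
    unfolding locally_integrable_def
  proof (intro allI impI)
    fix K assume K: "compact K \<and> K \<subseteq> \<Omega>"
    then have Ks: "K \<in> sets lebesgue" using lmeasurable_compact by (auto intro: fmeasurableD)
    show "integrable (lebesgue_on K) w'"
    proof (rule integrable_cong_AE_imp)
      show "integrable (lebesgue_on K) w" using W K by (auto simp: locally_integrable_def)
      show "w' \<in> borel_measurable (lebesgue_on K)"
        using m K by (meson measurable_restrict_mono)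
      show "AE x in lebesgue_on K. w x = w' x"
        using ww' K Ks by (subst AE_restrict_space_iff) (auto elim!: eventually_mono)
    qed
  qed
  have "(\<integral>x. w' x * grad \<phi> x $ i \<partial>lebesgue) = (\<integral>x. w x * grad \<phi> x $ i \<partial>lebesgue)" if \<phi>: "\<phi> \<in> test_functions \<Omega>" for \<phi> i
  proof -
    obtain C where C: "C \<subseteq> \<Omega>" "\<And>x. x \<notin> C \<Longrightarrow> grad \<phi> x = 0"
      by (rule test_functionsE[OF \<phi>]) (rule that)
    show ?thesis
    proof (rule integral_cong_AE)
      show "AE x in lebesgue. w' x * grad \<phi> x $ i = w x * grad \<phi> x $ i"
        using ww' by eventually_elim (use C in force)
    qed (use W l \<phi> locally_integrable_times_grad in blast)+
  qed
  then show ?thesis using W l unfolding has_weak_gradient_iff[OF \<Omega>] by simp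
qed

lemma weakly_differentiable_weak_gradient:
  "weakly_differentiable \<Omega> w \<Longrightarrow> has_weak_gradient \<Omega> w (weak_gradient \<Omega> w)"
  unfolding weakly_differentiable_def weak_gradient_def
  using someI_ex[of "has_weak_gradient \<Omega> w"] by simp

lemma finite_energyD:
  assumes \<Omega>: "open \<Omega>" and E: "energy \<Omega> v z < \<infinity>"
  shows "has_weak_gradient \<Omega> (\<lambda>x. z x / v x) (weak_gradient \<Omega> (\<lambda>x. z x / v x))"
    and "integrable (lebesgue_on \<Omega>) (weak_gradient \<Omega> (\<lambda>x. z x / v x))"
proof -
  have wd: "weakly_differentiable \<Omega> (\<lambda>x. z x / v x)" using E by (simp add: energy_def split: if_splits)
  then show h: "has_weak_gradient \<Omega> (\<lambda>x. z x / v x) (weak_gradient \<Omega> (\<lambda>x. z x / v x))"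
    by (rule weakly_differentiable_weak_gradient)
  have "weak_gradient \<Omega> (\<lambda>x. z x / v x) \<in> borel_measurable (lebesgue_on \<Omega>)"
    using h by (intro locally_integrable_measurable[OF \<Omega>]) (simp add: has_weak_gradient_def)
  then show "integrable (lebesgue_on \<Omega>) (weak_gradient \<Omega> (\<lambda>x. z x / v x))"
    using E wd by (intro integrableI_bounded) (simp_all add: energy_def)
qed

text \<open>The value \<open>sgn 0 = 0\<close> is the convention for \<open>s/|s|\<close>, and the sign is insensitive to the positive factor \<open>v\<close>.\<close>
lemma osmosis_flux_sgn: "osmosis_flux \<Omega> d u x = sgn (drift_gradient \<Omega> d u x)"
  by (simp add: osmosis_flux_def diffusivity_def sgn_div_norm divide_inverse)

lemma first_variation_flux:
  "first_variation \<Omega> v d u z = (\<integral>x. osmosis_flux \<Omega> d u x \<bullet> weak_gradient \<Omega> (\<lambda>x. z x / v x) x \<partial>lebesgue_on \<Omega>)"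
  unfolding first_variation_def osmosis_flux_sgn sgn_div_norm ..

lemma osmosis_flux_measurable:
  assumes "open \<Omega>" "weakly_differentiable \<Omega> u" "has_weak_gradient \<Omega> l d"
  shows "osmosis_flux \<Omega> d u \<in> borel_measurable (lebesgue_on \<Omega>)"
proof -
  have "u \<in> borel_measurable (lebesgue_on \<Omega>)" "weak_gradient \<Omega> u \<in> borel_measurable (lebesgue_on \<Omega>)"
    "d \<in> borel_measurable (lebesgue_on \<Omega>)"
    using weakly_differentiable_weak_gradient[OF assms(2)] assms(3) locally_integrable_measurable[OF assms(1)]
    by (auto simp: has_weak_gradient_def)
  then have "(\<lambda>x. weak_gradient \<Omega> u x - u x *\<^sub>R d x) \<in> borel_measurable (lebesgue_on \<Omega>)"
    by (intro borel_measurable_diff borel_measurable_scaleR)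
  then show ?thesis
    unfolding osmosis_flux_sgn[abs_def] drift_gradient_def by (rule measurable_compose[OF _ borel_measurable_sgn])
qed

lemma norm_osmosis_flux_le: "norm (osmosis_flux \<Omega> d u x) \<le> 1"
  by (simp add: osmosis_flux_sgn norm_sgn)

lemma integrable_bounded_box:
  fixes f :: "real^2 \<Rightarrow> 'b::{banach, second_countable_topology}"
  assumes "\<Omega> = box a b" "f \<in> borel_measurable (lebesgue_on \<Omega>)" "\<And>x. x \<in> \<Omega> \<Longrightarrow> norm (f x) \<le> B"
  shows "integrable (lebesgue_on \<Omega>) f"
proof -
  interpret finite_measure "lebesgue_on \<Omega>"
    using assms(1) by (intro finite_measure_lebesgue_on) (simp add: lmeasurable_box)
  show ?thesis using assms(2,3) by (intro integrable_const_bound[of _ B]) auto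
qed

text \<open>The flux is bounded by \<open>1\<close>, so all integrability conditions hold. The vanishing of the divergence is
  the identity for \<open>\<phi>\<close> with compact support, hence a special case of the vanishing of the normal trace.\<close>
lemma steady_state_iff:
  assumes \<Omega>: "\<Omega> = box a b" and u: "weakly_differentiable \<Omega> u" and d: "has_weak_gradient \<Omega> l d"
  shows "satisfies_steady_state_equation \<Omega> d u \<longleftrightarrow>
    (\<forall>\<phi>. smooth \<phi> \<longrightarrow> (\<integral>x. osmosis_flux \<Omega> d u x \<bullet> grad \<phi> x \<partial>lebesgue_on \<Omega>) = 0)"
proof -
  have op: "open \<Omega>" by (simp add: \<Omega> open_box)
  note m = osmosis_flux_measurable[OF op u d]
  have i: "integrable (lebesgue_on \<Omega>) (osmosis_flux \<Omega> d u)"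
    by (rule integrable_bounded_box[OF \<Omega> m norm_osmosis_flux_le])
  have "locally_integrable \<Omega> (osmosis_flux \<Omega> d u)"
    unfolding locally_integrable_def
  proof (intro allI impI)
    fix K assume K: "compact K \<and> K \<subseteq> \<Omega>"
    then interpret finite_measure "lebesgue_on K"
      by (intro finite_measure_lebesgue_on lmeasurable_compact) auto
    have "osmosis_flux \<Omega> d u \<in> borel_measurable (lebesgue_on K)"
      using m K by (meson measurable_restrict_mono)
    then show "integrable (lebesgue_on K) (osmosis_flux \<Omega> d u)"
      using norm_osmosis_flux_le by (intro integrable_const_bound[of _ 1]) auto
  qed
  moreover have "locally_integrable \<Omega> (\<lambda>x. 0 :: real)" by (simp add: locally_integrable_def)
  ultimately show ?thesis
    using u i by (auto simp: satisfies_steady_state_equation_def has_weak_divergence_def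
        has_zero_normal_trace_def normal_trace_def test_functions_def)
qed

text \<open>If \<open>\<phi>\<close> is smooth, then \<open>z = \<phi> v\<close> has finite energy and \<open>z/v = \<phi>\<close> almost everywhere, so the first
  variation in direction \<open>z\<close> is the integral on the right. The other direction is
  lemma \<open>divergence_free_pairing\<close> applied to the flux and \<open>z/v\<close>.\<close>
lemma stationary_iff:
  assumes \<Omega>: "\<Omega> = box a b" "\<And>i. a $ i < b $ i" and u: "weakly_differentiable \<Omega> u" "energy \<Omega> v u < \<infinity>"
    and d: "has_weak_gradient \<Omega> l d"
    and v: "v \<in> borel_measurable (lebesgue_on \<Omega>)" "AE x in lebesgue_on \<Omega>. v x > 0"
  shows "stationary_point \<Omega> v d u \<longleftrightarrow>
    (\<forall>\<phi>. smooth \<phi> \<longrightarrow> (\<integral>x. osmosis_flux \<Omega> d u x \<bullet> grad \<phi> x \<partial>lebesgue_on \<Omega>) = 0)"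
proof -
  have op: "open \<Omega>" by (simp add: \<Omega> open_box)
  note m = osmosis_flux_measurable[OF op u(1) d]
  have 1: "(\<integral>x. osmosis_flux \<Omega> d u x \<bullet> grad \<phi> x \<partial>lebesgue_on \<Omega>) = 0"
    if st: "stationary_point \<Omega> v d u" and \<phi>: "smooth \<phi>" for \<phi>
  proof -
    define z where "z x = \<phi> x * v x" for x
    define Z where "Z = weak_gradient \<Omega> (\<lambda>x. z x / v x)"
    have h\<phi>: "has_weak_gradient \<Omega> \<phi> (grad \<phi>)" by (rule smooth_has_weak_gradient[OF op \<phi>])
    have \<phi>z: "AE x in lebesgue_on \<Omega>. \<phi> x = z x / v x" using v(2) by eventually_elim (simp add: z_def)
    have \<phi>m: "\<phi> \<in> borel_measurable (lebesgue_on \<Omega>)" "grad \<phi> \<in> borel_measurable (lebesgue_on \<Omega>)"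
      using continuous_imp_lebesgue_measurable[OF smooth_continuous[OF \<phi>]]
        continuous_imp_lebesgue_measurable[OF smooth_grad_continuous[OF \<phi>]]
      by (auto intro: measurable_restrict_space1)
    have hz: "has_weak_gradient \<Omega> (\<lambda>x. z x / v x) (grad \<phi>)"
      by (rule has_weak_gradient_cong[OF op h\<phi> _ \<phi>z]) (use \<phi>m v(1) in \<open>simp add: z_def\<close>)
    then have wd: "weakly_differentiable \<Omega> (\<lambda>x. z x / v x)" by (auto simp: weakly_differentiable_def)
    from weak_gradient_unique[OF op weakly_differentiable_weak_gradient[OF wd] hz]
    have Z: "AE x in lebesgue_on \<Omega>. Z x = grad \<phi> x" by (simp add: Z_def)
    have Zm: "Z \<in> borel_measurable (lebesgue_on \<Omega>)"
      using weakly_differentiable_weak_gradient[OF wd] unfolding Z_def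
      by (intro locally_integrable_measurable[OF op]) (simp add: has_weak_gradient_def)
    obtain M where M: "\<And>x. x \<in> cbox a b \<Longrightarrow> norm (grad \<phi> x) \<le> M"
      using compact_imp_bounded[OF compact_continuous_image[OF smooth_grad_continuous[OF \<phi>] compact_cbox]]
      unfolding bounded_iff by (metis imageI)
    have ig: "integrable (lebesgue_on \<Omega>) (grad \<phi>)"
      by (rule integrable_bounded_box[OF \<Omega>(1) \<phi>m(2), of M]) (use M box_subset_cbox[of a b] \<Omega>(1) in blast)
    have "energy \<Omega> v z = (\<integral>\<^sup>+x. ennreal (norm (Z x)) \<partial>lebesgue_on \<Omega>)"
      using wd by (simp add: energy_def Z_def)
    also have "\<dots> = (\<integral>\<^sup>+x. ennreal (norm (grad \<phi> x)) \<partial>lebesgue_on \<Omega>)"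
      using Z by (intro nn_integral_cong_AE) auto
    also have "\<dots> < \<infinity>" using ig by (simp add: integrable_iff_bounded)
    finally have "first_variation \<Omega> v d u z = 0" using st by (simp add: stationary_point_def)
    then have "(\<integral>x. osmosis_flux \<Omega> d u x \<bullet> Z x \<partial>lebesgue_on \<Omega>) = 0" by (simp add: first_variation_flux Z_def)
    also have "(\<integral>x. osmosis_flux \<Omega> d u x \<bullet> Z x \<partial>lebesgue_on \<Omega>) = (\<integral>x. osmosis_flux \<Omega> d u x \<bullet> grad \<phi> x \<partial>lebesgue_on \<Omega>)"
      using Z m Zm \<phi>m by (intro integral_cong_AE) auto
    finally show ?thesis .
  qed
  have "first_variation \<Omega> v d u z = 0"
    if S: "\<And>\<phi>. smooth \<phi> \<Longrightarrow> (\<integral>x. osmosis_flux \<Omega> d u x \<bullet> grad \<phi> x \<partial>lebesgue_on \<Omega>) = 0"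
      and E: "energy \<Omega> v z < \<infinity>" for z
    unfolding first_variation_flux
    by (rule divergence_free_pairing[OF \<Omega> m norm_osmosis_flux_le S finite_energyD[OF op E]])
  then show ?thesis using u(2) 1 unfolding stationary_point_def by blast
qed

text \<open>A stationary point has finite energy and is therefore an admissible direction. The flux is the sign of
  \<open>\<nabla>(u/v)\<close>, so the first variation at \<open>u\<close> in direction \<open>u\<close> is the integral of \<open>|\<nabla>(u/v)|\<close>.\<close>
lemma stationary_point_multiple:
  assumes \<Omega>: "\<Omega> = box a b" and u: "weakly_differentiable \<Omega> u" and st: "stationary_point \<Omega> v d u"
    and d: "has_weak_gradient \<Omega> (\<lambda>x. ln (v x)) d" and v: "AE x in lebesgue_on \<Omega>. v x > 0"
  shows "\<exists>c. AE x in lebesgue_on \<Omega>. u x = c * v x"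
proof -
  have op: "open \<Omega>" and cx: "convex \<Omega>" by (simp_all add: \<Omega> open_box)
  have E: "energy \<Omega> v u < \<infinity>" using st by (simp add: stationary_point_def)
  define W where "W = weak_gradient \<Omega> (\<lambda>x. u x / v x)"
  note W = finite_energyD[OF op E, folded W_def]
  have dg: "AE x in lebesgue_on \<Omega>. drift_gradient \<Omega> d u x = v x *\<^sub>R W x"
    unfolding drift_gradient_def
    by (rule weak_gradient_quotient[OF op weakly_differentiable_weak_gradient[OF u] d W(1) v])
  have Wm: "W \<in> borel_measurable (lebesgue_on \<Omega>)" using W(2) by simp
  have "AE x in lebesgue_on \<Omega>. osmosis_flux \<Omega> d u x \<bullet> W x = norm (W x)"
    using dg v
  proof eventually_elim
    case (elim x)
    have "sgn (W x) \<bullet> W x = norm (W x)"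
      by (cases "W x = 0") (simp_all add: sgn_div_norm power2_norm_eq_inner[symmetric] power2_eq_square)
    then show ?case using elim by (simp add: osmosis_flux_sgn sgn_scaleR)
  qed
  moreover have "(\<integral>x. osmosis_flux \<Omega> d u x \<bullet> W x \<partial>lebesgue_on \<Omega>) = 0"
    using st E by (simp add: stationary_point_def first_variation_flux W_def)
  ultimately have "(\<integral>x. norm (W x) \<partial>lebesgue_on \<Omega>) = 0"
    using osmosis_flux_measurable[OF op u d] Wm
    by (subst integral_cong_AE[of "\<lambda>x. norm (W x)" _ "\<lambda>x. osmosis_flux \<Omega> d u x \<bullet> W x"]) auto
  then have "AE x in lebesgue_on \<Omega>. W x = 0"
    using W(2) by (subst (asm) integral_nonneg_eq_0_iff_AE) auto
  from weak_gradient_zero_imp_constant[OF op cx W(1) this]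
  obtain c where "AE x in lebesgue_on \<Omega>. u x / v x = c" by blast
  with v have "AE x in lebesgue_on \<Omega>. u x = c * v x"
    by eventually_elim (auto simp: field_simps)
  then show ?thesis by blast
qed

text \<open>With the constant test function \<open>1\<close> the normal trace condition reads \<open>\<integral>(u(t) - f) = 0\<close>.\<close>
lemma steady_state_mass:
  assumes \<Omega>: "\<Omega> = box a b" and st: "steady_state_of_evolution \<Omega> d f us"
  shows "(\<integral>x. us x \<partial>lebesgue_on \<Omega>) = (\<integral>x. f x \<partial>lebesgue_on \<Omega>)"
proof -
  obtain u where u: "osmosis_evolution \<Omega> d f u" and us: "integrable (lebesgue_on \<Omega>) us"
    and lim: "((\<lambda>t. \<integral>x. \<bar>u t x - us x\<bar> \<partial>lebesgue_on \<Omega>) \<longlongrightarrow> 0) at_top"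
    using st by (auto simp: steady_state_of_evolution_def)
  have ut: "integrable (lebesgue_on \<Omega>) (u t)" if "t \<ge> 0" for t using u that by (simp add: osmosis_evolution_def)
  have mass: "(\<integral>x. u t x \<partial>lebesgue_on \<Omega>) = (\<integral>x. f x \<partial>lebesgue_on \<Omega>)" if t0: "t \<ge> 0" for t
  proof -
    obtain \<xi> where "\<forall>t\<ge>0.
       has_weak_divergence \<Omega> (\<lambda>x. \<integral>\<tau>. \<xi> \<tau> x \<partial>lebesgue_on {0<..t}) (\<lambda>x. u t x - f x) \<and>
       has_zero_normal_trace \<Omega> (\<lambda>x. \<integral>\<tau>. \<xi> \<tau> x \<partial>lebesgue_on {0<..t}) (\<lambda>x. u t x - f x)"
      using u unfolding osmosis_evolution_def by (elim conjE exE) (rule that)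
    then have \<xi>: "has_zero_normal_trace \<Omega> (\<lambda>x. \<integral>\<tau>. \<xi> \<tau> x \<partial>lebesgue_on {0<..t}) (\<lambda>x. u t x - f x)"
      using t0 by simp
    then have i: "integrable (lebesgue_on \<Omega>) (\<lambda>x. u t x - f x)"
      and "normal_trace \<Omega> (\<lambda>x. \<integral>\<tau>. \<xi> \<tau> x \<partial>lebesgue_on {0<..t}) (\<lambda>x. u t x - f x) (\<lambda>x. 1) = 0"
      using smooth_const[of 1] by (simp_all add: has_zero_normal_trace_def)
    then have 0: "(\<integral>x. u t x - f x \<partial>lebesgue_on \<Omega>) = 0" by (simp add: normal_trace_def grad_const)
    have "integrable (lebesgue_on \<Omega>) f"
      using Bochner_Integration.integrable_diff[OF ut[OF t0] i] by simp
    with 0 ut[OF t0] show ?thesis by simp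
  qed
  have "((\<lambda>t. (\<integral>x. f x \<partial>lebesgue_on \<Omega>) - (\<integral>x. us x \<partial>lebesgue_on \<Omega>)) \<longlongrightarrow> 0) (at_top :: real filter)"
  proof (rule Lim_null_comparison[OF _ lim])
    show "eventually (\<lambda>t. norm ((\<integral>x. f x \<partial>lebesgue_on \<Omega>) - (\<integral>x. us x \<partial>lebesgue_on \<Omega>)) \<le> (\<integral>x. \<bar>u t x - us x\<bar> \<partial>lebesgue_on \<Omega>)) at_top"
      using eventually_ge_at_top[of 0]
    proof eventually_elim
      case (elim t)
      have "(\<integral>x. f x \<partial>lebesgue_on \<Omega>) - (\<integral>x. us x \<partial>lebesgue_on \<Omega>) = (\<integral>x. u t x - us x \<partial>lebesgue_on \<Omega>)"
        using mass[OF elim] ut[OF elim] us by simp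
      then show ?case using integral_norm_bound[of "lebesgue_on \<Omega>" "\<lambda>x. u t x - us x"] by simp
    qed
  qed
  then show ?thesis by (simp add: tendsto_const_iff)
qed

lemma integral_pos_box:
  assumes \<Omega>: "\<Omega> = box a b" "\<And>i. a $ i < b $ i" and v: "in_H1 \<Omega> v" "AE x in lebesgue_on \<Omega>. v x > 0"
  shows "measure lebesgue \<Omega> > 0" "integrable (lebesgue_on \<Omega>) v" "(\<integral>x. v x \<partial>lebesgue_on \<Omega>) > 0"
proof -
  have "(1/2) *\<^sub>R (a + b) \<in> \<Omega>" using \<Omega>(2) by (simp add: \<Omega>(1) mem_box_cart field_simps)
  then have ne: "\<Omega> \<noteq> {}" by blast
  have nn: "\<Omega> \<notin> null_sets lebesgue"
    using open_not_negligible[of \<Omega>] ne \<Omega>(1) by (auto simp: negligible_iff_null_sets)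
  have lm: "\<Omega> \<in> lmeasurable" using \<Omega>(1) by (simp add: lmeasurable_box)
  then show "measure lebesgue \<Omega> > 0"
    using nn negligible_iff_measure[of \<Omega>] measure_nonneg[of lebesgue \<Omega>]
    by (auto simp: negligible_iff_null_sets less_le)
  interpret finite_measure "lebesgue_on \<Omega>" by (rule finite_measure_lebesgue_on[OF lm])
  have vm: "v \<in> borel_measurable (lebesgue_on \<Omega>)" and v2: "integrable (lebesgue_on \<Omega>) (\<lambda>x. (v x)\<^sup>2)"
    using v(1) by (auto simp: in_H1_def)
  show iv: "integrable (lebesgue_on \<Omega>) v"
  proof (rule Bochner_Integration.integrable_bound[OF _ vm])
    show "integrable (lebesgue_on \<Omega>) (\<lambda>x. 1 + (v x)\<^sup>2)" using v2 by auto
    have "\<bar>y\<bar> \<le> 1 + y\<^sup>2" for y :: real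
      using abs_frac_le_one[of y] one_plus_sq(1)[of y] by (simp add: abs_divide divide_le_eq)
    then show "AE x in lebesgue_on \<Omega>. norm (v x) \<le> norm (1 + (v x)\<^sup>2)"
      by (intro AE_I2) (simp add: order_trans[OF _ abs_ge_self])
  qed
  have v0: "AE x in lebesgue_on \<Omega>. 0 \<le> v x" using v(2) by eventually_elim simp
  have "(\<integral>x. v x \<partial>lebesgue_on \<Omega>) \<noteq> 0"
  proof
    assume "(\<integral>x. v x \<partial>lebesgue_on \<Omega>) = 0"
    then have "AE x in lebesgue_on \<Omega>. v x = 0" using integral_nonneg_eq_0_iff_AE[OF iv v0] by simp
    with v(2) have "AE x in lebesgue_on \<Omega>. False" by eventually_elim simp
    then have "AE x in lebesgue. x \<notin> \<Omega>" using lm by (subst (asm) AE_restrict_space_iff) (auto dest: fmeasurableD)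
    then show False using nn lm by (subst (asm) AE_iff_null_sets[symmetric]) (auto dest: fmeasurableD)
  qed
  then show "(\<integral>x. v x \<partial>lebesgue_on \<Omega>) > 0" using integral_nonneg_AE[OF v0] by linarith
qed

theorem proposition3p3:
  fixes a b :: "real^2" and \<Omega> :: "(real^2) set"
    and v us :: "real^2 \<Rightarrow> real" and d :: "real^2 \<Rightarrow> real^2"
  assumes rectangle: "\<Omega> = box a b" "a $ 1 < b $ 1" "a $ 2 < b $ 2"
    and v_H1: "in_H1 \<Omega> v"
    and v_pos: "AE x in lebesgue_on \<Omega>. v x > 0"
    and drift: "has_weak_gradient \<Omega> (\<lambda>x. ln (v x)) d"
    and us_nonneg: "AE x in lebesgue_on \<Omega>. us x \<ge> 0"
    and us_regular: "weakly_differentiable \<Omega> us" "energy \<Omega> v us < \<infinity>"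
  shows "(satisfies_steady_state_equation \<Omega> d us \<longleftrightarrow> stationary_point \<Omega> v d us) \<and>
         (\<forall>f. in_Linf \<Omega> f \<longrightarrow> (AE x in lebesgue_on \<Omega>. f x > 0) \<longrightarrow>
              steady_state_of_evolution \<Omega> d f us \<longrightarrow>
              (AE x in lebesgue_on \<Omega>.
                 us x = average_grey_value \<Omega> f / average_grey_value \<Omega> v * v x))"
proof (intro conjI allI impI)
  have ab: "a $ i < b $ i" for i using rectangle(2,3) exhaust_2[of i] by auto
  have vm: "v \<in> borel_measurable (lebesgue_on \<Omega>)" using v_H1 by (simp add: in_H1_def)
  show equiv: "satisfies_steady_state_equation \<Omega> d us \<longleftrightarrow> stationary_point \<Omega> v d us"
    unfolding steady_state_iff[OF rectangle(1) us_regular(1) drift]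
      stationary_iff[OF rectangle(1) ab us_regular drift vm v_pos] ..
  fix f assume st: "steady_state_of_evolution \<Omega> d f us"
  then have "stationary_point \<Omega> v d us" using equiv by (simp add: steady_state_of_evolution_def)
  from stationary_point_multiple[OF rectangle(1) us_regular(1) this drift v_pos]
  obtain c where c: "AE x in lebesgue_on \<Omega>. us x = c * v x" by blast
  note v = integral_pos_box[OF rectangle(1) ab v_H1 v_pos]
  have "us \<in> borel_measurable (lebesgue_on \<Omega>)" using st by (auto simp: steady_state_of_evolution_def)
  then have "(\<integral>x. us x \<partial>lebesgue_on \<Omega>) = (\<integral>x. c * v x \<partial>lebesgue_on \<Omega>)"
    using c vm by (intro integral_cong_AE) auto
  then have "(\<integral>x. f x \<partial>lebesgue_on \<Omega>) = c * (\<integral>x. v x \<partial>lebesgue_on \<Omega>)"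
    by (simp add: steady_state_mass[OF rectangle(1) st])
  then have "average_grey_value \<Omega> f / average_grey_value \<Omega> v = c"
    using v(1,3) by (simp add: average_grey_value_def)
  with c show "AE x in lebesgue_on \<Omega>. us x = average_grey_value \<Omega> f / average_grey_value \<Omega> v * v x"
    by simp
qed

end
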